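(* Let $k$ be a finite field of characteristic $3$. Let $C$ be a genus $2$ curve defined over $k$ and let $(g_1,g_2,g_3)$ be its absolute invariants. Then $C$ is non-ordinary (i.e. has $3$-rank exactly $1$) if and only if $g_1 = 0$, $g_2 \in k^\times$, and $g_3 \in k$.
   Context: Curves are smooth, projective and geometrically irreducible; $k^{\mathrm{alg}}$ denotes an algebraic closure of $k$. $p$-rank: for a genus $2$ curve $C$ over a field $k$ of characteristic $p$, the $p$-rank of $C$ is the integer $f \in \{0,1,2\}$ with $\mathrm{Jac}(C)[p](k^{\mathrm{alg}}) \cong (\mathbb{Z}/p\mathbb{Z})^f$. The curve $C$ is called ordinary if $f=2$, non-ordinary if $f=1$ (exactly), and supersingular if $f=0$. In particular, "non-ordinary" does not include the supersingular case. Igusa invariants: in characteristic different from $2$, let $C$ be given by $y^2 = F(x)$ with $F = c_6x^6+\dots+c_0$ separable of degree $5$ or $6$ (viewed as a binary sextic form, with a root at infinity if $c_6=0$). The Igusa invariants $[J_2:J_4:J_6:J_8:J_{10}]$ are a point of the weighted projective space $\mathbb{P}(2,4,6,8,10)$, where the $J_{2i}$ are the polynomials in $c_0,\dots,c_6$ with coefficients in $\mathbb{Z}[1/2]$ defined as follows. Over characteristic $0$, for $F$ of degree $6$ with roots $x_1,\dots,x_6$ and $(ij)=x_i-x_j$, put $I_2 = c_6^2\sum_{15}(12)^2(34)^2(56)^2$, $I_4 = c_6^4\sum_{10}(12)^2(23)^2(31)^2(45)^2(56)^2(64)^2$, $I_6 = c_6^6\sum_{60}(12)^2(23)^2(31)^2(45)^2(56)^2(64)^2(14)^2(25)^2(36)^2$,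 $I_{10} = c_6^{10}\prod_{i<j}(ij)^2$ (the discriminant), where each sum is over the indicated number of distinct expressions obtained by permuting the indices. Then $J_2 = I_2/8$, $J_4=(4J_2^2-I_4)/96$, $J_6 = (8J_2^3-160J_2J_4-I_6)/576$, $J_8=(J_2J_6-J_4^2)/4$, $J_{10}=I_{10}/2^{12}$. These are polynomials in the $c_i$ over $\mathbb{Z}[1/2]$ and hence make sense in every characteristic different from $2$. Absolute invariants: $(g_1,g_2,g_3)$ is defined by $\left(\frac{J_2^5}{J_{10}}, \frac{J_2^3J_4}{J_{10}}, \frac{J_2^2J_6}{J_{10}}\right)$ if $J_2\neq 0$; $\left(0,\frac{J_4^5}{J_{10}^2},\frac{J_4J_6}{J_{10}}\right)$ if $J_2=0$, $J_4\ne 0$; $\left(0,0,\frac{J_6^5}{J_{10}^3}\right)$ if $J_2=J_4=0$. Two genus $2$ curves are isomorphic over $k^{\mathrm{alg}}$ if and only if their absolute invariants coincide. *)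

theory Defs
  imports
    "HOL-Algebra.Algebraic_Closure_Type"
    "HOL-Algebra.Elementary_Groups"
    "HOL-Algebra.Product_Groups"
    "HOL-Algebra.Free_Abelian_Groups"
    "HOL-Computational_Algebra.Computational_Algebra"
    "HOL-Combinatorics.Permutations"
    Complex_Main
begin

section \<open>Genus 2 curves and their Jacobians\<close>

text \<open>A polynomial F stands for the smooth projective curve with affine model
  y^2 = F(x), in characteristic different from 2.\<close>

definition genus2_model :: "'k::field poly \<Rightarrow> bool" where
  "genus2_model F \<longleftrightarrow>
     Polynomial.degree F \<in> {5, 6} \<and> rsquarefree (map_poly to_ac F)"

text \<open>The function field K(x)[y]/(y^2 - F) of the curve; the pair (a, b) stands for a + b y.\<close>

definition function_field :: "'a::field poly \<Rightarrow> ('a poly fract \<times> 'a poly fract) ring" where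
  "function_field F =
     \<lparr>carrier = UNIV,
      monoid.mult = (\<lambda>(a, b) (c, d). (a * c + b * d * Fract F 1, a * d + b * c)),
      one = (1, 0),
      ring.zero = (0, 0),
      add = (\<lambda>(a, b) (c, d). (a + c, b + d))\<rparr>"

text \<open>Over an algebraically closed field, the closed points of the smooth projective curve
  are the normalised discrete valuations of its function field that are trivial on constants.
  The value at zero is set to 0, so that each valuation is represented by exactly
  one function.\<close>

definition places :: "'a::field poly \<Rightarrow> ('a poly fract \<times> 'a poly fract \<Rightarrow> int) set" where
  "places F = {v.
     (let K = function_field F; N = carrier K - {\<zero>\<^bsub>K\<^esub>} in
        v \<zero>\<^bsub>K\<^esub> = 0 \<and>
        (\<forall>f\<in>N. \<forall>g\<in>N. v (f \<otimes>\<^bsub>K\<^esub> g) = v f + v g) \<and>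
        (\<forall>f\<in>N. \<forall>g\<in>N. f \<oplus>\<^bsub>K\<^esub> g \<noteq> \<zero>\<^bsub>K\<^esub> \<longrightarrow> min (v f) (v g) \<le> v (f \<oplus>\<^bsub>K\<^esub> g)) \<and>
        (\<forall>c. c \<noteq> 0 \<longrightarrow> v (Fract [:c:] 1, 0) = 0) \<and>
        (\<exists>t\<in>N. v t = 1))}"

type_synonym 'a divisor = "('a poly fract \<times> 'a poly fract \<Rightarrow> int) \<Rightarrow>\<^sub>0 int"

definition divisor_group :: "'a::field poly \<Rightarrow> 'a divisor monoid" where
  "divisor_group F = free_Abelian_group (places F)"

text \<open>All residue fields are equal to the base field when the latter is algebraically closed,
  so a divisor has degree the sum of its multiplicities.\<close>

definition divisor_degree :: "'a::alg_closed_field divisor \<Rightarrow> int" where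
  "divisor_degree D = (\<Sum>v\<in>Poly_Mapping.keys D. Poly_Mapping.lookup D v)"

definition degree_zero_divisors :: "'a::alg_closed_field poly \<Rightarrow> 'a divisor monoid" where
  "degree_zero_divisors F =
     (divisor_group F)\<lparr>carrier := {D \<in> carrier (divisor_group F). divisor_degree D = 0}\<rparr>"

definition principal_divisors :: "'a::field poly \<Rightarrow> 'a divisor set" where
  "principal_divisors F =
     {D \<in> carrier (divisor_group F).
        \<exists>f \<in> carrier (function_field F) - {\<zero>\<^bsub>function_field F\<^esub>}.
          \<forall>v \<in> places F. Poly_Mapping.lookup D v = v f}"

definition Pic0 :: "'a::alg_closed_field poly \<Rightarrow> 'a divisor set monoid" where
  "Pic0 F = degree_zero_divisors F Mod principal_divisors F"

text \<open>The group Jac(C)(kalg) of geometric points of the Jacobian.\<close>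

definition Jac :: "'k::field poly \<Rightarrow> 'k alg_closure divisor set monoid" where
  "Jac F = Pic0 (map_poly to_ac F)"

definition torsion :: "('g, 'm) monoid_scheme \<Rightarrow> nat \<Rightarrow> ('g, 'm) monoid_scheme" where
  "torsion G n = G\<lparr>carrier := {P \<in> carrier G. P [^]\<^bsub>G\<^esub> n = \<one>\<^bsub>G\<^esub>}\<rparr>"

definition has_p_rank :: "'k::field poly \<Rightarrow> nat \<Rightarrow> bool" where
  "has_p_rank F f \<longleftrightarrow>
     f \<in> {0, 1, 2} \<and>
     torsion (Jac F) CHAR('k) \<cong> product_group {..<f} (\<lambda>_. integer_mod_group CHAR('k))"

definition ordinary :: "'k::field poly \<Rightarrow> bool" where
  "ordinary F \<longleftrightarrow> has_p_rank F 2"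

definition non_ordinary :: "'k::field poly \<Rightarrow> bool" where
  "non_ordinary F \<longleftrightarrow> has_p_rank F 1"

definition supersingular :: "'k::field poly \<Rightarrow> bool" where
  "supersingular F \<longleftrightarrow> has_p_rank F 0"


section \<open>Igusa invariants\<close>

text \<open>A product of squared root differences is given by its set of edges {i, j}, one for each
  factor (x_i - x_j)^2. The set below is the set of distinct expressions
  obtained from it by permuting the indices 1, ..., 6.\<close>

definition index_orbit :: "nat set set \<Rightarrow> nat set set set" where
  "index_orbit E = {(\<lambda>e. \<sigma> ` e) ` E |\<sigma>. \<sigma> permutes {1..6}}"

definition orbit_sum :: "nat set set \<Rightarrow> (nat \<Rightarrow> complex) \<Rightarrow> complex" where
  "orbit_sum E x = (\<Sum>E'\<in>index_orbit E. \<Prod>e\<in>E'. (x (Min e) - x (Max e))\<^sup>2)"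

text \<open>The invariants of the sextic c (X - x_1) ... (X - x_6) in characteristic 0,
  as functions of c and of the roots.\<close>

definition I2_roots :: "complex \<Rightarrow> (nat \<Rightarrow> complex) \<Rightarrow> complex" where
  "I2_roots c x = c ^ 2 * orbit_sum {{1,2}, {3,4}, {5,6}} x"

definition I4_roots :: "complex \<Rightarrow> (nat \<Rightarrow> complex) \<Rightarrow> complex" where
  "I4_roots c x = c ^ 4 * orbit_sum {{1,2}, {2,3}, {3,1}, {4,5}, {5,6}, {6,4}} x"

definition I6_roots :: "complex \<Rightarrow> (nat \<Rightarrow> complex) \<Rightarrow> complex" where
  "I6_roots c x = c ^ 6 *
     orbit_sum {{1,2}, {2,3}, {3,1}, {4,5}, {5,6}, {6,4}, {1,4}, {2,5}, {3,6}} x"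

definition I10_roots :: "complex \<Rightarrow> (nat \<Rightarrow> complex) \<Rightarrow> complex" where
  "I10_roots c x = c ^ 10 * (\<Prod>j\<in>{1..6}. \<Prod>i\<in>{1..<j}. (x i - x j)\<^sup>2)"

definition J2_roots :: "complex \<Rightarrow> (nat \<Rightarrow> complex) \<Rightarrow> complex" where
  "J2_roots c x = I2_roots c x / 8"

definition J4_roots :: "complex \<Rightarrow> (nat \<Rightarrow> complex) \<Rightarrow> complex" where
  "J4_roots c x = (4 * J2_roots c x ^ 2 - I4_roots c x) / 96"

definition J6_roots :: "complex \<Rightarrow> (nat \<Rightarrow> complex) \<Rightarrow> complex" where
  "J6_roots c x =
     (8 * J2_roots c x ^ 3 - 160 * J2_roots c x * J4_roots c x - I6_roots c x) / 576"

definition J8_roots :: "complex \<Rightarrow> (nat \<Rightarrow> complex) \<Rightarrow> complex" where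
  "J8_roots c x = (J2_roots c x * J6_roots c x - J4_roots c x ^ 2) / 4"

definition J10_roots :: "complex \<Rightarrow> (nat \<Rightarrow> complex) \<Rightarrow> complex" where
  "J10_roots c x = I10_roots c x / 2 ^ 12"

text \<open>Polynomials in variables c_0, c_1, ... with rational coefficients, and their value
  at a point after mapping the coefficients by h.\<close>

type_synonym rat_mpoly = "(nat \<Rightarrow>\<^sub>0 nat) \<Rightarrow>\<^sub>0 rat"

definition mpoly_value :: "(rat \<Rightarrow> 'a::comm_ring_1) \<Rightarrow> (nat \<Rightarrow> 'a) \<Rightarrow> rat_mpoly \<Rightarrow> 'a" where
  "mpoly_value h c P =
     (\<Sum>m\<in>Poly_Mapping.keys P. h (Poly_Mapping.lookup P m) *
        (\<Prod>i\<in>Poly_Mapping.keys m. c i ^ Poly_Mapping.lookup m i))"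

definition Z_half :: "rat set" where
  "Z_half = {of_int a / 2 ^ n |a n. True}"

text \<open>The polynomial over Z[1/2] in the coefficients c_0, ..., c_6 that expresses
  a given function of the leading coefficient and the roots of a sextic. It is unique if it exists,
  because the coefficient vectors of complex sextics are Zariski dense.\<close>

definition coeff_polynomial :: "(complex \<Rightarrow> (nat \<Rightarrow> complex) \<Rightarrow> complex) \<Rightarrow> rat_mpoly" where
  "coeff_polynomial J = (THE P.
     (\<forall>m\<in>Poly_Mapping.keys P.
        Poly_Mapping.keys m \<subseteq> {..6} \<and> Poly_Mapping.lookup P m \<in> Z_half) \<and>
     (\<forall>c x. c \<noteq> 0 \<longrightarrow>
        mpoly_value of_rat (Polynomial.coeff (Polynomial.smult c (\<Prod>i\<in>{1..6}. [:- x i, 1:]))) P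
          = J c x))"

text \<open>On Z[1/2] this is the unique ring homomorphism to a field of characteristic
  different from 2.\<close>

definition reduce :: "rat \<Rightarrow> 'k::field" where
  "reduce r = (case quotient_of r of (a, b) \<Rightarrow> of_int a / of_int b)"

definition specialise :: "(complex \<Rightarrow> (nat \<Rightarrow> complex) \<Rightarrow> complex) \<Rightarrow> 'k::field poly \<Rightarrow> 'k" where
  "specialise J F = mpoly_value reduce (Polynomial.coeff F) (coeff_polynomial J)"

definition J2 :: "'k::field poly \<Rightarrow> 'k" where "J2 = specialise J2_roots"
definition J4 :: "'k::field poly \<Rightarrow> 'k" where "J4 = specialise J4_roots"
definition J6 :: "'k::field poly \<Rightarrow> 'k" where "J6 = specialise J6_roots"
definition J8 :: "'k::field poly \<Rightarrow> 'k" where "J8 = specialise J8_roots"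
definition J10 :: "'k::field poly \<Rightarrow> 'k" where "J10 = specialise J10_roots"

definition absolute_invariants :: "'k::field poly \<Rightarrow> 'k \<times> 'k \<times> 'k" where
  "absolute_invariants F =
     (if J2 F \<noteq> 0 then
        (J2 F ^ 5 / J10 F, J2 F ^ 3 * J4 F / J10 F, J2 F ^ 2 * J6 F / J10 F)
      else if J4 F \<noteq> 0 then
        (0, J4 F ^ 5 / J10 F ^ 2, J4 F * J6 F / J10 F)
      else
        (0, 0, J6 F ^ 5 / J10 F ^ 3))"

end

theory Submission
  imports Defs "Jordan_Normal_Form.Determinant" "HOL-Library.Product_Plus"
begin

text \<open>Over the algebraic closure, a divisor class of order dividing 3, \<open>3 D = div f\<close>, is determined by
  the regular differential \<open>df / f\<close>, since \<open>df = 0\<close> means that \<open>f\<close> is a cube. By Jacobson's criterion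
  the regular differentials \<open>(a + b x) dx / y\<close> that arise are those with \<open>\<omega>'' + \<omega>\<^sup>3 = 0\<close>, where
  \<open>\<omega> = (a + b x) / y\<close>, i.e. the solutions of the Cartier--Manin equations
  \<open>a\<^sup>3 = c\<^sub>2 a + c\<^sub>1 b\<close>, \<open>b\<^sup>3 = c\<^sub>5 a + c\<^sub>4 b\<close>. There are exactly three of them
  iff the matrix has determinant \<open>0\<close> and the semilinear map that it defines is not nilpotent.
  In characteristic 3 the determinant is \<open>J\<^sub>2\<close>, and if it vanishes then \<open>J\<^sub>4\<close> is the obstruction to nilpotence times a value of the sextic at a zero of
  its derivative, which is nonzero. As the discriminant does not vanish,
  \<open>J\<^sub>2 = 0 \<noteq> J\<^sub>4\<close> is equivalent to the condition on the absolute invariants.\<close>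

subsection \<open>Polynomials over the integers\<close>

text \<open>The invariants are defined from roots in characteristic 0, and \<open>J4_roots\<close>
  divides by 96, so nothing can be computed after reducing modulo 3: each invariant in use is
  exhibited as an integral polynomial in the coefficients over a power of 2, with the 3 cancelled
  over the integers. For \<open>J10\<close> that polynomial is a determinant that also makes sense
  in degree 5 and in characteristic 3. The Jacobian is built from all discrete valuations of the
  function field, so these have to be classified. Trace and norm down to the rational functions do
  this: they decide integrality, isolate the places over each point, give principal divisors degree
  0 and show that a function without zeros and poles is constant. Differentials never appear as
  objects. The function field is embedded in Laurent series at a point where x is the parameter plus
  a constant, so that d/dx is the formal derivative and a differential is represented by its
  quotient by dx. The 3-torsion group is only counted, which suffices because a group with three
  elements is cyclic.\<close>

definition monom_value :: "(nat \<Rightarrow> 'a::comm_ring_1) \<Rightarrow> (nat \<Rightarrow>\<^sub>0 nat) \<Rightarrow> 'a" where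
  "monom_value c m = (\<Prod>i\<in>Poly_Mapping.keys m. c i ^ Poly_Mapping.lookup m i)"

text \<open>The coefficient type is left open so that one integral polynomial can be evaluated both
  in the complex numbers, where the invariants are defined, and in a field of characteristic
  3.\<close>

definition mpoly_eval :: "('b::zero \<Rightarrow> 'a::comm_ring_1) \<Rightarrow> (nat \<Rightarrow> 'a) \<Rightarrow> ((nat \<Rightarrow>\<^sub>0 nat) \<Rightarrow>\<^sub>0 'b) \<Rightarrow> 'a" where
  "mpoly_eval h c P = (\<Sum>m\<in>Poly_Mapping.keys P. h (Poly_Mapping.lookup P m) * monom_value c m)"

lemma mpoly_value_eq_eval: "mpoly_value h c P = mpoly_eval h c P"
  by (simp add: mpoly_value_def mpoly_eval_def monom_value_def)

lemma monom_value_superset: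
  assumes "finite A" "Poly_Mapping.keys m \<subseteq> A"
  shows "monom_value c m = (\<Prod>i\<in>A. c i ^ Poly_Mapping.lookup m i)"
  unfolding monom_value_def using assms
  by (intro prod.mono_neutral_left) (auto simp: in_keys_iff)

lemma monom_value_0 [simp]: "monom_value c 0 = 1"
  by (simp add: monom_value_def)

lemma monom_value_add: "monom_value c (m + n) = monom_value c m * monom_value c n"
proof -
  let ?A = "Poly_Mapping.keys m \<union> Poly_Mapping.keys n"
  have "Poly_Mapping.keys (m + n) \<subseteq> ?A" by (rule Poly_Mapping.keys_add)
  then show ?thesis
    using monom_value_superset[of ?A m c] monom_value_superset[of ?A n c] monom_value_superset[of ?A "m + n" c]
    by (simp add: lookup_add power_add prod.distrib)
qed

lemma monom_value_single [simp]: "monom_value c (Poly_Mapping.single i k) = c i ^ k"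
  by (cases "k = 0") (auto simp: monom_value_def)

lemma mpoly_eval_superset:
  assumes "finite A" "Poly_Mapping.keys P \<subseteq> A" "h 0 = 0"
  shows "mpoly_eval h c P = (\<Sum>m\<in>A. h (Poly_Mapping.lookup P m) * monom_value c m)"
  unfolding mpoly_eval_def using assms
  by (intro sum.mono_neutral_left) (auto simp: in_keys_iff)

lemma mpoly_eval_add:
  assumes "\<And>x y. h (x + y) = h x + h y" "h 0 = 0"
  shows "mpoly_eval h c (P + Q) = mpoly_eval h c P + mpoly_eval h c Q"
proof -
  let ?A = "Poly_Mapping.keys P \<union> Poly_Mapping.keys Q"
  have "Poly_Mapping.keys (P + Q) \<subseteq> ?A" by (rule Poly_Mapping.keys_add)
  then show ?thesis
    using mpoly_eval_superset[of ?A P h c] mpoly_eval_superset[of ?A Q h c] mpoly_eval_superset[of ?A "P + Q" h c] assms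
    by (simp add: lookup_add sum.distrib algebra_simps)
qed

lemma mpoly_eval_single [simp]: "h 0 = 0 \<Longrightarrow> mpoly_eval h c (Poly_Mapping.single m a) = h a * monom_value c m"
  by (cases "a = 0") (auto simp: mpoly_eval_def)

lemma poly_mapping_eq_sum_single:
  "(P :: 'b \<Rightarrow>\<^sub>0 'c::comm_monoid_add) = (\<Sum>m\<in>Poly_Mapping.keys P. Poly_Mapping.single m (Poly_Mapping.lookup P m))"
proof (rule poly_mapping_eqI)
  fix k
  show "Poly_Mapping.lookup P k = Poly_Mapping.lookup (\<Sum>m\<in>Poly_Mapping.keys P. Poly_Mapping.single m (Poly_Mapping.lookup P m)) k"
    by (cases "k \<in> Poly_Mapping.keys P")
       (auto simp: lookup_sum lookup_single when_def in_keys_iff sum.delta')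
qed

lemma mpoly_eval_sum:
  assumes "\<And>x y. h (x + y) = h x + h y" "h 0 = 0"
  shows "mpoly_eval h c (sum F A) = (\<Sum>a\<in>A. mpoly_eval h c (F a))"
  by (induction A rule: infinite_finite_induct)
     (simp_all add: mpoly_eval_add assms mpoly_eval_def[of _ _ 0])

lemma mpoly_eval_mult:
  fixes P Q :: "(nat \<Rightarrow>\<^sub>0 nat) \<Rightarrow>\<^sub>0 'b::comm_ring_1"
  assumes h: "comm_ring_hom h"
  shows "mpoly_eval h c (P * Q) = mpoly_eval h c P * mpoly_eval h c Q"
proof -
  interpret comm_ring_hom h by fact
  let ?s = "\<lambda>P m. Poly_Mapping.single m (Poly_Mapping.lookup P m)"
  have "P * Q = (\<Sum>m\<in>Poly_Mapping.keys P. \<Sum>n\<in>Poly_Mapping.keys Q. ?s P m * ?s Q n)"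
    by (subst (1) poly_mapping_eq_sum_single[of P], subst (1) poly_mapping_eq_sum_single[of Q]) (simp add: sum_product)
  then have "mpoly_eval h c (P * Q) = (\<Sum>m\<in>Poly_Mapping.keys P. \<Sum>n\<in>Poly_Mapping.keys Q.
      (h (Poly_Mapping.lookup P m) * monom_value c m) * (h (Poly_Mapping.lookup Q n) * monom_value c n))"
    by (simp add: mpoly_eval_sum hom_distribs mult_single monom_value_add algebra_simps)
  then show ?thesis
    by (simp add: mpoly_eval_def sum_product)
qed

lemma mpoly_eval_comm_ring_hom:
  assumes h: "comm_ring_hom h"
  shows "comm_ring_hom (mpoly_eval h c)"
proof -
  interpret comm_ring_hom h by fact
  have "mpoly_eval h c 1 = 1"
    by (simp flip: single_one)
  then show ?thesis
    by unfold_locales (simp_all add: mpoly_eval_add mpoly_eval_mult h hom_distribs mpoly_eval_def[of _ _ 0])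
qed

lemma of_int_comm_ring_hom: "comm_ring_hom (of_int :: int \<Rightarrow> 'a::comm_ring_1)"
  by unfold_locales auto

text \<open>The lowest digit is the residue modulo \<open>N\<close>; removing it and dividing by
  \<open>N\<close> leaves the remaining digits. This makes an exponent vector recoverable from a
  single exponent.\<close>

lemma digits_unique:
  fixes a b :: "nat \<Rightarrow> nat"
  assumes "\<And>i. i < n \<Longrightarrow> a i < N" "\<And>i. i < n \<Longrightarrow> b i < N"
    and "(\<Sum>i<n. a i * N ^ i) = (\<Sum>i<n. b i * N ^ i)" "i < n"
  shows "a i = b i"
  using assms
proof (induction n arbitrary: a b i)
  case (Suc n)
  have split: "(\<Sum>i<Suc n. f i * N ^ i) = f 0 + N * (\<Sum>i<n. f (Suc i) * N ^ i)" for f :: "nat \<Rightarrow> nat"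
    by (subst sum.lessThan_Suc_shift) (simp add: sum_distrib_left algebra_simps)
  have eq: "a 0 + N * (\<Sum>i<n. a (Suc i) * N ^ i) = b 0 + N * (\<Sum>i<n. b (Suc i) * N ^ i)"
    using Suc.prems(3) by (simp only: split)
  have lt: "a 0 < N" "b 0 < N" using Suc.prems(1,2)[of 0] by auto
  then have "a 0 = b 0"
    using arg_cong[OF eq, of "\<lambda>x. x mod N"] by simp
  moreover have "(\<Sum>i<n. a (Suc i) * N ^ i) = (\<Sum>i<n. b (Suc i) * N ^ i)"
    using eq \<open>a 0 = b 0\<close> lt by auto
  then have "a (Suc j) = b (Suc j)" if "j < n" for j
    using Suc.IH[of "\<lambda>i. a (Suc i)" "\<lambda>i. b (Suc i)" j] Suc.prems(1,2) that by auto
  ultimately show ?case using Suc.prems(4) by (cases i) auto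
qed auto

text \<open>Kronecker substitution: with \<open>c\<^sub>i = t ^ N ^ i\<close> and \<open>N\<close> larger than all exponents,
  distinct monomials become distinct powers of \<open>t\<close>.\<close>

lemma mpoly_eval_nonzero:
  fixes h :: "'b::zero \<Rightarrow> 'a::field_char_0"
  assumes h: "\<And>x. h x = 0 \<longleftrightarrow> x = 0" and "P \<noteq> 0"
  obtains c where "\<And>i. c i \<noteq> 0" "mpoly_eval h c P \<noteq> 0"
proof -
  define A where "A = (\<Union>m\<in>Poly_Mapping.keys P. Poly_Mapping.keys m)"
  define n where "n = Suc (Max (insert 0 A))"
  define E where "E = (\<Union>m\<in>Poly_Mapping.keys P. Poly_Mapping.lookup m ` Poly_Mapping.keys m)"
  define N where "N = Suc (Max (insert 0 E))"
  have fin: "finite A" "finite E" by (auto simp: A_def E_def)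
  have sub: "Poly_Mapping.keys m \<subseteq> {..<n}" if "m \<in> Poly_Mapping.keys P" for m
  proof
    fix i assume "i \<in> Poly_Mapping.keys m"
    with that have "i \<in> insert 0 A" by (auto simp: A_def)
    then show "i \<in> {..<n}" using fin Max_ge[of "insert 0 A" i] by (simp add: n_def less_Suc_eq_le)
  qed
  have lt: "Poly_Mapping.lookup m i < N" if "m \<in> Poly_Mapping.keys P" for m i
  proof (cases "i \<in> Poly_Mapping.keys m")
    case True
    then have "Poly_Mapping.lookup m i \<in> insert 0 E" using that by (auto simp: E_def)
    then show ?thesis using fin Max_ge[of "insert 0 E" "Poly_Mapping.lookup m i"] by (simp add: N_def less_Suc_eq_le)
  qed (simp add: N_def in_keys_iff)
  define k where "k m = (\<Sum>i<n. Poly_Mapping.lookup m i * N ^ i)" for m :: "nat \<Rightarrow>\<^sub>0 nat"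
  have inj: "inj_on k (Poly_Mapping.keys P)"
  proof (rule inj_onI)
    fix m m' assume m: "m \<in> Poly_Mapping.keys P" "m' \<in> Poly_Mapping.keys P" "k m = k m'"
    show "m = m'"
    proof (rule poly_mapping_eqI)
      fix i
      show "Poly_Mapping.lookup m i = Poly_Mapping.lookup m' i"
      proof (cases "i < n")
        case True
        then show ?thesis using digits_unique[of n "Poly_Mapping.lookup m" N "Poly_Mapping.lookup m'" i] m lt
          by (simp add: k_def)
      next
        case False
        then have "i \<notin> Poly_Mapping.keys m" "i \<notin> Poly_Mapping.keys m'" using sub m by auto
        then show ?thesis by (simp add: in_keys_iff)
      qed
    qed
  qed
  define p where "p = (\<Sum>m\<in>Poly_Mapping.keys P. Polynomial.monom (h (Poly_Mapping.lookup P m)) (k m))"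
  have eval: "mpoly_eval h (\<lambda>i. t ^ N ^ i) P = poly p t" for t
  proof -
    have "monom_value (\<lambda>i. t ^ N ^ i) m = t ^ k m" if "m \<in> Poly_Mapping.keys P" for m
      using monom_value_superset[of "{..<n}" m "\<lambda>i. t ^ N ^ i"] sub[OF that]
      by (simp add: k_def power_sum power_mult[symmetric] mult.commute)
    then show ?thesis by (simp add: mpoly_eval_def p_def poly_sum poly_monom)
  qed
  obtain m0 where m0: "m0 \<in> Poly_Mapping.keys P"
    using \<open>P \<noteq> 0\<close> by (metis lookup_not_eq_zero_eq_in_keys lookup_zero poly_mapping_eqI)
  \<comment> \<open>By injectivity of \<open>k\<close> no other monomial contributes to this power
    of t, so nothing cancels.\<close>
  have "Polynomial.coeff p (k m0) = (\<Sum>m\<in>Poly_Mapping.keys P. if m = m0 then h (Poly_Mapping.lookup P m) else 0)"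
    unfolding p_def coeff_sum
    by (intro sum.cong refl) (use inj m0 in \<open>auto simp: inj_on_def\<close>)
  also have "\<dots> = h (Poly_Mapping.lookup P m0)" using m0 by simp
  also have "\<dots> \<noteq> 0" using m0 h by (simp add: in_keys_iff)
  finally have "p \<noteq> 0" by auto
  then have "finite {t. poly p t = 0}" by (rule poly_roots_finite)
  \<comment> \<open>Zero is avoided along with the roots so that every \<open>c i\<close> is
    nonzero: later such values serve as leading coefficients and as denominators.\<close>
  then have "finite (insert 0 {t. poly p t = 0})" by simp
  then obtain t where "t \<notin> insert 0 {t. poly p t = 0}"
    using ex_new_if_finite[OF infinite_UNIV_char_0] by blast
  then show ?thesis using that[of "\<lambda>i. t ^ N ^ i"] eval by auto
qed

type_synonym int_mpoly = "(nat \<Rightarrow>\<^sub>0 nat) \<Rightarrow>\<^sub>0 int"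

abbreviation eval_int :: "(nat \<Rightarrow> 'a::comm_ring_1) \<Rightarrow> int_mpoly \<Rightarrow> 'a" where
  "eval_int \<equiv> mpoly_eval of_int"

definition in_vars :: "nat set \<Rightarrow> int_mpoly \<Rightarrow> bool" where
  "in_vars V P \<longleftrightarrow> (\<forall>m\<in>Poly_Mapping.keys P. Poly_Mapping.keys m \<subseteq> V)"

definition mvar :: "nat \<Rightarrow> int_mpoly" where
  "mvar i = Poly_Mapping.single (Poly_Mapping.single i 1) 1"

lemma eval_int_hom: "comm_ring_hom (eval_int c)"
  by (rule mpoly_eval_comm_ring_hom[OF of_int_comm_ring_hom])

lemma eval_int_mvar [simp]: "eval_int c (mvar i) = c i"
  by (simp add: mvar_def)

lemma in_vars_mvar: "i \<in> V \<Longrightarrow> in_vars V (mvar i)"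
  by (simp add: in_vars_def mvar_def)

lemma in_vars_add: "in_vars V P \<Longrightarrow> in_vars V Q \<Longrightarrow> in_vars V (P + Q)"
  unfolding in_vars_def using Poly_Mapping.keys_add[of P Q] by blast

lemma in_vars_minus: "in_vars V P \<Longrightarrow> in_vars V (- P)"
  by (auto simp: in_vars_def in_keys_iff)

lemma in_vars_diff: "in_vars V P \<Longrightarrow> in_vars V Q \<Longrightarrow> in_vars V (P - Q)"
  using in_vars_add[of V P "- Q"] in_vars_minus by auto

lemma in_vars_mult:
  assumes "in_vars V P" "in_vars V Q" shows "in_vars V (P * Q)"
  unfolding in_vars_def
proof
  fix m assume "m \<in> Poly_Mapping.keys (P * Q)"
  then obtain a b where "m = a + b" "a \<in> Poly_Mapping.keys P" "b \<in> Poly_Mapping.keys Q"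
    using Poly_Mapping.keys_mult[of P Q] by auto
  then show "Poly_Mapping.keys m \<subseteq> V"
    using Poly_Mapping.keys_add[of a b] assms unfolding in_vars_def by blast
qed

lemma in_vars_0: "in_vars V 0" and in_vars_1: "in_vars V 1"
  by (auto simp: in_vars_def simp flip: single_one)

lemma in_vars_of_nat: "in_vars V (of_nat n)"
  by (induction n) (auto intro: in_vars_add in_vars_0 in_vars_1)

lemma in_vars_numeral: "in_vars V (numeral n)"
  using in_vars_of_nat[of V "numeral n"] by simp

lemma in_vars_of_int: "in_vars V (of_int n)"
  using in_vars_of_nat in_vars_minus by (cases n rule: int_cases2) auto

lemma in_vars_sum: "(\<And>a. a \<in> A \<Longrightarrow> in_vars V (f a)) \<Longrightarrow> in_vars V (sum f A)"
  by (induction A rule: infinite_finite_induct) (auto intro: in_vars_add in_vars_0)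

lemma in_vars_prod: "(\<And>a. a \<in> A \<Longrightarrow> in_vars V (f a)) \<Longrightarrow> in_vars V (prod f A)"
  by (induction A rule: infinite_finite_induct) (auto intro: in_vars_mult in_vars_1)

lemma in_vars_power: "in_vars V P \<Longrightarrow> in_vars V (P ^ n)"
  by (induction n) (auto intro: in_vars_mult in_vars_1)

lemmas in_vars_intros = in_vars_mvar in_vars_add in_vars_minus in_vars_diff in_vars_mult in_vars_0 in_vars_1
  in_vars_numeral in_vars_of_nat in_vars_of_int in_vars_sum in_vars_prod in_vars_power

section \<open>Specialising polynomials over Z[1/2]\<close>

lemma reduce_Z_half:
  assumes "(2 :: 'k::field) \<noteq> 0"
  shows "reduce (of_int a / 2 ^ n) = (of_int a / 2 ^ n :: 'k)"
proof -
  define r :: rat where "r = of_int a / 2 ^ n"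
  obtain p q where pq: "quotient_of r = (p, q)" by fastforce
  have q: "q > 0" "coprime p q" "r = of_int p / of_int q"
    using quotient_of_denom_pos[OF pq] quotient_of_coprime[OF pq] quotient_of_div[OF pq] by auto
  have "of_int (p * 2 ^ n) = (of_int (a * q) :: rat)"
    using q by (simp add: r_def field_simps)
  then have eq: "p * 2 ^ n = a * q" by linarith
  \<comment> \<open>\<open>reduce\<close> works in lowest terms, where powers of 2 may have
    cancelled; the remaining denominator still divides \<open>2 ^ n\<close> and so stays
    invertible.\<close>
  then have "q dvd 2 ^ n"
    using q(2) by (metis coprime_commute coprime_dvd_mult_right_iff dvd_triv_right)
  then obtain d where "2 ^ n = q * d" by (elim dvdE)
  then have "(2 ^ n :: 'k) = of_int q * of_int d"
    by (metis of_int_mult of_int_numeral of_int_power)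
  then have q0: "of_int q \<noteq> (0 :: 'k)" using assms by auto
  have "(of_int p * 2 ^ n :: 'k) = of_int a * of_int q"
    using arg_cong[OF eq, of "of_int :: int \<Rightarrow> 'k"] by simp
  then show ?thesis
    using q0 assms pq by (simp add: reduce_def r_def[symmetric] field_simps)
qed

definition half_power :: "nat \<Rightarrow> int_mpoly \<Rightarrow> rat_mpoly" where
  "half_power n Q = Poly_Mapping.map (\<lambda>a. of_int a / 2 ^ n) Q"

lemma lookup_half_power [simp]:
  "Poly_Mapping.lookup (half_power n Q) m = of_int (Poly_Mapping.lookup Q m) / 2 ^ n"
  unfolding half_power_def by transfer (simp add: when_def)

lemma keys_half_power [simp]: "Poly_Mapping.keys (half_power n Q) = Poly_Mapping.keys Q"
  by (auto simp: in_keys_iff)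

lemma mpoly_value_half_power:
  assumes "\<And>a. h (of_int a / 2 ^ n) = (of_int a / 2 ^ n :: 'a::field)"
  shows "mpoly_value h c (half_power n Q) = eval_int c Q / 2 ^ n"
  by (simp add: mpoly_value_eq_eval mpoly_eval_def assms sum_divide_distrib)

lemma complex_sextic_splits:
  fixes c :: "nat \<Rightarrow> complex"
  assumes "c 6 \<noteq> 0"
  obtains x where "\<And>i. i \<le> 6 \<Longrightarrow> Polynomial.coeff (Polynomial.smult (c 6) (\<Prod>i\<in>{1..6::nat}. [:- x i, 1:])) i = c i"
proof -
  define p where "p = (\<Sum>i\<le>6. Polynomial.monom (c i) i)"
  have co: "Polynomial.coeff p i = (if i \<le> 6 then c i else 0)" for i
    by (simp add: p_def coeff_sum)
  have deg: "Polynomial.degree p = 6"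
    using assms by (intro order_antisym degree_le le_degree) (auto simp: co)
  have "\<exists>A. size A = Polynomial.degree p \<and> p = Polynomial.smult (Polynomial.lead_coeff p) (\<Prod>x\<in>#A. [:- x, 1:])"
    using alg_closed_imp_factorization[of p] assms co by fastforce
  then obtain A where A: "size A = 6" "p = Polynomial.smult (c 6) (\<Prod>x\<in>#A. [:- x, 1:])"
    by (auto simp: deg co)
  obtain xs where xs: "mset xs = A" by (metis ex_mset)
  then have len: "length xs = 6" using A by (metis size_mset)
  have "(\<Prod>x\<in>#A. [:- x, 1:]) = (\<Prod>x\<leftarrow>xs. [:- x, 1:])"
    unfolding xs[symmetric] by (simp add: prod_mset_prod_list[symmetric])
  also have "\<dots> = (\<Prod>i<6. [:- xs ! i, 1:])"
    using len by (simp add: prod.list_conv_set_nth atLeast0LessThan)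
  also have "\<dots> = (\<Prod>i\<in>{1..6}. [:- xs ! (i - 1), 1:])"
    by (rule prod.reindex_bij_witness[of _ "\<lambda>i. i - 1" Suc]) auto
  finally have "p = Polynomial.smult (c 6) (\<Prod>i\<in>{1..6}. [:- xs ! (i - 1), 1:])" using A by simp
  then show ?thesis using that[of "\<lambda>i. xs ! (i - 1)"] co by metis
qed

text \<open>A nonzero difference of two candidates is nonzero at some vector with \<open>c 6\<close>
  nonzero. As complex sextics split, that vector belongs to a leading coefficient and six roots,
  where both candidates equal \<open>J\<close>.\<close>

lemma coeff_polynomial_eqI:
  assumes vars: "in_vars {..6} Q"
    and eval: "\<And>c x. c \<noteq> 0 \<Longrightarrow>
      eval_int (Polynomial.coeff (Polynomial.smult c (\<Prod>i\<in>{1..6::nat}. [:- x i, 1:]))) Q / 2 ^ n = J c x"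
  shows "coeff_polynomial J = half_power n Q"
  unfolding coeff_polynomial_def
proof (rule the_equality)
  have "Poly_Mapping.lookup (half_power n Q) m \<in> Z_half" for m
    by (auto simp: Z_half_def)
  moreover have "mpoly_value of_rat c (half_power n Q) = eval_int c Q / 2 ^ n" for c :: "nat \<Rightarrow> complex"
    by (rule mpoly_value_half_power) (simp add: of_rat_divide of_rat_power)
  ultimately show ex: "(\<forall>m\<in>Poly_Mapping.keys (half_power n Q). Poly_Mapping.keys m \<subseteq> {..6} \<and> Poly_Mapping.lookup (half_power n Q) m \<in> Z_half) \<and>
     (\<forall>c x. c \<noteq> 0 \<longrightarrow>
        mpoly_value of_rat (Polynomial.coeff (Polynomial.smult c (\<Prod>i\<in>{1..6}. [:- x i, 1:]))) (half_power n Q)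
          = J c x)"
    using vars eval by (auto simp: in_vars_def)
  fix P assume P: "(\<forall>m\<in>Poly_Mapping.keys P. Poly_Mapping.keys m \<subseteq> {..6} \<and> Poly_Mapping.lookup P m \<in> Z_half) \<and>
     (\<forall>c x. c \<noteq> 0 \<longrightarrow>
        mpoly_value of_rat (Polynomial.coeff (Polynomial.smult c (\<Prod>i\<in>{1..6}. [:- x i, 1:]))) P
          = J c x)"
  define R where "R = P - half_power n Q"
  let ?ev = "\<lambda>c. mpoly_eval (of_rat :: rat \<Rightarrow> complex) c"
  have "R = 0"
  proof (rule ccontr)
    assume "R \<noteq> 0"
    then obtain c where c: "\<And>i. c i \<noteq> 0" "?ev c R \<noteq> 0"
      using mpoly_eval_nonzero[of "of_rat :: rat \<Rightarrow> complex" R] by auto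
    obtain x where x: "\<And>i. i \<le> 6 \<Longrightarrow> Polynomial.coeff (Polynomial.smult (c 6) (\<Prod>i\<in>{1..6::nat}. [:- x i, 1:])) i = c i"
      using complex_sextic_splits[of c] c by blast
    let ?d = "Polynomial.coeff (Polynomial.smult (c 6) (\<Prod>i\<in>{1..6::nat}. [:- x i, 1:]))"
    \<comment> \<open>The split sextic reproduces \<open>c\<close> only up to index 6, which is all
      that these polynomials see.\<close>
    have cong: "?ev c S = ?ev ?d S" if "\<forall>m\<in>Poly_Mapping.keys S. Poly_Mapping.keys m \<subseteq> {..6}" for S
      using that x unfolding mpoly_eval_def monom_value_def
      by (intro sum.cong prod.cong refl arg_cong2[of _ _ _ _ "(*)"]) (auto simp: subset_iff)
    have "?ev c P = J (c 6) x"
      using P c cong[of P] by (simp add: mpoly_value_eq_eval)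
    moreover have "?ev c (half_power n Q) = J (c 6) x"
      using ex c cong[of "half_power n Q"] by (simp add: mpoly_value_eq_eval)
    moreover have "?ev c P = ?ev c R + ?ev c (half_power n Q)"
      by (subst mpoly_eval_add[symmetric]) (auto simp: R_def of_rat_add)
    ultimately show False using c by simp
  qed
  then show "P = half_power n Q" by (simp add: R_def)
qed

text \<open>Every later computation of an invariant goes through this lemma: an identity over the
  complex numbers with explicit integral \<open>Q\<close> is transported to any field in which 2 is
  invertible.\<close>

lemma specialise_eq:
  fixes F :: "'k::field poly"
  assumes "in_vars {..6} Q"
    and "\<And>c x. c \<noteq> 0 \<Longrightarrow>
      eval_int (Polynomial.coeff (Polynomial.smult c (\<Prod>i\<in>{1..6::nat}. [:- x i, 1:]))) Q / 2 ^ n = J c x"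
    and "(2 :: 'k) \<noteq> 0"
  shows "specialise J F = eval_int (Polynomial.coeff F) Q / 2 ^ n"
proof -
  have "coeff_polynomial J = half_power n Q"
    using assms(1,2) by (intro coeff_polynomial_eqI) auto
  then show ?thesis
    by (simp add: specialise_def mpoly_value_half_power reduce_Z_half[OF assms(3)])
qed

subsection \<open>Orbits of graphs on six vertices\<close>

lemma distinct_perm_list:
  assumes "distinct xs" "set xs = {1..6::nat}"
  obtains \<sigma> where "\<sigma> permutes {1..6}" "\<sigma> 1 = xs ! 0" "\<sigma> 2 = xs ! 1" "\<sigma> 3 = xs ! 2"
    "\<sigma> 4 = xs ! 3" "\<sigma> 5 = xs ! 4" "\<sigma> 6 = xs ! 5"
proof -
  have len: "length xs = 6" using distinct_card[OF assms(1)] assms(2) by simp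
  define \<sigma> where "\<sigma> i = (if i \<in> {1..6} then xs ! (i - 1) else i)" for i
  have "bij_betw (\<lambda>i. i - 1) {1..6::nat} {..<6}"
    by (rule bij_betw_byWitness[of _ Suc]) auto
  moreover have "bij_betw ((!) xs) {..<6} {1..6}"
    using bij_betw_nth[OF assms(1) refl refl] assms len by auto
  ultimately have "bij_betw ((!) xs \<circ> (\<lambda>i. i - 1)) {1..6::nat} {1..6}"
    by (rule bij_betw_trans)
  then have "bij_betw \<sigma> {1..6} {1..6}"
    by (rule bij_betw_cong[THEN iffD1, rotated]) (auto simp: \<sigma>_def)
  then have "\<sigma> permutes {1..6}"
    by (rule bij_imp_permutes) (auto simp: \<sigma>_def)
  then show ?thesis by (rule that) (auto simp: \<sigma>_def)
qed

lemma set_1_6: "{1..6::nat} = {1, 2, 3, 4, 5, 6}"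
  by auto

text \<open>Normal form of a perfect matching: \<open>P\<close> is the edge through 1 and
  \<open>Q\<close> the edge through the least vertex outside \<open>P\<close>. The two free
  endpoints \<open>u\<close> and \<open>v\<close> then determine everything.\<close>

lemma matching_cases_aux:
  fixes P Q R :: "nat set"
  assumes "card P = 2" "card Q = 2" "P \<union> Q \<union> R = {1..6}" "P \<inter> Q = {}" "(P \<union> Q) \<inter> R = {}"
    and "1 \<in> P" "(if 2 \<in> P then 3 else 2) \<in> Q"
  shows "{P, Q, R} \<in>
   {{{1,2}, {3,4}, {5,6}},
    {{1,2}, {3,5}, {4,6}},
    {{1,2}, {3,6}, {4,5}},
    {{1,3}, {2,4}, {5,6}},
    {{1,3}, {2,5}, {4,6}},
    {{1,3}, {2,6}, {4,5}},
    {{1,4}, {2,3}, {5,6}},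
    {{1,4}, {2,5}, {3,6}},
    {{1,4}, {2,6}, {3,5}},
    {{1,5}, {2,3}, {4,6}},
    {{1,5}, {2,4}, {3,6}},
    {{1,5}, {2,6}, {3,4}},
    {{1,6}, {2,3}, {4,5}},
    {{1,6}, {2,4}, {3,5}},
    {{1,6}, {2,5}, {3,4}}}"
proof -
  define m :: nat where "m = (if 2 \<in> P then 3 else 2)"
  have "card (P - {1}) = 1" "card (Q - {m}) = 1" using assms by (simp_all add: m_def split: if_splits)
  then obtain u v where uv: "P - {1} = {u}" "Q - {m} = {v}" by (metis card_1_singletonE)
  have PQ: "P = {1, u}" "Q = {m, v}" using uv assms by (auto simp: m_def split: if_splits)
  have R: "R = {1..6} - P - Q" using assms by blast
  have "u \<in> {1..6} - {1}" "v \<in> {1..6} - {1}" using uv assms by blast+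
  then have "u = 2 \<or> u = 3 \<or> u = 4 \<or> u = 5 \<or> u = 6" "v = 2 \<or> v = 3 \<or> v = 4 \<or> v = 5 \<or> v = 6"
    by auto
  moreover have "m = (if u = 2 then 3 else 2)" by (simp add: m_def PQ)
  moreover have "u \<noteq> m" "u \<noteq> v" "v \<noteq> m" using assms(4) uv by (auto simp: PQ)
  ultimately show ?thesis unfolding R PQ set_1_6
    by (elim disjE) (simp_all add: insert_Diff_if insert_commute)
qed

lemma matching_cases:
  fixes P Q R :: "nat set"
  assumes "card P = 2" "card Q = 2" "card R = 2" "P \<union> Q \<union> R = {1..6}" "P \<inter> Q = {}" "P \<inter> R = {}" "Q \<inter> R = {}"
  shows "{P, Q, R} \<in>
   {{{1,2}, {3,4}, {5,6}},
    {{1,2}, {3,5}, {4,6}},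
    {{1,2}, {3,6}, {4,5}},
    {{1,3}, {2,4}, {5,6}},
    {{1,3}, {2,5}, {4,6}},
    {{1,3}, {2,6}, {4,5}},
    {{1,4}, {2,3}, {5,6}},
    {{1,4}, {2,5}, {3,6}},
    {{1,4}, {2,6}, {3,5}},
    {{1,5}, {2,3}, {4,6}},
    {{1,5}, {2,4}, {3,6}},
    {{1,5}, {2,6}, {3,4}},
    {{1,6}, {2,3}, {4,5}},
    {{1,6}, {2,4}, {3,5}},
    {{1,6}, {2,5}, {3,4}}}" (is "_ \<in> ?M")
proof -
  have step: "{P, Q, R} \<in> ?M"
    if "1 \<in> P" "card P = 2" "card Q = 2" "card R = 2" "P \<union> Q \<union> R = {1..6}" "P \<inter> Q = {}" "P \<inter> R = {}" "Q \<inter> R = {}"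
    for P Q R :: "nat set"
  proof -
    define m :: nat where "m = (if 2 \<in> P then 3 else 2)"
    have "m \<notin> P"
    proof
      assume "m \<in> P"
      then have "{1, 2, 3} \<subseteq> P" using that(1) by (auto simp: m_def split: if_splits)
      then have "card {1, 2, 3 :: nat} \<le> card P" using that(2) by (intro card_mono) (simp_all add: card_ge_0_finite)
      then show False using that(2) by simp
    qed
    moreover have "m \<in> P \<union> Q \<union> R" unfolding that(5) by (simp add: m_def)
    ultimately consider "m \<in> Q" | "m \<in> R" by blast
    then show ?thesis
    proof cases
      case 1
      then show ?thesis using that unfolding m_def by (intro matching_cases_aux) blast+
    next
      case 2
      then have "{P, R, Q} \<in> ?M" using that unfolding m_def by (intro matching_cases_aux) blast+
      then show ?thesis by (simp only: insert_commute)
    qed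
  qed
  have "1 \<in> P \<union> Q \<union> R" unfolding assms(4) by simp
  then consider "1 \<in> P" | "1 \<in> Q" | "1 \<in> R" by blast
  then show ?thesis
  proof cases
    case 1
    then show ?thesis using assms by (intro step) blast+
  next
    case 2
    then have "{Q, P, R} \<in> ?M" using assms by (intro step) blast+
    then show ?thesis by (simp only: insert_commute)
  next
    case 3
    then have "{R, P, Q} \<in> ?M" using assms by (intro step) blast+
    then show ?thesis by (simp only: insert_commute)
  qed
qed

lemma index_orbit_matchings:
  "index_orbit {{1,2}, {3,4}, {5,6}} =
   {{{1,2}, {3,4}, {5,6}},
    {{1,2}, {3,5}, {4,6}},
    {{1,2}, {3,6}, {4,5}},
    {{1,3}, {2,4}, {5,6}},
    {{1,3}, {2,5}, {4,6}},
    {{1,3}, {2,6}, {4,5}},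
    {{1,4}, {2,3}, {5,6}},
    {{1,4}, {2,5}, {3,6}},
    {{1,4}, {2,6}, {3,5}},
    {{1,5}, {2,3}, {4,6}},
    {{1,5}, {2,4}, {3,6}},
    {{1,5}, {2,6}, {3,4}},
    {{1,6}, {2,3}, {4,5}},
    {{1,6}, {2,4}, {3,5}},
    {{1,6}, {2,5}, {3,4}}}" (is "_ = ?M")
proof
  show "index_orbit {{1,2}, {3,4}, {5,6}} \<subseteq> ?M"
  proof
    fix Y assume "Y \<in> index_orbit {{1,2}, {3,4}, {5,6}}"
    then obtain \<sigma> where s: "\<sigma> permutes {1..6}" "Y = (\<lambda>e. \<sigma> ` e) ` {{1,2}, {3,4}, {5,6}}"
      by (auto simp: index_orbit_def)
    have inj: "inj \<sigma>" using s permutes_inj by blast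
    have Y: "Y = {{\<sigma> 1, \<sigma> 2}, {\<sigma> 3, \<sigma> 4}, {\<sigma> 5, \<sigma> 6}}" using s by simp
    have "{\<sigma> 1, \<sigma> 2} \<union> {\<sigma> 3, \<sigma> 4} \<union> {\<sigma> 5, \<sigma> 6} = \<sigma> ` {1..6}"
      unfolding set_1_6 by (simp only: image_insert image_empty Un_insert_left Un_empty_left)
    also have "\<dots> = {1..6}" by (rule permutes_image[OF s(1)])
    finally have un: "{\<sigma> 1, \<sigma> 2} \<union> {\<sigma> 3, \<sigma> 4} \<union> {\<sigma> 5, \<sigma> 6} = {1..6}" .
    show "Y \<in> ?M" unfolding Y
      using inj by (intro matching_cases un) (auto simp: inj_eq)
  qed
  \<comment> \<open>The leading 0 is a dummy entry, so that positions 1 to 6 of the list carry the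
    images of the vertices 1 to 6.\<close>
  have img: "(\<lambda>e. (!) (0 # xs) ` e) ` {{1,2}, {3,4}, {5,6}} \<in> index_orbit {{1,2}, {3,4}, {5,6}}"
    if xs: "distinct xs" "set xs = {1, 2, 3, 4, 5, 6}" for xs
  proof -
    obtain \<sigma> where \<sigma>: "\<sigma> permutes {1..6}" "\<sigma> 1 = xs ! 0" "\<sigma> 2 = xs ! 1" "\<sigma> 3 = xs ! 2"
      "\<sigma> 4 = xs ! 3" "\<sigma> 5 = xs ! 4" "\<sigma> 6 = xs ! 5"
      by (rule distinct_perm_list[OF xs[folded set_1_6]])
    have "(\<lambda>e. (!) (0 # xs) ` e) ` {{1,2}, {3,4}, {5,6}} = (\<lambda>e. \<sigma> ` e) ` {{1,2}, {3,4}, {5,6}}"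
      using \<sigma>(2-) by simp
    then show ?thesis using \<sigma>(1) unfolding index_orbit_def by blast
  qed
  show "?M \<subseteq> index_orbit {{1,2}, {3,4}, {5,6}}"
  proof -
    have m0: "{{1,2}, {3,4}, {5,6}} \<in> index_orbit {{1,2}, {3,4}, {5,6}}"
      using img[of "[1, 2, 3, 4, 5, 6]"] by (simp add: insert_commute)
    have m1: "{{1,2}, {3,5}, {4,6}} \<in> index_orbit {{1,2}, {3,4}, {5,6}}"
      using img[of "[1, 2, 3, 5, 4, 6]"] by (simp add: insert_commute)
    have m2: "{{1,2}, {3,6}, {4,5}} \<in> index_orbit {{1,2}, {3,4}, {5,6}}"
      using img[of "[1, 2, 3, 6, 4, 5]"] by (simp add: insert_commute)
    have m3: "{{1,3}, {2,4}, {5,6}} \<in> index_orbit {{1,2}, {3,4}, {5,6}}"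
      using img[of "[1, 3, 2, 4, 5, 6]"] by (simp add: insert_commute)
    have m4: "{{1,3}, {2,5}, {4,6}} \<in> index_orbit {{1,2}, {3,4}, {5,6}}"
      using img[of "[1, 3, 2, 5, 4, 6]"] by (simp add: insert_commute)
    have m5: "{{1,3}, {2,6}, {4,5}} \<in> index_orbit {{1,2}, {3,4}, {5,6}}"
      using img[of "[1, 3, 2, 6, 4, 5]"] by (simp add: insert_commute)
    have m6: "{{1,4}, {2,3}, {5,6}} \<in> index_orbit {{1,2}, {3,4}, {5,6}}"
      using img[of "[1, 4, 2, 3, 5, 6]"] by (simp add: insert_commute)
    have m7: "{{1,4}, {2,5}, {3,6}} \<in> index_orbit {{1,2}, {3,4}, {5,6}}"
      using img[of "[1, 4, 2, 5, 3, 6]"] by (simp add: insert_commute)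
    have m8: "{{1,4}, {2,6}, {3,5}} \<in> index_orbit {{1,2}, {3,4}, {5,6}}"
      using img[of "[1, 4, 2, 6, 3, 5]"] by (simp add: insert_commute)
    have m9: "{{1,5}, {2,3}, {4,6}} \<in> index_orbit {{1,2}, {3,4}, {5,6}}"
      using img[of "[1, 5, 2, 3, 4, 6]"] by (simp add: insert_commute)
    have m10: "{{1,5}, {2,4}, {3,6}} \<in> index_orbit {{1,2}, {3,4}, {5,6}}"
      using img[of "[1, 5, 2, 4, 3, 6]"] by (simp add: insert_commute)
    have m11: "{{1,5}, {2,6}, {3,4}} \<in> index_orbit {{1,2}, {3,4}, {5,6}}"
      using img[of "[1, 5, 2, 6, 3, 4]"] by (simp add: insert_commute)
    have m12: "{{1,6}, {2,3}, {4,5}} \<in> index_orbit {{1,2}, {3,4}, {5,6}}"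
      using img[of "[1, 6, 2, 3, 4, 5]"] by (simp add: insert_commute)
    have m13: "{{1,6}, {2,4}, {3,5}} \<in> index_orbit {{1,2}, {3,4}, {5,6}}"
      using img[of "[1, 6, 2, 4, 3, 5]"] by (simp add: insert_commute)
    have m14: "{{1,6}, {2,5}, {3,4}} \<in> index_orbit {{1,2}, {3,4}, {5,6}}"
      using img[of "[1, 6, 2, 5, 3, 4]"] by (simp add: insert_commute)
    show ?thesis using m0 m1 m2 m3 m4 m5 m6 m7 m8 m9 m10 m11 m12 m13 m14 by (simp only: insert_subset empty_subsetI simp_thms)
  qed
qed

lemma orbit_sum_matchings:
  "orbit_sum {{1,2}, {3,4}, {5,6}} x =
    (x 1 - x 2)\<^sup>2 * (x 3 - x 4)\<^sup>2 * (x 5 - x 6)\<^sup>2 +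
    (x 1 - x 2)\<^sup>2 * (x 3 - x 5)\<^sup>2 * (x 4 - x 6)\<^sup>2 +
    (x 1 - x 2)\<^sup>2 * (x 3 - x 6)\<^sup>2 * (x 4 - x 5)\<^sup>2 +
    (x 1 - x 3)\<^sup>2 * (x 2 - x 4)\<^sup>2 * (x 5 - x 6)\<^sup>2 +
    (x 1 - x 3)\<^sup>2 * (x 2 - x 5)\<^sup>2 * (x 4 - x 6)\<^sup>2 +
    (x 1 - x 3)\<^sup>2 * (x 2 - x 6)\<^sup>2 * (x 4 - x 5)\<^sup>2 +
    (x 1 - x 4)\<^sup>2 * (x 2 - x 3)\<^sup>2 * (x 5 - x 6)\<^sup>2 +
    (x 1 - x 4)\<^sup>2 * (x 2 - x 5)\<^sup>2 * (x 3 - x 6)\<^sup>2 +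
    (x 1 - x 4)\<^sup>2 * (x 2 - x 6)\<^sup>2 * (x 3 - x 5)\<^sup>2 +
    (x 1 - x 5)\<^sup>2 * (x 2 - x 3)\<^sup>2 * (x 4 - x 6)\<^sup>2 +
    (x 1 - x 5)\<^sup>2 * (x 2 - x 4)\<^sup>2 * (x 3 - x 6)\<^sup>2 +
    (x 1 - x 5)\<^sup>2 * (x 2 - x 6)\<^sup>2 * (x 3 - x 4)\<^sup>2 +
    (x 1 - x 6)\<^sup>2 * (x 2 - x 3)\<^sup>2 * (x 4 - x 5)\<^sup>2 +
    (x 1 - x 6)\<^sup>2 * (x 2 - x 4)\<^sup>2 * (x 3 - x 5)\<^sup>2 +
    (x 1 - x 6)\<^sup>2 * (x 2 - x 5)\<^sup>2 * (x 3 - x 4)\<^sup>2"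
  unfolding orbit_sum_def index_orbit_matchings
proof -
  define g where "g E' = (\<Prod>e\<in>E'. (x (Min e) - x (Max e))\<^sup>2)" for E'
  let ?Xs = "[{{1,2}, {3,4}, {5,6}}, {{1,2}, {3,5}, {4,6}}, {{1,2}, {3,6}, {4,5}}, {{1,3}, {2,4}, {5,6}}, {{1,3}, {2,5}, {4,6}}, {{1,3}, {2,6}, {4,5}}, {{1,4}, {2,3}, {5,6}}, {{1,4}, {2,5}, {3,6}}, {{1,4}, {2,6}, {3,5}}, {{1,5}, {2,3}, {4,6}}, {{1,5}, {2,4}, {3,6}}, {{1,5}, {2,6}, {3,4}}, {{1,6}, {2,3}, {4,5}}, {{1,6}, {2,4}, {3,5}}, {{1,6}, {2,5}, {3,4}}] :: nat set set list"
  \<comment> \<open>The matchings are told apart by which of eleven edges they contain, so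
    distinctness becomes a comparison of Boolean lists instead of sets of sets.\<close>
  have "distinct (map (\<lambda>M. map (\<lambda>e. e \<in> M) [{1,2::nat}, {1,3}, {1,4}, {1,5}, {1,6}, {2,3}, {2,4}, {2,5}, {2,6}, {3,4}, {3,5}]) ?Xs)"
    by (simp add: doubleton_eq_iff)
  then have "distinct ?Xs" by (rule distinct_map[THEN iffD1, THEN conjunct1])
  then have "sum g (set ?Xs) = sum_list (map g ?Xs)"
    by (rule sum.distinct_set_conv_list)
  then have "sum g {{{1,2}, {3,4}, {5,6}}, {{1,2}, {3,5}, {4,6}}, {{1,2}, {3,6}, {4,5}}, {{1,3}, {2,4}, {5,6}}, {{1,3}, {2,5}, {4,6}}, {{1,3}, {2,6}, {4,5}}, {{1,4}, {2,3}, {5,6}}, {{1,4}, {2,5}, {3,6}}, {{1,4}, {2,6}, {3,5}}, {{1,5}, {2,3}, {4,6}}, {{1,5}, {2,4}, {3,6}}, {{1,5}, {2,6}, {3,4}}, {{1,6}, {2,3}, {4,5}}, {{1,6}, {2,4}, {3,5}}, {{1,6}, {2,5}, {3,4}}} = sum_list (map g ?Xs)" by (simp only: list.set)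
  moreover have "g {{1,2}, {3,4}, {5,6}} = (x 1 - x 2)\<^sup>2 * (x 3 - x 4)\<^sup>2 * (x 5 - x 6)\<^sup>2"
    "g {{1,2}, {3,5}, {4,6}} = (x 1 - x 2)\<^sup>2 * (x 3 - x 5)\<^sup>2 * (x 4 - x 6)\<^sup>2"
    "g {{1,2}, {3,6}, {4,5}} = (x 1 - x 2)\<^sup>2 * (x 3 - x 6)\<^sup>2 * (x 4 - x 5)\<^sup>2"
    "g {{1,3}, {2,4}, {5,6}} = (x 1 - x 3)\<^sup>2 * (x 2 - x 4)\<^sup>2 * (x 5 - x 6)\<^sup>2"
    "g {{1,3}, {2,5}, {4,6}} = (x 1 - x 3)\<^sup>2 * (x 2 - x 5)\<^sup>2 * (x 4 - x 6)\<^sup>2"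
    "g {{1,3}, {2,6}, {4,5}} = (x 1 - x 3)\<^sup>2 * (x 2 - x 6)\<^sup>2 * (x 4 - x 5)\<^sup>2"
    "g {{1,4}, {2,3}, {5,6}} = (x 1 - x 4)\<^sup>2 * (x 2 - x 3)\<^sup>2 * (x 5 - x 6)\<^sup>2"
    "g {{1,4}, {2,5}, {3,6}} = (x 1 - x 4)\<^sup>2 * (x 2 - x 5)\<^sup>2 * (x 3 - x 6)\<^sup>2"
    "g {{1,4}, {2,6}, {3,5}} = (x 1 - x 4)\<^sup>2 * (x 2 - x 6)\<^sup>2 * (x 3 - x 5)\<^sup>2"
    "g {{1,5}, {2,3}, {4,6}} = (x 1 - x 5)\<^sup>2 * (x 2 - x 3)\<^sup>2 * (x 4 - x 6)\<^sup>2"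
    "g {{1,5}, {2,4}, {3,6}} = (x 1 - x 5)\<^sup>2 * (x 2 - x 4)\<^sup>2 * (x 3 - x 6)\<^sup>2"
    "g {{1,5}, {2,6}, {3,4}} = (x 1 - x 5)\<^sup>2 * (x 2 - x 6)\<^sup>2 * (x 3 - x 4)\<^sup>2"
    "g {{1,6}, {2,3}, {4,5}} = (x 1 - x 6)\<^sup>2 * (x 2 - x 3)\<^sup>2 * (x 4 - x 5)\<^sup>2"
    "g {{1,6}, {2,4}, {3,5}} = (x 1 - x 6)\<^sup>2 * (x 2 - x 4)\<^sup>2 * (x 3 - x 5)\<^sup>2"
    "g {{1,6}, {2,5}, {3,4}} = (x 1 - x 6)\<^sup>2 * (x 2 - x 5)\<^sup>2 * (x 3 - x 4)\<^sup>2"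
    unfolding g_def by (simp_all add: doubleton_eq_iff mult.assoc numeral_2_eq_2[symmetric])
  ultimately show "(\<Sum>E'\<in>{{{1,2}, {3,4}, {5,6}}, {{1,2}, {3,5}, {4,6}}, {{1,2}, {3,6}, {4,5}}, {{1,3}, {2,4}, {5,6}}, {{1,3}, {2,5}, {4,6}}, {{1,3}, {2,6}, {4,5}}, {{1,4}, {2,3}, {5,6}}, {{1,4}, {2,5}, {3,6}}, {{1,4}, {2,6}, {3,5}}, {{1,5}, {2,3}, {4,6}}, {{1,5}, {2,4}, {3,6}}, {{1,5}, {2,6}, {3,4}}, {{1,6}, {2,3}, {4,5}}, {{1,6}, {2,4}, {3,5}}, {{1,6}, {2,5}, {3,4}}}. \<Prod>e\<in>E'. (x (Min e) - x (Max e))\<^sup>2) = (x 1 - x 2)\<^sup>2 * (x 3 - x 4)\<^sup>2 * (x 5 - x 6)\<^sup>2 +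
    (x 1 - x 2)\<^sup>2 * (x 3 - x 5)\<^sup>2 * (x 4 - x 6)\<^sup>2 +
    (x 1 - x 2)\<^sup>2 * (x 3 - x 6)\<^sup>2 * (x 4 - x 5)\<^sup>2 +
    (x 1 - x 3)\<^sup>2 * (x 2 - x 4)\<^sup>2 * (x 5 - x 6)\<^sup>2 +
    (x 1 - x 3)\<^sup>2 * (x 2 - x 5)\<^sup>2 * (x 4 - x 6)\<^sup>2 +
    (x 1 - x 3)\<^sup>2 * (x 2 - x 6)\<^sup>2 * (x 4 - x 5)\<^sup>2 +
    (x 1 - x 4)\<^sup>2 * (x 2 - x 3)\<^sup>2 * (x 5 - x 6)\<^sup>2 +
    (x 1 - x 4)\<^sup>2 * (x 2 - x 5)\<^sup>2 * (x 3 - x 6)\<^sup>2 +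
    (x 1 - x 4)\<^sup>2 * (x 2 - x 6)\<^sup>2 * (x 3 - x 5)\<^sup>2 +
    (x 1 - x 5)\<^sup>2 * (x 2 - x 3)\<^sup>2 * (x 4 - x 6)\<^sup>2 +
    (x 1 - x 5)\<^sup>2 * (x 2 - x 4)\<^sup>2 * (x 3 - x 6)\<^sup>2 +
    (x 1 - x 5)\<^sup>2 * (x 2 - x 6)\<^sup>2 * (x 3 - x 4)\<^sup>2 +
    (x 1 - x 6)\<^sup>2 * (x 2 - x 3)\<^sup>2 * (x 4 - x 5)\<^sup>2 +
    (x 1 - x 6)\<^sup>2 * (x 2 - x 4)\<^sup>2 * (x 3 - x 5)\<^sup>2 +
    (x 1 - x 6)\<^sup>2 * (x 2 - x 5)\<^sup>2 * (x 3 - x 4)\<^sup>2"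
    unfolding g_def[symmetric] by (simp only: list.map sum_list.Cons sum_list.Nil add_0_right add.assoc)
qed

section \<open>Pairs of disjoint triangles\<close>

definition edges :: "nat set \<Rightarrow> nat set set" where
  "edges A = {e. e \<subseteq> A \<and> card e = 2}"

lemma edges_triple:
  assumes "distinct [a, b, c]"
  shows "edges {a, b, c} = {{a, b}, {b, c}, {c, a}}"
proof
  show "edges {a, b, c} \<subseteq> {{a, b}, {b, c}, {c, a}}"
  proof
    fix e assume "e \<in> edges {a, b, c}"
    then obtain u v where "e = {u, v}" "u \<noteq> v" "u \<in> {a, b, c}" "v \<in> {a, b, c}"
      by (auto simp: edges_def card_2_iff)
    then show "e \<in> {{a, b}, {b, c}, {c, a}}" by auto
  qed
qed (use assms in \<open>auto simp: edges_def\<close>)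

text \<open>The graph is the union of the complete graphs on two complementary triples, so its orbit
  corresponds to the ten partitions of six vertices into two triples. The triple containing 1 labels
  the partition.\<close>

lemma index_orbit_triples:
  "index_orbit {{1,2}, {2,3}, {3,1}, {4,5}, {5,6}, {6,4}} =
   {{{1,2}, {2,3}, {3,1}, {4,5}, {5,6}, {6,4}},
    {{1,2}, {2,4}, {4,1}, {3,5}, {5,6}, {6,3}},
    {{1,2}, {2,5}, {5,1}, {3,4}, {4,6}, {6,3}},
    {{1,2}, {2,6}, {6,1}, {3,4}, {4,5}, {5,3}},
    {{1,3}, {3,4}, {4,1}, {2,5}, {5,6}, {6,2}},
    {{1,3}, {3,5}, {5,1}, {2,4}, {4,6}, {6,2}},
    {{1,3}, {3,6}, {6,1}, {2,4}, {4,5}, {5,2}},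
    {{1,4}, {4,5}, {5,1}, {2,3}, {3,6}, {6,2}},
    {{1,4}, {4,6}, {6,1}, {2,3}, {3,5}, {5,2}},
    {{1,5}, {5,6}, {6,1}, {2,3}, {3,4}, {4,2}}}" (is "_ = ?M")
proof
  show "index_orbit {{1,2}, {2,3}, {3,1}, {4,5}, {5,6}, {6,4}} \<subseteq> ?M"
  proof
    fix Y assume "Y \<in> index_orbit {{1,2}, {2,3}, {3,1}, {4,5}, {5,6}, {6,4}}"
    then obtain \<sigma> where s: "\<sigma> permutes {1..6}" "Y = (\<lambda>e. \<sigma> ` e) ` {{1,2}, {2,3}, {3,1}, {4,5}, {5,6}, {6,4}}"
      by (auto simp: index_orbit_def)
    have inj: "inj \<sigma>" using s permutes_inj by blast
    define A where "A = \<sigma> ` {1, 2, 3}"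
    define B where "B = \<sigma> ` {4, 5, 6}"
    have "A \<union> B = \<sigma> ` {1..6}" unfolding A_def B_def set_1_6 by (simp only: image_insert image_empty Un_insert_left Un_empty_left)
    then have AB: "A \<union> B = {1..6}" "A \<inter> B = {}"
      using permutes_image[OF s(1)] inj by (auto simp: A_def B_def inj_eq)
    have card: "card A = 3" "card B = 3"
      using inj by (simp_all add: A_def B_def inj_eq)
    have Y: "Y = edges A \<union> edges B"
      using s inj edges_triple[of "\<sigma> 1" "\<sigma> 2" "\<sigma> 3"] edges_triple[of "\<sigma> 4" "\<sigma> 5" "\<sigma> 6"]
      by (auto simp: A_def B_def inj_eq)
    have main: "edges A \<union> edges B \<in> ?M" if "1 \<in> A" "A \<union> B = {1..6}" "A \<inter> B = {}" "card A = 3" for A B :: "nat set"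
    proof -
      have fin: "finite A" using that(4) by (simp add: card_ge_0_finite)
      have "card (A - {1}) = 2" using that by simp
      then obtain u v where uv: "A - {1} = {u, v}" "u \<noteq> v" by (auto simp: card_2_iff)
      have A: "A = {1, u, v}" using uv that(1) by blast
      have B: "B = {1..6} - A" using that by blast
      have "u \<in> {1..6} - {1}" "v \<in> {1..6} - {1}" using uv that(2) by blast+
      then have "u = 2 \<or> u = 3 \<or> u = 4 \<or> u = 5 \<or> u = 6" "v = 2 \<or> v = 3 \<or> v = 4 \<or> v = 5 \<or> v = 6"
        by auto
      then show ?thesis using uv(2) unfolding A B set_1_6
        by (elim disjE) (simp_all add: insert_Diff_if edges_triple insert_commute)
    qed
    have "1 \<in> A \<union> B" unfolding AB by simp
    then consider "1 \<in> A" | "1 \<in> B" by blast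
    then show "Y \<in> ?M"
    proof cases
      case 1
      then show ?thesis unfolding Y using AB card by (intro main)
    next
      case 2
      have "B \<union> A = {1..6}" "B \<inter> A = {}" using AB by blast+
      with 2 card have "edges B \<union> edges A \<in> ?M" by (intro main)
      then show ?thesis unfolding Y by (simp only: Un_commute)
    qed
  qed
  have img: "(\<lambda>e. (!) (0 # xs) ` e) ` {{1,2}, {2,3}, {3,1}, {4,5}, {5,6}, {6,4}} \<in> index_orbit {{1,2}, {2,3}, {3,1}, {4,5}, {5,6}, {6,4}}"
    if xs: "distinct xs" "set xs = {1, 2, 3, 4, 5, 6}" for xs
  proof -
    obtain \<sigma> where \<sigma>: "\<sigma> permutes {1..6}" "\<sigma> 1 = xs ! 0" "\<sigma> 2 = xs ! 1" "\<sigma> 3 = xs ! 2"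
      "\<sigma> 4 = xs ! 3" "\<sigma> 5 = xs ! 4" "\<sigma> 6 = xs ! 5"
      by (rule distinct_perm_list[OF xs[folded set_1_6]])
    have "(\<lambda>e. (!) (0 # xs) ` e) ` {{1,2}, {2,3}, {3,1}, {4,5}, {5,6}, {6,4}} = (\<lambda>e. \<sigma> ` e) ` {{1,2}, {2,3}, {3,1}, {4,5}, {5,6}, {6,4}}"
      using \<sigma>(2-) by simp
    then show ?thesis using \<sigma>(1) unfolding index_orbit_def by blast
  qed
  show "?M \<subseteq> index_orbit {{1,2}, {2,3}, {3,1}, {4,5}, {5,6}, {6,4}}"
  proof -
    have m0: "{{1,2}, {2,3}, {3,1}, {4,5}, {5,6}, {6,4}} \<in> index_orbit {{1,2}, {2,3}, {3,1}, {4,5}, {5,6}, {6,4}}"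
      using img[of "[1, 2, 3, 4, 5, 6]"] by (simp add: insert_commute)
    have m1: "{{1,2}, {2,4}, {4,1}, {3,5}, {5,6}, {6,3}} \<in> index_orbit {{1,2}, {2,3}, {3,1}, {4,5}, {5,6}, {6,4}}"
      using img[of "[1, 2, 4, 3, 5, 6]"] by (simp add: insert_commute)
    have m2: "{{1,2}, {2,5}, {5,1}, {3,4}, {4,6}, {6,3}} \<in> index_orbit {{1,2}, {2,3}, {3,1}, {4,5}, {5,6}, {6,4}}"
      using img[of "[1, 2, 5, 3, 4, 6]"] by (simp add: insert_commute)
    have m3: "{{1,2}, {2,6}, {6,1}, {3,4}, {4,5}, {5,3}} \<in> index_orbit {{1,2}, {2,3}, {3,1}, {4,5}, {5,6}, {6,4}}"
      using img[of "[1, 2, 6, 3, 4, 5]"] by (simp add: insert_commute)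
    have m4: "{{1,3}, {3,4}, {4,1}, {2,5}, {5,6}, {6,2}} \<in> index_orbit {{1,2}, {2,3}, {3,1}, {4,5}, {5,6}, {6,4}}"
      using img[of "[1, 3, 4, 2, 5, 6]"] by (simp add: insert_commute)
    have m5: "{{1,3}, {3,5}, {5,1}, {2,4}, {4,6}, {6,2}} \<in> index_orbit {{1,2}, {2,3}, {3,1}, {4,5}, {5,6}, {6,4}}"
      using img[of "[1, 3, 5, 2, 4, 6]"] by (simp add: insert_commute)
    have m6: "{{1,3}, {3,6}, {6,1}, {2,4}, {4,5}, {5,2}} \<in> index_orbit {{1,2}, {2,3}, {3,1}, {4,5}, {5,6}, {6,4}}"
      using img[of "[1, 3, 6, 2, 4, 5]"] by (simp add: insert_commute)
    have m7: "{{1,4}, {4,5}, {5,1}, {2,3}, {3,6}, {6,2}} \<in> index_orbit {{1,2}, {2,3}, {3,1}, {4,5}, {5,6}, {6,4}}"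
      using img[of "[1, 4, 5, 2, 3, 6]"] by (simp add: insert_commute)
    have m8: "{{1,4}, {4,6}, {6,1}, {2,3}, {3,5}, {5,2}} \<in> index_orbit {{1,2}, {2,3}, {3,1}, {4,5}, {5,6}, {6,4}}"
      using img[of "[1, 4, 6, 2, 3, 5]"] by (simp add: insert_commute)
    have m9: "{{1,5}, {5,6}, {6,1}, {2,3}, {3,4}, {4,2}} \<in> index_orbit {{1,2}, {2,3}, {3,1}, {4,5}, {5,6}, {6,4}}"
      using img[of "[1, 5, 6, 2, 3, 4]"] by (simp add: insert_commute)
    show ?thesis using m0 m1 m2 m3 m4 m5 m6 m7 m8 m9 by (simp only: insert_subset empty_subsetI simp_thms)
  qed
qed

lemma orbit_sum_triples:
  "orbit_sum {{1,2}, {2,3}, {3,1}, {4,5}, {5,6}, {6,4}} x =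
    (x 1 - x 2)\<^sup>2 * (x 2 - x 3)\<^sup>2 * (x 1 - x 3)\<^sup>2 * (x 4 - x 5)\<^sup>2 * (x 5 - x 6)\<^sup>2 * (x 4 - x 6)\<^sup>2 +
    (x 1 - x 2)\<^sup>2 * (x 2 - x 4)\<^sup>2 * (x 1 - x 4)\<^sup>2 * (x 3 - x 5)\<^sup>2 * (x 5 - x 6)\<^sup>2 * (x 3 - x 6)\<^sup>2 +
    (x 1 - x 2)\<^sup>2 * (x 2 - x 5)\<^sup>2 * (x 1 - x 5)\<^sup>2 * (x 3 - x 4)\<^sup>2 * (x 4 - x 6)\<^sup>2 * (x 3 - x 6)\<^sup>2 +
    (x 1 - x 2)\<^sup>2 * (x 2 - x 6)\<^sup>2 * (x 1 - x 6)\<^sup>2 * (x 3 - x 4)\<^sup>2 * (x 4 - x 5)\<^sup>2 * (x 3 - x 5)\<^sup>2 +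
    (x 1 - x 3)\<^sup>2 * (x 3 - x 4)\<^sup>2 * (x 1 - x 4)\<^sup>2 * (x 2 - x 5)\<^sup>2 * (x 5 - x 6)\<^sup>2 * (x 2 - x 6)\<^sup>2 +
    (x 1 - x 3)\<^sup>2 * (x 3 - x 5)\<^sup>2 * (x 1 - x 5)\<^sup>2 * (x 2 - x 4)\<^sup>2 * (x 4 - x 6)\<^sup>2 * (x 2 - x 6)\<^sup>2 +
    (x 1 - x 3)\<^sup>2 * (x 3 - x 6)\<^sup>2 * (x 1 - x 6)\<^sup>2 * (x 2 - x 4)\<^sup>2 * (x 4 - x 5)\<^sup>2 * (x 2 - x 5)\<^sup>2 +
    (x 1 - x 4)\<^sup>2 * (x 4 - x 5)\<^sup>2 * (x 1 - x 5)\<^sup>2 * (x 2 - x 3)\<^sup>2 * (x 3 - x 6)\<^sup>2 * (x 2 - x 6)\<^sup>2 +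
    (x 1 - x 4)\<^sup>2 * (x 4 - x 6)\<^sup>2 * (x 1 - x 6)\<^sup>2 * (x 2 - x 3)\<^sup>2 * (x 3 - x 5)\<^sup>2 * (x 2 - x 5)\<^sup>2 +
    (x 1 - x 5)\<^sup>2 * (x 5 - x 6)\<^sup>2 * (x 1 - x 6)\<^sup>2 * (x 2 - x 3)\<^sup>2 * (x 3 - x 4)\<^sup>2 * (x 2 - x 4)\<^sup>2"
  unfolding orbit_sum_def index_orbit_triples
proof -
  define g where "g E' = (\<Prod>e\<in>E'. (x (Min e) - x (Max e))\<^sup>2)" for E'
  let ?Xs = "[{{1,2}, {2,3}, {3,1}, {4,5}, {5,6}, {6,4}}, {{1,2}, {2,4}, {4,1}, {3,5}, {5,6}, {6,3}}, {{1,2}, {2,5}, {5,1}, {3,4}, {4,6}, {6,3}}, {{1,2}, {2,6}, {6,1}, {3,4}, {4,5}, {5,3}}, {{1,3}, {3,4}, {4,1}, {2,5}, {5,6}, {6,2}}, {{1,3}, {3,5}, {5,1}, {2,4}, {4,6}, {6,2}}, {{1,3}, {3,6}, {6,1}, {2,4}, {4,5}, {5,2}}, {{1,4}, {4,5}, {5,1}, {2,3}, {3,6}, {6,2}}, {{1,4}, {4,6}, {6,1}, {2,3}, {3,5}, {5,2}}, {{1,5}, {5,6}, {6,1}, {2,3}, {3,4}, {4,2}}] :: nat set set list"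
  \<comment> \<open>The two edges at vertex 1 determine the triangle through 1 and hence the whole
    graph, so membership of the five possible edges at 1 separates the ten expressions.\<close>
  have "distinct (map (\<lambda>M. map (\<lambda>e. e \<in> M) [{1,2::nat}, {1,3}, {1,4}, {1,5}, {1,6}]) ?Xs)"
    by (simp add: doubleton_eq_iff)
  then have "distinct ?Xs" by (rule distinct_map[THEN iffD1, THEN conjunct1])
  then have "sum g (set ?Xs) = sum_list (map g ?Xs)"
    by (rule sum.distinct_set_conv_list)
  then have "sum g {{{1,2}, {2,3}, {3,1}, {4,5}, {5,6}, {6,4}}, {{1,2}, {2,4}, {4,1}, {3,5}, {5,6}, {6,3}}, {{1,2}, {2,5}, {5,1}, {3,4}, {4,6}, {6,3}}, {{1,2}, {2,6}, {6,1}, {3,4}, {4,5}, {5,3}}, {{1,3}, {3,4}, {4,1}, {2,5}, {5,6}, {6,2}}, {{1,3}, {3,5}, {5,1}, {2,4}, {4,6}, {6,2}}, {{1,3}, {3,6}, {6,1}, {2,4}, {4,5}, {5,2}}, {{1,4}, {4,5}, {5,1}, {2,3}, {3,6}, {6,2}}, {{1,4}, {4,6}, {6,1}, {2,3}, {3,5}, {5,2}}, {{1,5}, {5,6}, {6,1}, {2,3}, {3,4}, {4,2}}} = sum_list (map g ?Xs)" by (simp only: list.set)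
  moreover have "g {{1,2}, {2,3}, {3,1}, {4,5}, {5,6}, {6,4}} = (x 1 - x 2)\<^sup>2 * (x 2 - x 3)\<^sup>2 * (x 1 - x 3)\<^sup>2 * (x 4 - x 5)\<^sup>2 * (x 5 - x 6)\<^sup>2 * (x 4 - x 6)\<^sup>2"
    "g {{1,2}, {2,4}, {4,1}, {3,5}, {5,6}, {6,3}} = (x 1 - x 2)\<^sup>2 * (x 2 - x 4)\<^sup>2 * (x 1 - x 4)\<^sup>2 * (x 3 - x 5)\<^sup>2 * (x 5 - x 6)\<^sup>2 * (x 3 - x 6)\<^sup>2"
    "g {{1,2}, {2,5}, {5,1}, {3,4}, {4,6}, {6,3}} = (x 1 - x 2)\<^sup>2 * (x 2 - x 5)\<^sup>2 * (x 1 - x 5)\<^sup>2 * (x 3 - x 4)\<^sup>2 * (x 4 - x 6)\<^sup>2 * (x 3 - x 6)\<^sup>2"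
    "g {{1,2}, {2,6}, {6,1}, {3,4}, {4,5}, {5,3}} = (x 1 - x 2)\<^sup>2 * (x 2 - x 6)\<^sup>2 * (x 1 - x 6)\<^sup>2 * (x 3 - x 4)\<^sup>2 * (x 4 - x 5)\<^sup>2 * (x 3 - x 5)\<^sup>2"
    "g {{1,3}, {3,4}, {4,1}, {2,5}, {5,6}, {6,2}} = (x 1 - x 3)\<^sup>2 * (x 3 - x 4)\<^sup>2 * (x 1 - x 4)\<^sup>2 * (x 2 - x 5)\<^sup>2 * (x 5 - x 6)\<^sup>2 * (x 2 - x 6)\<^sup>2"
    "g {{1,3}, {3,5}, {5,1}, {2,4}, {4,6}, {6,2}} = (x 1 - x 3)\<^sup>2 * (x 3 - x 5)\<^sup>2 * (x 1 - x 5)\<^sup>2 * (x 2 - x 4)\<^sup>2 * (x 4 - x 6)\<^sup>2 * (x 2 - x 6)\<^sup>2"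
    "g {{1,3}, {3,6}, {6,1}, {2,4}, {4,5}, {5,2}} = (x 1 - x 3)\<^sup>2 * (x 3 - x 6)\<^sup>2 * (x 1 - x 6)\<^sup>2 * (x 2 - x 4)\<^sup>2 * (x 4 - x 5)\<^sup>2 * (x 2 - x 5)\<^sup>2"
    "g {{1,4}, {4,5}, {5,1}, {2,3}, {3,6}, {6,2}} = (x 1 - x 4)\<^sup>2 * (x 4 - x 5)\<^sup>2 * (x 1 - x 5)\<^sup>2 * (x 2 - x 3)\<^sup>2 * (x 3 - x 6)\<^sup>2 * (x 2 - x 6)\<^sup>2"
    "g {{1,4}, {4,6}, {6,1}, {2,3}, {3,5}, {5,2}} = (x 1 - x 4)\<^sup>2 * (x 4 - x 6)\<^sup>2 * (x 1 - x 6)\<^sup>2 * (x 2 - x 3)\<^sup>2 * (x 3 - x 5)\<^sup>2 * (x 2 - x 5)\<^sup>2"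
    "g {{1,5}, {5,6}, {6,1}, {2,3}, {3,4}, {4,2}} = (x 1 - x 5)\<^sup>2 * (x 5 - x 6)\<^sup>2 * (x 1 - x 6)\<^sup>2 * (x 2 - x 3)\<^sup>2 * (x 3 - x 4)\<^sup>2 * (x 2 - x 4)\<^sup>2"
    unfolding g_def by (simp_all add: doubleton_eq_iff mult.assoc numeral_2_eq_2[symmetric])
  ultimately show "(\<Sum>E'\<in>{{{1,2}, {2,3}, {3,1}, {4,5}, {5,6}, {6,4}}, {{1,2}, {2,4}, {4,1}, {3,5}, {5,6}, {6,3}}, {{1,2}, {2,5}, {5,1}, {3,4}, {4,6}, {6,3}}, {{1,2}, {2,6}, {6,1}, {3,4}, {4,5}, {5,3}}, {{1,3}, {3,4}, {4,1}, {2,5}, {5,6}, {6,2}}, {{1,3}, {3,5}, {5,1}, {2,4}, {4,6}, {6,2}}, {{1,3}, {3,6}, {6,1}, {2,4}, {4,5}, {5,2}}, {{1,4}, {4,5}, {5,1}, {2,3}, {3,6}, {6,2}}, {{1,4}, {4,6}, {6,1}, {2,3}, {3,5}, {5,2}}, {{1,5}, {5,6}, {6,1}, {2,3}, {3,4}, {4,2}}}. \<Prod>e\<in>E'. (x (Min e) - x (Max e))\<^sup>2) = (x 1 - x 2)\<^sup>2 * (x 2 - x 3)\<^sup>2 * (x 1 - x 3)\<^sup>2 * (x 4 - x 5)\<^sup>2 * (x 5 - x 6)\<^sup>2 * (x 4 - x 6)\<^sup>2 +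
    (x 1 - x 2)\<^sup>2 * (x 2 - x 4)\<^sup>2 * (x 1 - x 4)\<^sup>2 * (x 3 - x 5)\<^sup>2 * (x 5 - x 6)\<^sup>2 * (x 3 - x 6)\<^sup>2 +
    (x 1 - x 2)\<^sup>2 * (x 2 - x 5)\<^sup>2 * (x 1 - x 5)\<^sup>2 * (x 3 - x 4)\<^sup>2 * (x 4 - x 6)\<^sup>2 * (x 3 - x 6)\<^sup>2 +
    (x 1 - x 2)\<^sup>2 * (x 2 - x 6)\<^sup>2 * (x 1 - x 6)\<^sup>2 * (x 3 - x 4)\<^sup>2 * (x 4 - x 5)\<^sup>2 * (x 3 - x 5)\<^sup>2 +
    (x 1 - x 3)\<^sup>2 * (x 3 - x 4)\<^sup>2 * (x 1 - x 4)\<^sup>2 * (x 2 - x 5)\<^sup>2 * (x 5 - x 6)\<^sup>2 * (x 2 - x 6)\<^sup>2 +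
    (x 1 - x 3)\<^sup>2 * (x 3 - x 5)\<^sup>2 * (x 1 - x 5)\<^sup>2 * (x 2 - x 4)\<^sup>2 * (x 4 - x 6)\<^sup>2 * (x 2 - x 6)\<^sup>2 +
    (x 1 - x 3)\<^sup>2 * (x 3 - x 6)\<^sup>2 * (x 1 - x 6)\<^sup>2 * (x 2 - x 4)\<^sup>2 * (x 4 - x 5)\<^sup>2 * (x 2 - x 5)\<^sup>2 +
    (x 1 - x 4)\<^sup>2 * (x 4 - x 5)\<^sup>2 * (x 1 - x 5)\<^sup>2 * (x 2 - x 3)\<^sup>2 * (x 3 - x 6)\<^sup>2 * (x 2 - x 6)\<^sup>2 +
    (x 1 - x 4)\<^sup>2 * (x 4 - x 6)\<^sup>2 * (x 1 - x 6)\<^sup>2 * (x 2 - x 3)\<^sup>2 * (x 3 - x 5)\<^sup>2 * (x 2 - x 5)\<^sup>2 +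
    (x 1 - x 5)\<^sup>2 * (x 5 - x 6)\<^sup>2 * (x 1 - x 6)\<^sup>2 * (x 2 - x 3)\<^sup>2 * (x 3 - x 4)\<^sup>2 * (x 2 - x 4)\<^sup>2"
    unfolding g_def[symmetric] by (simp only: list.map sum_list.Cons sum_list.Nil add_0_right add.assoc)
qed

subsection \<open>The discriminant of a sextic\<close>

text \<open>This is the Bezout matrix of a sextic and its derivative with a factor
  \<open>f 6\<close> divided out of the last row and of the last column, so the corner
  \<open>6 * f 6 ^ 2\<close> becomes 6. After this division the determinant is the discriminant
  itself, also when \<open>f 6\<close> is zero.\<close>

definition disc_entry :: "(nat \<Rightarrow> 'a::comm_ring_1) \<Rightarrow> nat \<Rightarrow> nat \<Rightarrow> 'a" where
  "disc_entry f i j = (let g = (\<lambda>m. if m \<le> 5 then of_nat (Suc m) * f (Suc m) else 0) in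
     if i = 5 then (if j = 5 then 6 else g j) else if j = 5 then g i
     else (\<Sum>k\<le>min i (5 - j). f (j + k + 1) * g (i - k) - f (i - k) * g (j + k + 1)))"

definition disc_mat :: "(nat \<Rightarrow> 'a::comm_ring_1) \<Rightarrow> 'a mat" where
  "disc_mat f = mat 6 6 (\<lambda>(i, j). disc_entry f i j)"

lemma sum_lessThan_6: "(\<Sum>i<6. a i) = a 0 + a 1 + a 2 + a 3 + a 4 + a (5::nat)"
  by (simp add: eval_nat_numeral)

lemma sum_atMost_6: "(\<Sum>i\<le>6. a i) = a 0 + a 1 + a 2 + a 3 + a 4 + a (5::nat) + a 6"
  by (simp add: eval_nat_numeral)

text \<open>The weight \<open>f 6\<close> in \<open>w\<close> puts back the factor removed from the
  last row and column, so \<open>B\<close> is the usual Bezoutian (F(x) G(y) - F(y) G(x)) / (x - y).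
  On the diagonal this is G^2 - F G'.\<close>

lemma disc_entry_bezout:
  fixes f :: "nat \<Rightarrow> 'a::idom"
  defines "w \<equiv> \<lambda>x i. if i = 5 then f 6 * x ^ 5 else x ^ i"
  defines "F \<equiv> \<lambda>x. \<Sum>i\<le>6. f i * x ^ i"
  defines "G \<equiv> \<lambda>x. \<Sum>i<6. of_nat (Suc i) * f (Suc i) * x ^ i"
  defines "B \<equiv> \<lambda>x y. \<Sum>i<6. \<Sum>j<6. w x i * disc_entry f i j * w y j"
  shows disc_entry_bezout_off_diag: "(x - y) * B x y = F x * G y - F y * G x"
    and disc_entry_bezout_diag: "F x = 0 \<Longrightarrow> B x x = G x ^ 2"
proof -
  note defs = B_def F_def G_def w_def sum_lessThan_6 sum_atMost_6 disc_entry_def Let_def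
  obtain f0 f1 f2 f3 f4 f5 f6 where f: "f 0 = f0" "f (Suc 0) = f1" "f 2 = f2" "f 3 = f3" "f 4 = f4" "f 5 = f5" "f 6 = f6"
    by simp
  show "(x - y) * B x y = F x * G y - F y * G x"
    unfolding defs by (simp add: atMost_nat_numeral atMost_Suc numeral_2_eq_2[symmetric] f del: power_Suc) (simp add: algebra_simps eval_nat_numeral)
  have "B x x = G x ^ 2 - F x * (2 * f 2 + 6 * f 3 * x + 12 * f 4 * x^2 + 20 * f 5 * x^3 + 30 * f 6 * x^4)"
    unfolding defs by (simp add: atMost_nat_numeral atMost_Suc numeral_2_eq_2[symmetric] f del: power_Suc) (simp add: algebra_simps eval_nat_numeral)
  then show "F x = 0 \<Longrightarrow> B x x = G x ^ 2" by simp
qed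

lemma prod_off_diag:
  fixes a :: "nat \<Rightarrow> nat \<Rightarrow> 'a::comm_monoid_mult"
  shows "(\<Prod>i<n. \<Prod>j\<in>{..<n} - {i}. a i j) = (\<Prod>i<n. \<Prod>j<i. a i j * a j i)"
proof (induction n)
  case (Suc n)
  have "(\<Prod>j\<in>{..<Suc n} - {i}. a i j) = (\<Prod>j\<in>{..<n} - {i}. a i j) * a i n" if "i < n" for i
  proof -
    have "{..<Suc n} - {i} = insert n ({..<n} - {i})" using that by auto
    then show ?thesis by (simp add: mult.commute)
  qed
  moreover have "{..<Suc n} - {n} = {..<n}" by auto
  ultimately show ?case using Suc by (simp add: prod.distrib mult_ac)
qed simp

text \<open>Column operations pass to the Newton basis: \<open>T\<close> is unitriangular because
  \<open>P j\<close> is monic of degree j, and \<open>P j\<close> vanishes at \<open>x i\<close> for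
  i < j, so the product is lower triangular.\<close>

lemma det_vandermonde:
  fixes x :: "nat \<Rightarrow> 'a::idom"
  shows "det (mat n n (\<lambda>(i, j). x i ^ j)) = (\<Prod>i<n. \<Prod>j<i. x i - x j)"
proof -
  define P where "P j = (\<Prod>k<j. [:- x k, 1:])" for j :: nat
  have "P j \<noteq> 0 \<and> Polynomial.degree (P j) = j \<and> Polynomial.lead_coeff (P j) = 1" for j
  proof (induction j)
    case (Suc j)
    have "P (Suc j) = P j * [:- x j, 1:]" by (simp add: P_def mult.commute)
    then show ?case
      using Suc degree_mult_eq[of "P j" "[:- x j, 1:]"] lead_coeff_mult[of "P j" "[:- x j, 1:]"] by auto
  qed (auto simp: P_def)
  then have deg: "Polynomial.degree (P j) = j" and monic: "Polynomial.coeff (P j) j = 1" for j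
    by metis+
  let ?V = "mat n n (\<lambda>(i, j). x i ^ j)"
  let ?T = "mat n n (\<lambda>(l, j). Polynomial.coeff (P j) l)"
  let ?N = "mat n n (\<lambda>(i, j). poly (P j) (x i))"
  have "?V * ?T = ?N"
  proof (rule eq_matI)
    fix i j assume ij: "i < dim_row ?N" "j < dim_col ?N"
    then have "(?V * ?T) $$ (i, j) = (\<Sum>l<n. x i ^ l * Polynomial.coeff (P j) l)"
      by (simp add: scalar_prod_def atLeast0LessThan)
    also have "\<dots> = (\<Sum>l\<le>Polynomial.degree (P j). x i ^ l * Polynomial.coeff (P j) l)"
      using ij by (intro sum.mono_neutral_right) (auto simp: deg coeff_eq_0)
    also have "\<dots> = poly (P j) (x i)" by (simp add: poly_altdef mult.commute)
    finally show "(?V * ?T) $$ (i, j) = ?N $$ (i, j)" using ij by simp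
  qed auto
  then have "det ?V * det ?T = det ?N"
    using det_mult[of ?V n ?T] by simp
  moreover have "det ?T = prod_list (diag_mat ?T)"
    by (rule det_upper_triangular[of _ n]) (auto simp: upper_triangular_def deg coeff_eq_0)
  then have "det ?T = 1"
    by (simp add: diag_mat_def monic prod.list_conv_set_nth)
  moreover have "det ?N = prod_list (diag_mat ?N)"
    by (rule det_lower_triangular[of n]) (auto simp: P_def poly_prod intro!: prod_zero)
  then have "det ?N = (\<Prod>i<n. \<Prod>j<i. x i - x j)"
    by (simp add: diag_mat_def P_def poly_prod prod.list_conv_set_nth atLeast0LessThan)
  ultimately show ?thesis by simp
qed

lemma poly_altdef_le:
  fixes p :: "'a::comm_ring_1 poly"
  assumes "Polynomial.degree p \<le> n"
  shows "poly p x = (\<Sum>i\<le>n. Polynomial.coeff p i * x ^ i)"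
  unfolding poly_altdef using assms by (intro sum.mono_neutral_left) (auto simp: coeff_eq_0)

lemma degree_prod_linear_le:
  fixes a b :: "nat \<Rightarrow> 'a::comm_ring_1"
  shows "Polynomial.degree (\<Prod>i<n. [:a i, b i:]) \<le> n"
proof -
  have "Polynomial.degree (\<Prod>i<n. [:a i, b i:]) \<le> (\<Sum>i<n. Polynomial.degree [:a i, b i:])"
    using degree_prod_sum_le[of "{..<n}" "\<lambda>i. [:a i, b i:]"] by (simp add: o_def)
  also have "\<dots> \<le> (\<Sum>i<n. 1)" by (intro sum_mono) auto
  finally show ?thesis by simp
qed

lemma coeff_prod_linear:
  fixes a b :: "nat \<Rightarrow> 'a::comm_ring_1"
  shows "Polynomial.coeff (\<Prod>i<n. [:a i, b i:]) n = (\<Prod>i<n. b i)"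
proof (induction n)
  case (Suc n)
  then show ?case using degree_prod_linear_le[of a b n] by (simp add: coeff_eq_0 mult.commute)
qed auto

text \<open>At the roots the Bezoutian vanishes off the diagonal, so the weighted Vandermonde matrix
  \<open>?U\<close> turns \<open>disc_mat\<close> into a diagonal matrix of squared values of the
  derivative. With d the determinant sought this gives (c \<Delta>)^2 d = c^12 \<Delta>^4, and c
  \<Delta> cancels because the roots are finite and distinct.\<close>

lemma det_disc_mat_generic:
  fixes r s :: "nat \<Rightarrow> 'a::field"
  assumes s: "\<And>i. i < 6 \<Longrightarrow> s i \<noteq> 0" and distinct: "\<And>i j. j < i \<Longrightarrow> i < 6 \<Longrightarrow> r i * s j - r j * s i \<noteq> 0"
  shows "det (disc_mat (Polynomial.coeff (\<Prod>i<6. [:- r i, s i:]))) = (\<Prod>i<6. \<Prod>j<i. r i * s j - r j * s i) ^ 2"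
proof -
  define p where "p = (\<Prod>i<6. [:- r i, s i:])"
  define f where "f = Polynomial.coeff p"
  define x where "x i = r i / s i" for i
  define c where "c = (\<Prod>i<6. s i)"
  define \<Delta> where "\<Delta> = (\<Prod>i<6. \<Prod>j<i. x i - x j)"
  have c: "f 6 = c" "c \<noteq> 0" using s by (auto simp: f_def p_def c_def coeff_prod_linear)
  have degp: "Polynomial.degree p \<le> 6" unfolding p_def by (rule degree_prod_linear_le)
  have pp: "poly p y = (\<Sum>i\<le>6. f i * y ^ i)" for y
    unfolding f_def by (rule poly_altdef_le[OF degp])
  have "Polynomial.degree (pderiv p) \<le> 5"
    using degp by (intro degree_le) (auto simp: coeff_pderiv intro!: coeff_eq_0)
  then have pd: "poly (pderiv p) y = (\<Sum>i<6. of_nat (Suc i) * f (Suc i) * y ^ i)" for y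
    using poly_altdef_le[of "pderiv p" 5 y] by (simp add: f_def coeff_pderiv lessThan_Suc_atMost[symmetric])
  have split: "p = [:- r i, s i:] * (\<Prod>j\<in>{..<6} - {i}. [:- r j, s j:])" if "i < 6" for i
    using that unfolding p_def by (subst prod.remove[of _ i]) auto
  have root: "poly p (x i) = 0" if "i < 6" for i
    using s that by (subst split[OF that]) (simp add: x_def)
  have fac: "poly [:- r j, s j:] (x i) = s j * (x i - x j)" if "i < 6" "j < 6" for i j
    using s that by (simp add: x_def field_simps)
  have dF: "poly (pderiv p) (x i) = c * (\<Prod>j\<in>{..<6} - {i}. x i - x j)" if i: "i < 6" for i
  proof -
    have "poly (pderiv p) (x i) = s i * poly (\<Prod>j\<in>{..<6} - {i}. [:- r j, s j:]) (x i)"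
    proof -
      have "poly (pderiv ([:- r i, s i:] * q)) (x i) = s i * poly q (x i)" for q
        using s[OF i] unfolding pderiv_mult by (simp add: pderiv_pCons x_def)
      then show ?thesis by (subst split[OF i])
    qed
    also have "\<dots> = s i * (\<Prod>j\<in>{..<6} - {i}. s j * (x i - x j))"
      unfolding poly_prod using i by (intro arg_cong2[of _ _ _ _ "(*)"] prod.cong refl fac) auto
    also have "\<dots> = s i * (\<Prod>j\<in>{..<6} - {i}. s j) * (\<Prod>j\<in>{..<6} - {i}. x i - x j)"
      by (simp add: prod.distrib)
    also have "s i * (\<Prod>j\<in>{..<6} - {i}. s j) = c"
      using i unfolding c_def by (subst prod.remove[of _ i]) auto
    finally show ?thesis .
  qed
  have ne: "x i \<noteq> x j" if "j < i" "i < 6" for i j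
    using distinct[OF that] s[of i] s[of j] that by (simp add: x_def field_simps)
  then have \<Delta>0: "\<Delta> \<noteq> 0" by (auto simp: \<Delta>_def)
  let ?w = "\<lambda>x i. if i = 5 then f 6 * x ^ 5 else x ^ i"
  let ?V = "mat 6 6 (\<lambda>(i, j). x i ^ j)"
  let ?D = "mat 6 6 (\<lambda>(i, j). if i = j then if i = 5 then c else 1 else 0)"
  let ?U = "mat 6 6 (\<lambda>(i, j). ?w (x i) j)"
  let ?M = "disc_mat f"
  let ?R = "mat 6 6 (\<lambda>(i, j). if i = j then poly (pderiv p) (x i) ^ 2 else 0)"
  have dims: "?V \<in> carrier_mat 6 6" "?D \<in> carrier_mat 6 6" "?U \<in> carrier_mat 6 6" "?M \<in> carrier_mat 6 6"
    by (auto simp: disc_mat_def)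
  have "?V * ?D = ?U"
    by (rule eq_matI) (auto simp: scalar_prod_def c if_distrib[of "\<lambda>a. _ * a"] mult.commute cong: if_cong)
  moreover have "det ?D = c"
    by (subst det_upper_triangular[of _ 6])
       (auto simp: upper_triangular_def diag_mat_def prod.list_conv_set_nth eval_nat_numeral)
  ultimately have detU: "det ?U = \<Delta> * c"
    using det_mult[of ?V 6 ?D] det_vandermonde[of 6 x] by (simp add: \<Delta>_def)
  have "?U * ?M * transpose_mat ?U = ?R"
  proof (rule eq_matI)
    fix i j assume "i < dim_row ?R" "j < dim_col ?R"
    then have ij: "i < 6" "j < 6" by auto
    let ?B = "\<Sum>k<6. \<Sum>l<6. ?w (x i) k * disc_entry f k l * ?w (x j) l"
    have "(?U * ?M * transpose_mat ?U) $$ (i, j) = (\<Sum>l<6. (\<Sum>k<6. ?w (x i) k * disc_entry f k l) * ?w (x j) l)"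
      using ij by (simp add: scalar_prod_def disc_mat_def atLeast0LessThan)
    also have "\<dots> = ?B"
      by (subst sum.swap) (simp only: sum_distrib_right)
    finally have entry: "(?U * ?M * transpose_mat ?U) $$ (i, j) = ?B" .
    show "(?U * ?M * transpose_mat ?U) $$ (i, j) = ?R $$ (i, j)"
    proof (cases "i = j")
      case True
      then have "?B = poly (pderiv p) (x i) ^ 2"
        using disc_entry_bezout_diag[of f "x i"] root[OF ij(1)] by (simp only: pp pd)
      then show ?thesis using entry ij True by simp
    next
      case False
      have "(x i - x j) * ?B = 0"
        using disc_entry_bezout_off_diag[of "x i" "x j" f] root[OF ij(1)] root[OF ij(2)] by (simp only: pp pd) simp
      moreover have "x i - x j \<noteq> 0" using False ij ne[of i j] ne[of j i] by (cases i j rule: linorder_cases) auto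
      ultimately have "?B = 0" by simp
      then show ?thesis using entry ij False by simp
    qed
  qed (auto simp: disc_mat_def)
  moreover have "det (?U * ?M * transpose_mat ?U) = det ?U * det ?M * det ?U"
  proof -
    have "?U * ?M \<in> carrier_mat 6 6" using dims(3,4) by (rule mult_carrier_mat)
    then have "det (?U * ?M * transpose_mat ?U) = det (?U * ?M) * det (transpose_mat ?U)"
      using dims(3) by (intro det_mult) auto
    also have "det (?U * ?M) = det ?U * det ?M" using dims(3,4) by (rule det_mult)
    also have "det (transpose_mat ?U) = det ?U" using dims(3) by (rule det_transpose)
    finally show ?thesis .
  qed
  moreover have "det ?R = (\<Prod>i<6. poly (pderiv p) (x i) ^ 2)"
    by (subst det_upper_triangular[of _ 6])
       (auto simp: upper_triangular_def diag_mat_def prod.list_conv_set_nth atLeast0LessThan)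
  moreover have "(\<Prod>i<6. poly (pderiv p) (x i) ^ 2) = c ^ 12 * \<Delta> ^ 4"
  proof -
    have "(\<Prod>i<6. poly (pderiv p) (x i) ^ 2) = (\<Prod>i<6. c ^ 2 * (\<Prod>j\<in>{..<6} - {i}. x i - x j) ^ 2)"
      by (intro prod.cong refl) (simp add: dF power_mult_distrib)
    also have "\<dots> = c ^ 12 * (\<Prod>i<6. \<Prod>j\<in>{..<6} - {i}. x i - x j) ^ 2"
      by (simp add: prod.distrib power_mult[symmetric] prod_power_distrib)
    also have "(\<Prod>i<6. \<Prod>j\<in>{..<6} - {i}. x i - x j) = (\<Prod>i<6. \<Prod>j<i. (x i - x j) * (x j - x i))"
      by (rule prod_off_diag)
    also have "(\<Prod>i<6. \<Prod>j<i. (x i - x j) * (x j - x i)) ^ 2 = (\<Prod>i<6. \<Prod>j<i. ((x i - x j) ^ 2) ^ 2)"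
      by (simp only: prod_power_distrib) (intro prod.cong refl, simp add: power2_eq_square algebra_simps)
    also have "\<dots> = \<Delta> ^ 4"
      by (simp add: \<Delta>_def prod_power_distrib[symmetric] power_mult[symmetric])
    finally show ?thesis .
  qed
  ultimately have "(\<Delta> * c) ^ 2 * det ?M = c ^ 12 * \<Delta> ^ 4"
    using detU by (simp add: power2_eq_square mult_ac)
  moreover have "(\<Delta> * c) ^ 2 * (c ^ 10 * \<Delta> ^ 2) = (c ^ 2 * c ^ 10) * (\<Delta> ^ 2 * \<Delta> ^ 2)"
    by (simp add: power_mult_distrib mult_ac)
  ultimately have "(\<Delta> * c) ^ 2 * det ?M = (\<Delta> * c) ^ 2 * (c ^ 10 * \<Delta> ^ 2)"
    by (simp flip: power_add)
  then have detM: "det ?M = (c ^ 5 * \<Delta>) ^ 2" using \<Delta>0 c by (simp add: power_mult_distrib)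
  \<comment> \<open>Back to homogeneous roots: each \<open>s i\<close> occurs in five of the fifteen
    factors, which accounts for \<open>c ^ 5\<close>.\<close>
  have "(\<Prod>i<6. \<Prod>j<i. r i * s j - r j * s i) = (\<Prod>i<6. \<Prod>j<i. s i * s j * (x i - x j))"
    by (intro prod.cong refl) (use s in \<open>auto simp: x_def field_simps\<close>)
  also have "\<dots> = (\<Prod>i<6. \<Prod>j<i. s i * s j) * \<Delta>" by (simp add: \<Delta>_def prod.distrib)
  also have "(\<Prod>i<6. \<Prod>j<i. s i * s j) = (\<Prod>i<6. \<Prod>j\<in>{..<6} - {i}. s i)"
    by (rule prod_off_diag[symmetric])
  also have "\<dots> = c ^ 5" by (simp add: c_def prod_power_distrib)
  finally show ?thesis using detM by (simp add: f_def p_def)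
qed

lemma (in comm_ring_hom) hom_disc_mat: "det (disc_mat (\<lambda>i. hom (f i))) = hom (det (disc_mat f))"
proof -
  have of_nat: "hom (of_nat n) = of_nat n" for n by (induction n) (auto simp: hom_distribs)
  have "hom 6 = 6" using of_nat[of 6] by simp
  then have "hom (disc_entry f i j) = disc_entry (\<lambda>i. hom (f i)) i j" for i j
    unfolding disc_entry_def Let_def by (simp add: hom_distribs of_nat if_distrib[of hom] cong: if_cong)
  then have "disc_mat (\<lambda>i. hom (f i)) = map_mat hom (disc_mat f)"
    by (intro eq_matI) (auto simp: disc_mat_def)
  then show ?thesis by (simp only: hom_det)
qed

lemma disc_mat_cong: "(\<And>i. i \<le> 6 \<Longrightarrow> f i = g i) \<Longrightarrow> disc_mat f = disc_mat g"
  by (rule eq_matI) (auto simp: disc_mat_def disc_entry_def Let_def intro!: sum.cong)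

lemma (in comm_ring_hom) hom_coeff_prod_linear:
  fixes n :: nat
  shows "hom (Polynomial.coeff (\<Prod>i<n. [:a i, b i:]) k) = Polynomial.coeff (\<Prod>i<n. [:hom (a i), hom (b i):]) k"
proof (induction n arbitrary: k)
  case (Suc n)
  then show ?case by (cases k) (simp_all add: hom_distribs coeff_pCons)
qed (simp add: hom_distribs)

definition disc_poly :: int_mpoly where
  "disc_poly = det (disc_mat (\<lambda>i. if i \<le> 6 then mvar i else 0))"

lemma in_vars_disc_poly: "in_vars {..6} disc_poly"
proof -
  have "in_vars {..6} (disc_entry (\<lambda>i. if i \<le> 6 then mvar i else 0) i j)" for i j
    unfolding disc_entry_def Let_def by (auto intro!: in_vars_intros)
  then show ?thesis
    unfolding disc_poly_def det_def by (auto simp: disc_mat_def permutes_in_image intro!: in_vars_intros)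
qed

lemma eval_disc_poly: "eval_int c disc_poly = det (disc_mat c)"
proof -
  interpret comm_ring_hom "eval_int c" by (rule eval_int_hom)
  show ?thesis unfolding disc_poly_def hom_disc_mat[symmetric]
    by (intro arg_cong[of _ _ det] disc_mat_cong) simp
qed

text \<open>Roots are points (r : s) of the projective line, so that degree 5 is a sextic with a
  root at infinity. The generic case implies the general one: \<open>Q\<close> vanishes wherever
  \<open>D\<close> and all coordinates are nonzero, so \<open>Q * D\<close> is the zero polynomial,
  and integral polynomials form a domain. The resulting identity over the integers holds in every
  commutative ring.\<close>

theorem det_disc_mat:
  fixes r s :: "nat \<Rightarrow> 'a::comm_ring_1"
  shows "det (disc_mat (Polynomial.coeff (\<Prod>i<6. [:- r i, s i:]))) = (\<Prod>i<6. \<Prod>j<i. r i * s j - r j * s i) ^ 2"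
proof -
  define R where "R i = mvar i" for i
  define S where "S i = mvar (6 + i)" for i
  define D where "D = (\<Prod>i<6. \<Prod>j<i. R i * S j - R j * S i)"
  define Q where "Q = det (disc_mat (Polynomial.coeff (\<Prod>i<6. [:- R i, S i:]))) - D ^ 2"
  have ev: "eval_int c Q = det (disc_mat (Polynomial.coeff (\<Prod>i<6. [:- c i, c (6 + i):])))
       - (\<Prod>i<6. \<Prod>j<i. c i * c (6 + j) - c j * c (6 + i)) ^ 2" for c :: "nat \<Rightarrow> 'b::comm_ring_1"
  proof -
    interpret comm_ring_hom "eval_int c" by (rule eval_int_hom)
    show ?thesis
      unfolding Q_def D_def R_def S_def
      by (simp add: hom_distribs hom_disc_mat[symmetric] hom_coeff_prod_linear)
  qed
  have evD: "eval_int c D = (\<Prod>i<6. \<Prod>j<i. c i * c (6 + j) - c j * c (6 + i))" for c :: "nat \<Rightarrow> 'b::comm_ring_1"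
  proof -
    interpret comm_ring_hom "eval_int c" by (rule eval_int_hom)
    show ?thesis unfolding D_def R_def S_def by (simp add: hom_distribs)
  qed
  have "D \<noteq> 0"
  proof
    assume "D = 0"
    \<comment> \<open>The roots 0 to 5 with all \<open>S i\<close> equal to 1 are distinct, so
      \<open>D\<close> cannot be the zero polynomial.\<close>
    then have "eval_int (\<lambda>i. if i < 6 then of_nat i else 1) D = (0 :: complex)"
      by (simp add: mpoly_eval_def)
    then show False by (simp add: evD)
  qed
  have "Q = 0"
  proof (rule ccontr)
    assume "Q \<noteq> 0"
    with \<open>D \<noteq> 0\<close> have "Q * D \<noteq> 0" by simp
    then obtain c :: "nat \<Rightarrow> complex" where c: "\<And>i. c i \<noteq> 0" "eval_int c (Q * D) \<noteq> 0"
      using mpoly_eval_nonzero[of "of_int :: int \<Rightarrow> complex" "Q * D"] by auto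
    interpret comm_ring_hom "eval_int c" by (rule eval_int_hom)
    have "eval_int c Q \<noteq> 0" "eval_int c D \<noteq> 0" using c by (auto simp: hom_distribs)
    then have "eval_int c Q = 0"
      unfolding ev using c by (subst det_disc_mat_generic) (auto simp: evD)
    then show False using \<open>eval_int c Q \<noteq> 0\<close> by simp
  qed
  then show ?thesis
    using ev[of "\<lambda>i. if i < 6 then r i else s (i - 6)"] by (simp add: mpoly_eval_def[of _ _ 0] cong: prod.cong_simp)
qed

lemma eval_disc_poly_roots:
  "eval_int (Polynomial.coeff (Polynomial.smult c (\<Prod>i\<in>{1..6::nat}. [:- x i, 1:]))) disc_poly / 2 ^ 12 = J10_roots c x"
proof -
  \<comment> \<open>The leading coefficient is put into the first linear factor, whose homogeneous
    root becomes (c x 1 : c).\<close>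
  define s where "s i = (if i = 0 then c else 1)" for i :: nat
  define r where "r i = s i * x (Suc i)" for i
  have "(\<Prod>i\<in>{1..6::nat}. [:- x i, 1:]) = (\<Prod>i<6. [:- x (Suc i), 1:])"
    by (rule prod.reindex_bij_witness[of _ Suc "\<lambda>i. i - 1"]) auto
  moreover have "(\<Prod>i<6. [:- r i, s i:]) = (\<Prod>i<6. Polynomial.smult (s i) [:- x (Suc i), 1:])"
    by (simp add: r_def)
  moreover have "\<dots> = Polynomial.smult (\<Prod>i<6. s i) (\<Prod>i<6. [:- x (Suc i), 1:])"
    by (rule prod_smult)
  moreover have "(\<Prod>i<6. s i) = c" by (simp add: s_def eval_nat_numeral)
  ultimately have "eval_int (Polynomial.coeff (Polynomial.smult c (\<Prod>i\<in>{1..6::nat}. [:- x i, 1:]))) disc_poly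
      = (\<Prod>i<6. \<Prod>j<i. r i * s j - r j * s i) ^ 2"
    by (simp only: eval_disc_poly det_disc_mat[symmetric])
  also have "(\<Prod>i<6. \<Prod>j<i. r i * s j - r j * s i) = (\<Prod>i<6. \<Prod>j<i. s i * s j * (x (Suc i) - x (Suc j)))"
    by (simp add: r_def algebra_simps)
  also have "\<dots> = c ^ 5 * (\<Prod>i<6. \<Prod>j<i. x (Suc i) - x (Suc j))"
    by (simp add: s_def eval_nat_numeral)
  also have "(c ^ 5 * (\<Prod>i<6. \<Prod>j<i. x (Suc i) - x (Suc j))) ^ 2 =
      c ^ 10 * (\<Prod>i<6. \<Prod>j<i. (x (Suc j) - x (Suc i)) ^ 2)"
    by (simp add: power_mult_distrib power_mult[symmetric] prod_power_distrib power2_commute)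
  also have "(\<Prod>i<6. \<Prod>j<i. (x (Suc j) - x (Suc i)) ^ 2) = (\<Prod>j\<in>{1..6}. \<Prod>i\<in>{1..<j}. (x i - x j) ^ 2)"
  proof (rule prod.reindex_bij_witness[of _ "\<lambda>i. i - 1" Suc])
    fix i :: nat
    show "(\<Prod>k\<in>{1..<Suc i}. (x k - x (Suc i)) ^ 2) = (\<Prod>j<i. (x (Suc j) - x (Suc i)) ^ 2)"
      by (rule prod.reindex_bij_witness[of _ Suc "\<lambda>i. i - 1"]) auto
  qed auto
  finally show ?thesis unfolding J10_roots_def I10_roots_def by (rule arg_cong[of _ _ "\<lambda>a. a / 2 ^ 12"])
qed

lemma J10_eq:
  fixes F :: "'k::field poly"
  assumes "(2 :: 'k) \<noteq> 0"
  shows "J10 F = det (disc_mat (Polynomial.coeff F)) / 2 ^ 12"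
  unfolding J10_def
  by (subst specialise_eq[OF in_vars_disc_poly eval_disc_poly_roots assms]) (rule arg_cong2[of _ _ _ _ "(/)", OF eval_disc_poly refl])

lemma to_ac_comm_ring_hom: "comm_ring_hom to_ac"
  by unfold_locales auto

lemma J10_nonzero:
  fixes F :: "'k::field poly"
  assumes two: "(2 :: 'k) \<noteq> 0" and F: "genus2_model F"
  shows "J10 F \<noteq> 0"
proof -
  interpret comm_ring_hom "to_ac :: 'k \<Rightarrow> _" by (rule to_ac_comm_ring_hom)
  define p where "p = map_poly to_ac F"
  have sf: "rsquarefree p" and deg: "Polynomial.degree p \<in> {5, 6}"
    using F by (auto simp: genus2_model_def p_def degree_map_poly)
  then have "p \<noteq> 0" by (auto simp: rsquarefree_def)
  obtain A where A: "size A = Polynomial.degree p" "p = Polynomial.smult (Polynomial.lead_coeff p) (\<Prod>x\<in>#A. [:- x, 1:])"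
    using alg_closed_imp_factorization[of p] \<open>p \<noteq> 0\<close> by blast
  obtain xs where xs: "mset xs = A" by (metis ex_mset)
  define n where "n = length xs"
  have n: "n = Polynomial.degree p" using A xs by (metis n_def size_mset)
  let ?l = "Polynomial.lead_coeff p"
  have pn: "p = Polynomial.smult ?l (\<Prod>i<n. [:- xs ! i, 1:])"
  proof -
    have "(\<Prod>x\<in>#A. [:- x, 1:]) = (\<Prod>x\<leftarrow>xs. [:- x, 1:])"
      unfolding xs[symmetric] by (simp add: prod_mset_prod_list[symmetric])
    also have "\<dots> = (\<Prod>i<n. [:- xs ! i, 1:])"
      by (simp add: prod.list_conv_set_nth atLeast0LessThan n_def)
    finally show ?thesis using A by metis
  qed
  have dist: "xs ! i \<noteq> xs ! j" if "j < i" "i < n" for i j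
  proof
    assume eq: "xs ! i = xs ! j"
    define l where "l k = [:- xs ! k, 1:]" for k
    have "(\<Prod>k<n. l k) = l i * (\<Prod>k\<in>{..<n} - {i}. l k)"
      using that by (intro prod.remove) auto
    also have "(\<Prod>k\<in>{..<n} - {i}. l k) = l j * (\<Prod>k\<in>{..<n} - {i} - {j}. l k)"
      using that by (intro prod.remove) auto
    finally have "p = Polynomial.smult ?l (l i * (l j * (\<Prod>k\<in>{..<n} - {i} - {j}. l k)))"
      using pn by (simp only: l_def)
    then have "l i ^ 2 dvd p"
      using eq by (metis dvd_smult dvd_triv_left l_def mult.assoc power2_eq_square)
    then have "[:- xs ! i, 1:] ^ 2 dvd p" by (simp only: l_def)
    then have "2 \<le> Polynomial.order (xs ! i) p" using \<open>p \<noteq> 0\<close> by (simp add: order_divides)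
    moreover have "Polynomial.order (xs ! i) p \<le> 1"
      using sf by (metis One_nat_def le_numeral_extra(4) rsquarefree_def zero_le_one)
    ultimately show False by simp
  qed
  \<comment> \<open>In degree 5 the sixth factor belongs to the point at infinity: r = -1 and s = 0
    make it the constant 1. The leading coefficient sits in factor 0.\<close>
  define s :: "nat \<Rightarrow> 'k alg_closure" where "s i = (if i = 0 then ?l else if i < n then 1 else 0)" for i
  define r where "r i = (if i = 0 then ?l * xs ! 0 else if i < n then xs ! i else -1)" for i
  have pr: "p = (\<Prod>i<6. [:- r i, s i:])"
  proof -
    have "(\<Prod>i<6. [:- r i, s i:]) = (\<Prod>i<n. [:- r i, s i:])"
      using deg n by (intro prod.mono_neutral_right) (auto simp: r_def s_def one_pCons)
    also have "\<dots> = [:- r 0, s 0:] * (\<Prod>i\<in>{..<n} - {0}. [:- r i, s i:])"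
      using deg n by (subst prod.remove[of _ 0]) auto
    also have "\<dots> = Polynomial.smult ?l [:- xs ! 0, 1:] * (\<Prod>i\<in>{..<n} - {0}. [:- xs ! i, 1:])"
      by (intro arg_cong2[of _ _ _ _ "(*)"] prod.cong refl) (auto simp: r_def s_def)
    also have "\<dots> = Polynomial.smult ?l ([:- xs ! 0, 1:] * (\<Prod>i\<in>{..<n} - {0}. [:- xs ! i, 1:]))"
      by (rule mult_smult_left)
    also have "[:- xs ! 0, 1:] * (\<Prod>i\<in>{..<n} - {0}. [:- xs ! i, 1:]) = (\<Prod>i<n. [:- xs ! i, 1:])"
      using deg n by (intro prod.remove[symmetric]) auto
    also have "Polynomial.smult ?l \<dots> = p" by (rule pn[symmetric])
    finally show ?thesis ..
  qed
  have l0: "?l \<noteq> 0" using \<open>p \<noteq> 0\<close> by simp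
  have "r i * s j - r j * s i \<noteq> 0" if "j < i" "i < 6" for i j
  proof (cases "i < n")
    case True
    then show ?thesis using dist[OF that(1) True] that l0 by (auto simp: r_def s_def)
  next
    case False
    then show ?thesis using that deg n l0 by (auto simp: r_def s_def)
  qed
  then have "det (disc_mat (Polynomial.coeff p)) \<noteq> 0"
    unfolding pr det_disc_mat by auto
  moreover have "Polynomial.coeff p = (\<lambda>i. to_ac (Polynomial.coeff F i))"
    by (auto simp: p_def coeff_map_poly)
  ultimately have "det (disc_mat (Polynomial.coeff F)) \<noteq> 0"
    using hom_disc_mat[of "Polynomial.coeff F"] by auto
  then show ?thesis unfolding J10_eq[OF two] using power_not_zero[OF two, of 12] by (metis divide_eq_0_iff)
qed

subsection \<open>Igusa invariants in characteristic 3\<close>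

text \<open>The hypotheses name the coefficients of the monic sextic as signed elementary symmetric
  functions; after substitution both sides are one polynomial in the six roots. The leading
  coefficient is restored later by homogeneity.\<close>

lemma I2_identity:
  fixes x1 x2 x3 x4 x5 x6 :: "'a::idom"
  assumes "c5 = -(x1 + x2 + x3 + x4 + x5 + x6)"
    and "c4 = (x1*x2 + x1*x3 + x1*x4 + x1*x5 + x1*x6 + x2*x3 + x2*x4 + x2*x5 + x2*x6 + x3*x4 + x3*x5 + x3*x6 + x4*x5 + x4*x6 + x5*x6)"
    and "c3 = -(x1*x2*x3 + x1*x2*x4 + x1*x2*x5 + x1*x2*x6 + x1*x3*x4 + x1*x3*x5 + x1*x3*x6 + x1*x4*x5 + x1*x4*x6 + x1*x5*x6 + x2*x3*x4 + x2*x3*x5 + x2*x3*x6 + x2*x4*x5 + x2*x4*x6 + x2*x5*x6 + x3*x4*x5 + x3*x4*x6 + x3*x5*x6 + x4*x5*x6)"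
    and "c2 = (x1*x2*x3*x4 + x1*x2*x3*x5 + x1*x2*x3*x6 + x1*x2*x4*x5 + x1*x2*x4*x6 + x1*x2*x5*x6 + x1*x3*x4*x5 + x1*x3*x4*x6 + x1*x3*x5*x6 + x1*x4*x5*x6 + x2*x3*x4*x5 + x2*x3*x4*x6 + x2*x3*x5*x6 + x2*x4*x5*x6 + x3*x4*x5*x6)"
    and "c1 = -(x1*x2*x3*x4*x5 + x1*x2*x3*x4*x6 + x1*x2*x3*x5*x6 + x1*x2*x4*x5*x6 + x1*x3*x4*x5*x6 + x2*x3*x4*x5*x6)"
    and "c0 = (x1*x2*x3*x4*x5*x6)"
  shows "(x1 - x2)^2 * (x3 - x4)^2 * (x5 - x6)^2 + (x1 - x2)^2 * (x3 - x5)^2 * (x4 - x6)^2 + (x1 - x2)^2 * (x3 - x6)^2 * (x4 - x5)^2 + (x1 - x3)^2 * (x2 - x4)^2 * (x5 - x6)^2 + (x1 - x3)^2 * (x2 - x5)^2 * (x4 - x6)^2 + (x1 - x3)^2 * (x2 - x6)^2 * (x4 - x5)^2 + (x1 - x4)^2 * (x2 - x3)^2 * (x5 - x6)^2 + (x1 - x4)^2 * (x2 - x5)^2 * (x3 - x6)^2 + (x1 - x4)^2 * (x2 - x6)^2 * (x3 - x5)^2 + (x1 - x5)^2 * (x2 - x3)^2 * (x4 - x6)^2 + (x1 - x5)^2 * (x2 - x4)^2 * (x3 - x6)^2 + (x1 - x5)^2 * (x2 - x6)^2 * (x3 - x4)^2 + (x1 - x6)^2 * (x2 - x3)^2 * (x4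 - x5)^2 + (x1 - x6)^2 * (x2 - x4)^2 * (x3 - x5)^2 + (x1 - x6)^2 * (x2 - x5)^2 * (x3 - x4)^2 = 6 * c3^2 - 16 * c2 * c4 + 40 * c1 * c5 - 240 * c0"
  unfolding assms by Groebner_Basis.algebra

lemma I4_identity:
  fixes x1 x2 x3 x4 x5 x6 :: "'a::idom"
  assumes "c5 = -(x1 + x2 + x3 + x4 + x5 + x6)"
    and "c4 = (x1*x2 + x1*x3 + x1*x4 + x1*x5 + x1*x6 + x2*x3 + x2*x4 + x2*x5 + x2*x6 + x3*x4 + x3*x5 + x3*x6 + x4*x5 + x4*x6 + x5*x6)"
    and "c3 = -(x1*x2*x3 + x1*x2*x4 + x1*x2*x5 + x1*x2*x6 + x1*x3*x4 + x1*x3*x5 + x1*x3*x6 + x1*x4*x5 + x1*x4*x6 + x1*x5*x6 + x2*x3*x4 + x2*x3*x5 + x2*x3*x6 + x2*x4*x5 + x2*x4*x6 + x2*x5*x6 + x3*x4*x5 + x3*x4*x6 + x3*x5*x6 + x4*x5*x6)"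
    and "c2 = (x1*x2*x3*x4 + x1*x2*x3*x5 + x1*x2*x3*x6 + x1*x2*x4*x5 + x1*x2*x4*x6 + x1*x2*x5*x6 + x1*x3*x4*x5 + x1*x3*x4*x6 + x1*x3*x5*x6 + x1*x4*x5*x6 + x2*x3*x4*x5 + x2*x3*x4*x6 + x2*x3*x5*x6 + x2*x4*x5*x6 + x3*x4*x5*x6)"
    and "c1 = -(x1*x2*x3*x4*x5 + x1*x2*x3*x4*x6 + x1*x2*x3*x5*x6 + x1*x2*x4*x5*x6 + x1*x3*x4*x5*x6 + x2*x3*x4*x5*x6)"
    and "c0 = (x1*x2*x3*x4*x5*x6)"
  shows "(x1 - x2)^2 * (x2 - x3)^2 * (x1 - x3)^2 * (x4 - x5)^2 * (x5 - x6)^2 * (x4 - x6)^2 + (x1 - x2)^2 * (x2 - x4)^2 * (x1 - x4)^2 * (x3 - x5)^2 * (x5 - x6)^2 * (x3 - x6)^2 + (x1 - x2)^2 * (x2 - x5)^2 * (x1 - x5)^2 * (x3 - x4)^2 * (x4 - x6)^2 * (x3 - x6)^2 + (x1 - x2)^2 * (x2 - x6)^2 * (x1 - x6)^2 * (x3 - x4)^2 * (x4 - x5)^2 * (x3 - x5)^2 + (x1 - x3)^2 * (x3 - x4)^2 * (x1 - x4)^2 * (x2 - x5)^2 * (x5 - x6)^2 * (x2 - x6)^2 + (x1 - x3)^2 * (x3 - x5)^2 * (x1 - x5)^2 * (x2 - x4)^2 * (x4 - x6)^2 * (x2 - x6)^2 + (x1 - x3)^2 * (x3 - x6)^2 * (x1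 - x6)^2 * (x2 - x4)^2 * (x4 - x5)^2 * (x2 - x5)^2 + (x1 - x4)^2 * (x4 - x5)^2 * (x1 - x5)^2 * (x2 - x3)^2 * (x3 - x6)^2 * (x2 - x6)^2 + (x1 - x4)^2 * (x4 - x6)^2 * (x1 - x6)^2 * (x2 - x3)^2 * (x3 - x5)^2 * (x2 - x5)^2 + (x1 - x5)^2 * (x5 - x6)^2 * (x1 - x6)^2 * (x2 - x3)^2 * (x3 - x4)^2 * (x2 - x4)^2 =
    (4) * c2^2 * c4^2 + (-12) * c2^2 * c3 * c5 + (48) * c2^3 + (-12) * c1 * c3 * c4^2 + (36) * c1 * c3^2 * c5 + (4) * c1 * c2 * c4 * c5 + (-180) * c1 * c2 * c3 + (-80) * c1^2 * c5^2 + (300) * c1^2 * c4 + (48) * c0 * c4^3 + (-180) * c0 * c3 * c4 * c5 + (324) * c0 * c3^2 + (300) * c0 * c2 * c5^2 + (-504) * c0 * c2 * c4 + (-540) * c0 * c1 * c5 + (1620) * c0^2 * 1"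
  unfolding assms by Groebner_Basis.algebra

definition Q2_value :: "(nat \<Rightarrow> 'a::comm_ring_1) \<Rightarrow> 'a" where
  "Q2_value c = 3 * c 3 ^ 2 - 8 * (c 2 * c 4) + 20 * (c 1 * c 5) - 120 * (c 0 * c 6)"

text \<open>This is 128 times J4. The definition of J4 divides by 96 = 3 * 32; the 3 has been
  divided out here over the integers, which is what makes reduction modulo 3 possible.\<close>

definition Q4_value :: "(nat \<Rightarrow> 'a::comm_ring_1) \<Rightarrow> 'a" where
  "Q4_value c = 3 * c 3 ^ 4 - 16 * c 2 * c 3 ^ 2 * c 4 + 16 * c 2 ^ 2 * c 4 ^ 2 + 16 * c 2 ^ 2 * c 3 * c 5 - 64 * c 2 ^ 3 * c 6 + 16 * c 1 * c 3 * c 4 ^ 2 - 8 * c 1 * c 3 ^ 2 * c 5 - 112 * c 1 * c 2 * c 4 * c 5 + 240 * c 1 * c 2 * c 3 * c 6 + 240 * c 1 ^ 2 * c 5 ^ 2 - 400 * c 1 ^ 2 * c 4 * c 6 - 64 * c 0 * c 4 ^ 3 + 240 * c 0 * c 3 * c 4 * c 5 - 672 * c 0 * c 3 ^ 2 * c 6 - 400 * c 0 * c 2 * c 5 ^ 2 + 1312 * c 0 * c 2 * c 4 * c 6 - 880 * c 0 * c 1 * c 5 * c 6 + 2640 * c 0 ^ 2 * c 6 ^ 2"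

lemma (in comm_ring_hom) comm_ring_hom_numeral: "hom (numeral n) = numeral n"
proof -
  have of_nat: "hom (of_nat n) = of_nat n" for n by (induction n) (auto simp: hom_distribs)
  show ?thesis using of_nat[of "numeral n"] by simp
qed

lemma in_vars_Q2: "in_vars {..6} (Q2_value mvar)"
  and in_vars_Q4: "in_vars {..6} (Q4_value mvar)"
  unfolding Q2_value_def Q4_value_def by (intro in_vars_intros; simp)+

lemma eval_Q2: "eval_int c (Q2_value mvar) = Q2_value c"
  and eval_Q4: "eval_int c (Q4_value mvar) = Q4_value c"
proof -
  interpret comm_ring_hom "eval_int c" by (rule eval_int_hom)
  show "eval_int c (Q2_value mvar) = Q2_value c" "eval_int c (Q4_value mvar) = Q4_value c"
    unfolding Q2_value_def Q4_value_def by (simp_all add: hom_distribs comm_ring_hom_numeral)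
qed

lemma coeff_sextic:
  fixes x :: "nat \<Rightarrow> 'a::comm_ring_1"
  defines "p \<equiv> \<Prod>i\<in>{1..6::nat}. [:- x i, 1:]"
  shows     "Polynomial.coeff p 5 = -(x 1 + x 2 + x 3 + x 4 + x 5 + x 6)"
    "Polynomial.coeff p 4 = (x 1 * x 2 + x 1 * x 3 + x 1 * x 4 + x 1 * x 5 + x 1 * x 6 + x 2 * x 3 + x 2 * x 4 + x 2 * x 5 + x 2 * x 6 + x 3 * x 4 + x 3 * x 5 + x 3 * x 6 + x 4 * x 5 + x 4 * x 6 + x 5 * x 6)"
    "Polynomial.coeff p 3 = -(x 1 * x 2 * x 3 + x 1 * x 2 * x 4 + x 1 * x 2 * x 5 + x 1 * x 2 * x 6 + x 1 * x 3 * x 4 + x 1 * x 3 * x 5 + x 1 * x 3 * x 6 + x 1 * x 4 * x 5 + x 1 * x 4 * x 6 + x 1 * x 5 * x 6 + x 2 * x 3 * x 4 + x 2 * x 3 * x 5 + x 2 * x 3 * x 6 + x 2 * x 4 * x 5 + x 2 * x 4 * x 6 + x 2 * x 5 * x 6 + x 3 * x 4 * x 5 + x 3 * x 4 * x 6 + x 3 * x 5 * x 6 + x 4 * x 5 * x 6)"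
    "Polynomial.coeff p 2 = (x 1 * x 2 * x 3 * x 4 + x 1 * x 2 * x 3 * x 5 + x 1 * x 2 * x 3 * x 6 + x 1 * x 2 * x 4 * x 5 + x 1 * x 2 * x 4 * x 6 + x 1 * x 2 * x 5 * x 6 + x 1 * x 3 * x 4 * x 5 + x 1 * x 3 * x 4 * x 6 + x 1 * x 3 * x 5 * x 6 + x 1 * x 4 * x 5 * x 6 + x 2 * x 3 * x 4 * x 5 + x 2 * x 3 * x 4 * x 6 + x 2 * x 3 * x 5 * x 6 + x 2 * x 4 * x 5 * x 6 + x 3 * x 4 * x 5 * x 6)"
    "Polynomial.coeff p 1 = -(x 1 * x 2 * x 3 * x 4 * x 5 + x 1 * x 2 * x 3 * x 4 * x 6 + x 1 * x 2 * x 3 * x 5 * x 6 + x 1 * x 2 * x 4 * x 5 * x 6 + x 1 * x 3 * x 4 * x 5 * x 6 + x 2 * x 3 * x 4 * x 5 * x 6)"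
    "Polynomial.coeff p 0 = (x 1 * x 2 * x 3 * x 4 * x 5 * x 6)"
    "Polynomial.coeff p 6 = 1"
proof -
  have "p = [:- x 1, 1:] * [:- x 2, 1:] * [:- x 3, 1:] * [:- x 4, 1:] * [:- x 5, 1:] * [:- x 6, 1:]"
    unfolding p_def set_1_6 by (simp only: prod.insert finite.intros prod.empty mult_1_right mult.assoc) simp
  then have "p = [:(x 1 * x 2 * x 3 * x 4 * x 5 * x 6), -(x 1 * x 2 * x 3 * x 4 * x 5 + x 1 * x 2 * x 3 * x 4 * x 6 + x 1 * x 2 * x 3 * x 5 * x 6 + x 1 * x 2 * x 4 * x 5 * x 6 + x 1 * x 3 * x 4 * x 5 * x 6 + x 2 * x 3 * x 4 * x 5 * x 6), (x 1 * x 2 * x 3 * x 4 + x 1 * x 2 * x 3 * x 5 + x 1 * x 2 * x 3 * x 6 + x 1 * x 2 * x 4 * x 5 + x 1 * x 2 * x 4 * x 6 + x 1 * x 2 * x 5 * x 6 + x 1 * x 3 * x 4 * x 5 + x 1 * x 3 * x 4 * x 6 + x 1 * x 3 * x 5 * x 6 + x 1 * x 4 * x 5 * x 6 + x 2 * x 3 * x 4 * x 5 + x 2 * x 3 * x 4 * x 6 + x 2 * x 3 * x 5 * x 6 + x 2 * x 4 * x 5 * x 6 + x 3 * x 4 * x 5 * x 6), -(x 1 * x 2 * x 3 + x 1 * x 2 * x 4 + x 1 * x 2 * x 5 + x 1 * x 2 * x 6 + x 1 * x 3 * x 4 + x 1 * x 3 * x 5 + x 1 * x 3 * x 6 + x 1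 * x 4 * x 5 + x 1 * x 4 * x 6 + x 1 * x 5 * x 6 + x 2 * x 3 * x 4 + x 2 * x 3 * x 5 + x 2 * x 3 * x 6 + x 2 * x 4 * x 5 + x 2 * x 4 * x 6 + x 2 * x 5 * x 6 + x 3 * x 4 * x 5 + x 3 * x 4 * x 6 + x 3 * x 5 * x 6 + x 4 * x 5 * x 6), (x 1 * x 2 + x 1 * x 3 + x 1 * x 4 + x 1 * x 5 + x 1 * x 6 + x 2 * x 3 + x 2 * x 4 + x 2 * x 5 + x 2 * x 6 + x 3 * x 4 + x 3 * x 5 + x 3 * x 6 + x 4 * x 5 + x 4 * x 6 + x 5 * x 6), -(x 1 + x 2 + x 3 + x 4 + x 5 + x 6), 1:]"
    by (simp add: algebra_simps)
  then show "Polynomial.coeff p 5 = -(x 1 + x 2 + x 3 + x 4 + x 5 + x 6)" "Polynomial.coeff p 4 = (x 1 * x 2 + x 1 * x 3 + x 1 * x 4 + x 1 * x 5 + x 1 * x 6 + x 2 * x 3 + x 2 * x 4 + x 2 * x 5 + x 2 * x 6 + x 3 * x 4 + x 3 * x 5 + x 3 * x 6 + x 4 * x 5 + x 4 * x 6 + x 5 * x 6)" "Polynomial.coeff p 3 = -(x 1 * x 2 * x 3 + x 1 * x 2 * x 4 + x 1 * x 2 * x 5 + x 1 * x 2 * x 6 + x 1 * x 3 * x 4 + x 1 * x 3 * x 5 + x 1 * x 3 * x 6 + x 1 * x 4 * x 5 + x 1 * x 4 * x 6 + x 1 * x 5 * x 6 + x 2 * x 3 * x 4 + x 2 * x 3 *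 x 5 + x 2 * x 3 * x 6 + x 2 * x 4 * x 5 + x 2 * x 4 * x 6 + x 2 * x 5 * x 6 + x 3 * x 4 * x 5 + x 3 * x 4 * x 6 + x 3 * x 5 * x 6 + x 4 * x 5 * x 6)"
    "Polynomial.coeff p 2 = (x 1 * x 2 * x 3 * x 4 + x 1 * x 2 * x 3 * x 5 + x 1 * x 2 * x 3 * x 6 + x 1 * x 2 * x 4 * x 5 + x 1 * x 2 * x 4 * x 6 + x 1 * x 2 * x 5 * x 6 + x 1 * x 3 * x 4 * x 5 + x 1 * x 3 * x 4 * x 6 + x 1 * x 3 * x 5 * x 6 + x 1 * x 4 * x 5 * x 6 + x 2 * x 3 * x 4 * x 5 + x 2 * x 3 * x 4 * x 6 + x 2 * x 3 * x 5 * x 6 + x 2 * x 4 * x 5 * x 6 + x 3 * x 4 * x 5 * x 6)" "Polynomial.coeff p 1 = -(x 1 * x 2 * x 3 * x 4 * x 5 + x 1 * x 2 * x 3 * x 4 * x 6 + x 1 * x 2 * x 3 * x 5 * x 6 + x 1 * x 2 * x 4 * x 5 * x 6 + x 1 * x 3 * x 4 * x 5 * x 6 + x 2 * x 3 * x 4 * x 5 * x 6)" "Polynomial.coeff p 0 = (x 1 * x 2 * x 3 * x 4 * x 5 * x 6)" "Polynomial.coeff p 6 = 1"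
    by (simp_all add: eval_nat_numeral)
qed

lemma J2_roots_eq:
  assumes "c \<noteq> 0"
  shows "eval_int (Polynomial.coeff (Polynomial.smult c (\<Prod>i\<in>{1..6::nat}. [:- x i, 1:]))) (Q2_value mvar) / 2 ^ 2 = J2_roots c x"
proof -
  define p where "p = (\<Prod>i\<in>{1..6::nat}. [:- x i, 1:])"
  note co = coeff_sextic[of x, folded p_def]
  define C where "C k = Polynomial.coeff p k" for k
  have I2: "I2_roots c x = c ^ 2 * (6 * C 3 ^ 2 - 16 * C 2 * C 4 + 40 * C 1 * C 5 - 240 * C 0)"
    unfolding I2_roots_def orbit_sum_matchings C_def by (rule arg_cong[OF I2_identity[OF co(1-6)]])
  have d: "Polynomial.coeff (Polynomial.smult c p) = (\<lambda>k. c * C k)" by (simp add: C_def fun_eq_iff)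
  have C6: "C 6 = 1" using co(7) by (simp add: C_def)
  show ?thesis
    unfolding J2_roots_def eval_Q2 p_def[symmetric] d I2 unfolding Q2_value_def
    by (simp add: C6 power2_eq_square field_simps)
qed

lemma J4_roots_eq:
  assumes "c \<noteq> 0"
  shows "eval_int (Polynomial.coeff (Polynomial.smult c (\<Prod>i\<in>{1..6::nat}. [:- x i, 1:]))) (Q4_value mvar) / 2 ^ 7 = J4_roots c x"
proof -
  define p where "p = (\<Prod>i\<in>{1..6::nat}. [:- x i, 1:])"
  note co = coeff_sextic[of x, folded p_def]
  define C where "C k = Polynomial.coeff p k" for k
  have I4: "I4_roots c x = c ^ 4 * ((4) * C 2^2 * C 4^2 + (-12) * C 2^2 * C 3 * C 5 + (48) * C 2^3 + (-12) * C 1 * C 3 * C 4^2 + (36) * C 1 * C 3^2 * C 5 + (4) * C 1 * C 2 * C 4 * C 5 + (-180) * C 1 * C 2 * C 3 + (-80) * C 1^2 * C 5^2 + (300) * C 1^2 * C 4 + (48) * C 0 * C 4^3 + (-180) * C 0 * C 3 * C 4 * C 5 + (324) * C 0 * C 3^2 + (300) * C 0 * C 2 * C 5^2 + (-504) * C 0 * C 2 * C 4 + (-540) * C 0 * C 1 * C 5 + (1620) * C 0^2 * 1)"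
    unfolding I4_roots_def orbit_sum_triples C_def by (rule arg_cong[OF I4_identity[OF co(1-6)]])
  have d: "Polynomial.coeff (Polynomial.smult c p) = (\<lambda>k. c * C k)" by (simp add: C_def fun_eq_iff)
  have C6: "C 6 = 1" using co(7) by (simp add: C_def)
  have J2: "J2_roots c x = c ^ 2 * (3 * C 3 ^ 2 - 8 * (C 2 * C 4) + 20 * (C 1 * C 5) - 120 * C 0) / 4"
    unfolding J2_roots_eq[OF assms, symmetric] eval_Q2 p_def[symmetric] d unfolding Q2_value_def
    by (simp add: C6 power2_eq_square field_simps)
  \<comment> \<open>The 3 on the left is the one to be cancelled before reducing: 4 (4 J2^2 - I4) =
    4 * 96 J4 = 3 * 128 J4.\<close>
  have "3 * Q4_value (\<lambda>k. c * C k) = (c ^ 2 * (3 * C 3 ^ 2 - 8 * (C 2 * C 4) + 20 * (C 1 * C 5) - 120 * C 0)) ^ 2 - 4 * (c ^ 4 * ((4) * C 2^2 * C 4^2 + (-12) * C 2^2 * C 3 * C 5 + (48) * C 2^3 + (-12) * C 1 * C 3 * C 4^2 + (36) * C 1 * C 3^2 * C 5 + (4) * C 1 * C 2 * C 4 * C 5 + (-180) * C 1 * C 2 * C 3 + (-80) * C 1^2 * C 5^2 + (300) * C 1^2 * C 4 + (48) * C 0 * C 4^3 + (-180) * C 0 * C 3 * C 4 * C 5 + (324) * C 0 * C 3^2 + (300) * C 0 * C 2 * C 5^2 + (-504) * C 0 * C 2 * C 4 + (-540) * C 0 * C 1 * C 5 + (1620) * C 0^2 * 1))"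
    unfolding Q4_value_def C6 by Groebner_Basis.algebra
  then have "3 * Q4_value (\<lambda>k. c * C k) = (4 * J2_roots c x) ^ 2 - 4 * I4_roots c x"
    unfolding I4 J2 by simp
  then show ?thesis
    unfolding J4_roots_def eval_Q4 p_def[symmetric] d by (simp add: power2_eq_square field_simps)
qed

lemma char3_numeral:
  assumes "CHAR('k::field) = 3"
  shows "(3 :: 'k) = 0" "(2 :: 'k) = -1"
proof -
  have "of_nat 3 = (0 :: 'k)" by (metis assms of_nat_CHAR)
  then show *: "(3 :: 'k) = 0" by simp
  have "(2 :: 'k) = 3 - 1" by simp
  then show "(2 :: 'k) = -1" using * by simp
qed

lemma char3_reduce_numeral:
  assumes "CHAR('k::field) = 3"
  shows "(of_int n :: 'k) = of_int (n mod 3)"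
proof -
  have "(of_int n :: 'k) = of_int (3 * (n div 3) + n mod 3)" by simp
  also have "\<dots> = of_int (n mod 3)" using char3_numeral[OF assms] by (simp only: of_int_add of_int_mult) simp
  finally show ?thesis .
qed

text \<open>The determinant of the Cartier--Manin matrix with rows (\<open>c 2\<close>,
  \<open>c 1\<close>) and (\<open>c 5\<close>, \<open>c 4\<close>).\<close>

definition J2_char3 :: "(nat \<Rightarrow> 'a::comm_ring_1) \<Rightarrow> 'a" where
  "J2_char3 c = c 2 * c 4 - c 1 * c 5"

definition J4_char3 :: "(nat \<Rightarrow> 'a::comm_ring_1) \<Rightarrow> 'a" where
  "J4_char3 c = c 2 * c 3 ^ 2 * c 4 - c 2 ^ 2 * c 4 ^ 2 - c 2 ^ 2 * c 3 * c 5 + c 2 ^ 3 * c 6 - c 1 * c 3 * c 4 ^ 2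
     - c 1 * c 3 ^ 2 * c 5 + c 1 * c 2 * c 4 * c 5 + c 1 ^ 2 * c 4 * c 6 + c 0 * c 4 ^ 3 + c 0 * c 2 * c 5 ^ 2
     - c 0 * c 2 * c 4 * c 6 + c 0 * c 1 * c 5 * c 6"

lemma J2_char3: "CHAR('k::field) = 3 \<Longrightarrow> J2 (F :: 'k poly) = J2_char3 (Polynomial.coeff F)"
  and J4_char3: "CHAR('k::field) = 3 \<Longrightarrow> J4 (F :: 'k poly) = J4_char3 (Polynomial.coeff F)"
proof -
  assume char: "CHAR('k) = 3"
  have two: "(2 :: 'k) \<noteq> 0"
    unfolding char3_numeral(2)[OF char] by (simp only: neg_equal_0_iff_equal one_neq_zero not_False_eq_True)
  have red: "(4 :: 'k) = 1" "(8 :: 'k) = -1" "(20 :: 'k) = -1" "(120 :: 'k) = 0" "(128 :: 'k) = -1" "(16 :: 'k) = 1" "(64 :: 'k) = 1" "(112 :: 'k) = 1" "(240 :: 'k) = 0" "(400 :: 'k) = 1" "(672 :: 'k) = 0" "(1312 :: 'k) = 1" "(880 :: 'k) = 1" "(2640 :: 'k) = 0"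
    using char3_numeral[OF char] char3_reduce_numeral[OF char, of 4] char3_reduce_numeral[OF char, of 8] char3_reduce_numeral[OF char, of 20] char3_reduce_numeral[OF char, of 120] char3_reduce_numeral[OF char, of 128] char3_reduce_numeral[OF char, of 16] char3_reduce_numeral[OF char, of 64] char3_reduce_numeral[OF char, of 112] char3_reduce_numeral[OF char, of 240] char3_reduce_numeral[OF char, of 400] char3_reduce_numeral[OF char, of 672] char3_reduce_numeral[OF char, of 1312] char3_reduce_numeral[OF char, of 880] char3_reduce_numeral[OF char, of 2640]
    by simp_all
  have "J2 F = Q2_value (Polynomial.coeff F) / 2 ^ 2"
    unfolding J2_def by (subst specialise_eq[OF in_vars_Q2 _ two]) (erule J2_roots_eq, simp only: eval_Q2)
  then show "J2 F = J2_char3 (Polynomial.coeff F)"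
    unfolding Q2_value_def J2_char3_def by (simp only: red char3_numeral[OF char]) simp
  have "J4 F = Q4_value (Polynomial.coeff F) / 2 ^ 7"
    unfolding J4_def by (subst specialise_eq[OF in_vars_Q4 _ two]) (erule J4_roots_eq, simp only: eval_Q4)
  then show "J4 F = J4_char3 (Polynomial.coeff F)"
    unfolding Q4_value_def J4_char3_def by (simp only: red char3_numeral[OF char]) (simp add: algebra_simps)
qed

subsection \<open>Square roots of Laurent series\<close>

text \<open>Coefficients of S^2 = g are compared: the n-th one is \<open>2 * s\<close> times the
  unknown plus products of earlier coefficients.\<close>

fun sqrt_coeff :: "(nat \<Rightarrow> 'a::field) \<Rightarrow> 'a \<Rightarrow> nat \<Rightarrow> 'a" where
  "sqrt_coeff g s n = (if n = 0 then s else (g n - (\<Sum>i\<in>{1..<n}. sqrt_coeff g s i * sqrt_coeff g s (n - i))) / (2 * s))"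

declare sqrt_coeff.simps [simp del]

lemma fps_sqrt_exists:
  fixes g :: "'a::alg_closed_field fps"
  assumes "fps_nth g 0 \<noteq> 0" "(2 :: 'a) \<noteq> 0"
  obtains S where "S * S = g"
proof -
  obtain s where s: "s ^ 2 = fps_nth g 0"
    using nth_root_exists[of 2 "fps_nth g 0"] by auto
  then have s0: "s \<noteq> 0" using assms by auto
  define S where "S = Abs_fps (sqrt_coeff (fps_nth g) s)"
  have "fps_nth (S * S) n = fps_nth g n" for n
  proof (cases "n = 0")
    case True
    then show ?thesis using s by (simp add: S_def sqrt_coeff.simps[of _ _ 0] power2_eq_square)
  next
    case False
    let ?c = "sqrt_coeff (fps_nth g) s"
    have "{0..n} = insert 0 (insert n {1..<n})" using False by auto
    then have "fps_nth (S * S) n = ?c 0 * ?c n + (?c n * ?c 0 + (\<Sum>i\<in>{1..<n}. ?c i * ?c (n - i)))"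
      using False by (simp add: S_def fps_mult_nth)
    also have "?c 0 = s" by (simp add: sqrt_coeff.simps[of _ _ 0])
    also have "s * ?c n + (?c n * s + (\<Sum>i\<in>{1..<n}. ?c i * ?c (n - i))) =
        2 * s * ?c n + (\<Sum>i\<in>{1..<n}. ?c i * ?c (n - i))" by (simp add: algebra_simps)
    also have "2 * s * ?c n = fps_nth g n - (\<Sum>i\<in>{1..<n}. ?c i * ?c (n - i))"
      using False s0 assms(2) by (subst sqrt_coeff.simps[of _ _ n]) simp
    finally show ?thesis by simp
  qed
  then have "S * S = g" by (simp add: fps_eq_iff)
  then show ?thesis by (rule that)
qed

lemma fls_sqrt_exists:
  fixes g :: "'a::alg_closed_field fls"
  assumes "even (fls_subdegree g)" "(2 :: 'a) \<noteq> 0"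
  obtains S where "S ^ 2 = g"
proof (cases "g = 0")
  case True
  then show ?thesis using that[of 0] by simp
next
  case False
  obtain m where m: "fls_subdegree g = 2 * m" using assms(1) by (elim evenE)
  define h where "h = fls_regpart (fls_base_factor g)"
  have "fps_nth h 0 \<noteq> 0" using False by (simp add: h_def)
  then obtain S where S: "S * S = h" using fps_sqrt_exists assms(2) by blast
  have "fps_to_fls h = fls_base_factor g"
    using fls_regpart_to_fls_trivial[of "fls_base_factor g"] False by (simp add: h_def)
  then have "g = fls_shift (- (2 * m)) (fps_to_fls h)"
    using fls_conv_base_factor_shift_subdegree[of g] m by simp
  also have "fps_to_fls h = fps_to_fls S * fps_to_fls S"
    by (simp add: S[symmetric] fls_times_fps_to_fls)
  also have "fls_shift (- (2 * m)) \<dots> = fls_shift (- m) (fps_to_fls S) ^ 2"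
    by (simp add: power2_eq_square fls_shifted_times_simps)
  finally show ?thesis using that by metis
qed

subsection \<open>Extending homomorphisms to the field of fractions\<close>

definition fract_lift :: "('r::idom \<Rightarrow> 'l::field) \<Rightarrow> 'r fract \<Rightarrow> 'l" where
  "fract_lift h q = (THE z. \<forall>a b. b \<noteq> 0 \<longrightarrow> q = Fract a b \<longrightarrow> z = h a / h b)"

lemma fract_lift_Fract:
  assumes h: "comm_ring_hom h" and inj: "\<And>a. h a = 0 \<Longrightarrow> a = 0" and b: "b \<noteq> 0"
  shows "fract_lift h (Fract a b) = h a / h b"
  unfolding fract_lift_def
proof (rule the_equality)
  interpret comm_ring_hom h by fact
  show *: "\<forall>a' b'. b' \<noteq> 0 \<longrightarrow> Fract a b = Fract a' b' \<longrightarrow> h a / h b = h a' / h b'"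
  proof (intro allI impI)
    fix a' b' assume "b' \<noteq> 0" "Fract a b = Fract a' b'"
    then have "a * b' = a' * b" using b by (simp add: eq_fract)
    then have "h a * h b' = h a' * h b" by (metis hom_mult)
    moreover have "h b \<noteq> 0" "h b' \<noteq> 0" using inj b \<open>b' \<noteq> 0\<close> by auto
    ultimately show "h a / h b = h a' / h b'" by (simp add: field_simps)
  qed
  show "\<And>z. \<forall>a' b'. b' \<noteq> 0 \<longrightarrow> Fract a b = Fract a' b' \<longrightarrow> z = h a' / h b' \<Longrightarrow> z = h a / h b"
    using b by blast
qed

lemma fract_lift_hom:
  assumes h: "comm_ring_hom h" and inj: "\<And>a. h a = 0 \<Longrightarrow> a = 0"
  shows "comm_ring_hom (fract_lift h)"
proof -
  interpret comm_ring_hom h by fact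
  note lift = fract_lift_Fract[OF h inj]
  have add: "fract_lift h (q + r) = fract_lift h q + fract_lift h r" 
    and mult: "fract_lift h (q * r) = fract_lift h q * fract_lift h r" for q r
  proof -
    obtain a b c d where q: "q = Fract a b" "b \<noteq> 0" and r: "r = Fract c d" "d \<noteq> 0"
      by (meson Fract_cases)
    have "h b \<noteq> 0" "h d \<noteq> 0" using inj q r by auto
    then show "fract_lift h (q + r) = fract_lift h q + fract_lift h r"
      "fract_lift h (q * r) = fract_lift h q * fract_lift h r"
      using q r by (simp_all add: lift hom_distribs field_simps)
  qed
  show ?thesis
    by unfold_locales (simp_all add: add mult Zero_fract_def One_fract_def lift)
qed

lemma comm_ring_hom_field_inj:
  assumes "comm_ring_hom (h :: 'a::field \<Rightarrow> 'b::{comm_ring_1})" "h x = 0"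
  shows "x = 0"
proof (rule ccontr)
  interpret comm_ring_hom h by fact
  assume "x \<noteq> 0"
  then have "h x * h (inverse x) = 1" by (simp flip: hom_mult)
  then show False using assms(2) by simp
qed

lemma comm_ring_hom_divide:
  assumes "comm_ring_hom (h :: 'a::field \<Rightarrow> 'b::field)"
  shows "h (x / y) = h x / h y"
proof (cases "y = 0")
  case False
  interpret comm_ring_hom h by fact
  have "h (x / y) * h y = h x" using False by (simp flip: hom_mult)
  moreover have "h y \<noteq> 0" using comm_ring_hom_field_inj[OF assms] False by blast
  ultimately show ?thesis by (simp add: field_simps)
next
  case True
  interpret comm_ring_hom h by fact
  show ?thesis using True by simp
qed

subsection \<open>Valuations\<close>

definition is_subfield :: "'l::field set \<Rightarrow> bool" where
  "is_subfield K \<longleftrightarrow> 0 \<in> K \<and> 1 \<in> K \<and> (\<forall>f\<in>K. \<forall>g\<in>K. f + g \<in> K \<and> f * g \<in> K) \<and> (\<forall>f\<in>K. - f \<in> K \<and> inverse f \<in> K)"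

lemma
  assumes "is_subfield K"
  shows subfield_0: "0 \<in> K" and subfield_1: "1 \<in> K"
    and subfield_add: "f \<in> K \<Longrightarrow> g \<in> K \<Longrightarrow> f + g \<in> K"
    and subfield_mult: "f \<in> K \<Longrightarrow> g \<in> K \<Longrightarrow> f * g \<in> K"
    and subfield_uminus: "f \<in> K \<Longrightarrow> - f \<in> K"
    and subfield_inverse: "f \<in> K \<Longrightarrow> inverse f \<in> K"
    and subfield_diff: "f \<in> K \<Longrightarrow> g \<in> K \<Longrightarrow> f - g \<in> K"
    and subfield_divide: "f \<in> K \<Longrightarrow> g \<in> K \<Longrightarrow> f / g \<in> K"
    and subfield_power: "f \<in> K \<Longrightarrow> f ^ n \<in> K"
proof -
  show K: "0 \<in> K" "1 \<in> K" "f \<in> K \<Longrightarrow> g \<in> K \<Longrightarrow> f + g \<in> K" "f \<in> K \<Longrightarrow> g \<in> K \<Longrightarrow> f * g \<in> K"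
    "f \<in> K \<Longrightarrow> - f \<in> K" "f \<in> K \<Longrightarrow> inverse f \<in> K" for f g
    using assms by (auto simp: is_subfield_def)
  show "f \<in> K \<Longrightarrow> g \<in> K \<Longrightarrow> f - g \<in> K" using K(3)[of f "- g"] K(5) by simp
  show "f \<in> K \<Longrightarrow> g \<in> K \<Longrightarrow> f / g \<in> K" using K(4)[of f "inverse g"] K(6) by (simp add: divide_inverse)
  show "f \<in> K \<Longrightarrow> f ^ n \<in> K" by (induction n) (auto intro: K)
qed

lemma is_subfield_UNIV: "is_subfield UNIV"
  by (simp add: is_subfield_def)

text \<open>The valuation lives on a subfield so that the same rules serve Laurent series, with
  \<open>K\<close> everything and \<open>w\<close> the subdegree, and an arbitrary place of the
  function field once that is embedded in Laurent series. As \<open>w 0\<close> carries no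
  information, bounds are stated with \<open>ge\<close>, where 0 satisfies every bound.\<close>

locale valn =
  fixes K :: "'l::field set" and \<kappa> :: "'a::field \<Rightarrow> 'l" and w :: "'l \<Rightarrow> int"
  assumes K: "is_subfield K" and \<kappa>: "comm_ring_hom \<kappa>" and \<kappa>_in: "\<kappa> c \<in> K"
    and w_mult: "f \<in> K \<Longrightarrow> g \<in> K \<Longrightarrow> f \<noteq> 0 \<Longrightarrow> g \<noteq> 0 \<Longrightarrow> w (f * g) = w f + w g"
    and w_add: "f \<in> K \<Longrightarrow> g \<in> K \<Longrightarrow> f \<noteq> 0 \<Longrightarrow> g \<noteq> 0 \<Longrightarrow> f + g \<noteq> 0 \<Longrightarrow> min (w f) (w g) \<le> w (f + g)"
    and w_const: "c \<noteq> 0 \<Longrightarrow> w (\<kappa> c) = 0"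
begin

sublocale \<kappa>: comm_ring_hom \<kappa> by (rule \<kappa>)

lemmas K_closed [intro] = subfield_0[OF K] subfield_1[OF K] subfield_add[OF K] subfield_mult[OF K] subfield_uminus[OF K]
  subfield_inverse[OF K] subfield_diff[OF K] subfield_divide[OF K] subfield_power[OF K] \<kappa>_in

lemma \<kappa>_eq_0 [simp]: "\<kappa> c = 0 \<longleftrightarrow> c = 0"
  using comm_ring_hom_field_inj[OF \<kappa>] by auto

lemma w_1 [simp]: "w 1 = 0"
  using w_const[of 1] by simp

lemma w_minus_1 [simp]: "w (- 1) = 0"
  using w_const[of "- 1"] by (simp add: \<kappa>.hom_uminus)

lemma w_uminus [simp]: "f \<in> K \<Longrightarrow> w (- f) = w f"
  using w_mult[of "- 1" f] by (cases "f = 0") auto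

lemma w_inverse: "f \<in> K \<Longrightarrow> f \<noteq> 0 \<Longrightarrow> w (inverse f) = - w f"
  using w_mult[of f "inverse f"] subfield_inverse[OF K] by force

lemma w_divide: "f \<in> K \<Longrightarrow> g \<in> K \<Longrightarrow> f \<noteq> 0 \<Longrightarrow> g \<noteq> 0 \<Longrightarrow> w (f / g) = w f - w g"
  using w_mult[of f "inverse g"] w_inverse[of g] by (auto simp: divide_inverse)

lemma w_power: "f \<in> K \<Longrightarrow> f \<noteq> 0 \<Longrightarrow> w (f ^ n) = int n * w f"
  by (induction n) (auto simp: w_mult K_closed algebra_simps)

definition ge :: "'l \<Rightarrow> int \<Rightarrow> bool" where
  "ge f n \<longleftrightarrow> f = 0 \<or> n \<le> w f"

lemma ge_add: "f \<in> K \<Longrightarrow> g \<in> K \<Longrightarrow> ge f n \<Longrightarrow> ge g n \<Longrightarrow> ge (f + g) n"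
  using w_add[of f g] by (cases "f = 0"; cases "g = 0"; cases "f + g = 0") (auto simp: ge_def)

lemma ge_mult: "f \<in> K \<Longrightarrow> g \<in> K \<Longrightarrow> ge f n \<Longrightarrow> ge g m \<Longrightarrow> ge (f * g) (n + m)"
  using w_mult[of f g] by (cases "f = 0"; cases "g = 0") (auto simp: ge_def)

lemma ge_uminus: "f \<in> K \<Longrightarrow> ge (- f) n \<longleftrightarrow> ge f n"
  by (simp add: ge_def)

lemma ge_diff: "f \<in> K \<Longrightarrow> g \<in> K \<Longrightarrow> ge f n \<Longrightarrow> ge g n \<Longrightarrow> ge (f - g) n"
  using ge_add[of f "- g" n] ge_uminus[of g n] by auto

lemma ge_const: "ge (\<kappa> c) 0"
  using w_const[of c] by (cases "c = 0") (auto simp: ge_def)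

lemma ge_mono: "ge f n \<Longrightarrow> m \<le> n \<Longrightarrow> ge f m"
  by (auto simp: ge_def)

lemma w_add_strict:
  assumes "f \<in> K" "g \<in> K" "f \<noteq> 0" "ge g (w f + 1)"
  shows "f + g \<noteq> 0" "w (f + g) = w f"
proof -
  show ne: "f + g \<noteq> 0"
  proof
    assume "f + g = 0"
    then have "g = - f" by (simp add: eq_neg_iff_add_eq_0 add.commute)
    then show False using assms by (simp add: ge_def)
  qed
  show "w (f + g) = w f"
  proof (cases "g = 0")
    case False
    then have "w f < w g" using assms by (simp add: ge_def)
    moreover have "min (w f) (w g) \<le> w (f + g)" using w_add assms ne False by blast
    \<comment> \<open>The upper bound is the ultrametric inequality for f = (f + g) + (-g).\<close>
    moreover have "min (w (f + g)) (w (- g)) \<le> w f"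
      using w_add[of "f + g" "- g"] assms ne False by auto
    ultimately show ?thesis using assms by simp
  qed simp
qed

definition eval :: "'l \<Rightarrow> 'a poly \<Rightarrow> 'l" where
  "eval x p = poly (map_poly \<kappa> p) x"

lemma eval_pCons [simp]: "eval x (pCons a p) = \<kappa> a + x * eval x p"
  by (cases "p = 0 \<and> a = 0") (auto simp: eval_def map_poly_pCons)

lemma eval_0 [simp]: "eval x 0 = 0" by (simp add: eval_def)

lemma eval_1 [simp]: "eval x 1 = 1" by (simp add: one_pCons)

lemma eval_in [intro]: "x \<in> K \<Longrightarrow> eval x p \<in> K"
  by (induction p) auto

lemma eval_add: "eval x (p + q) = eval x p + eval x q"
proof (induction p arbitrary: q)
  case (pCons a p)
  then show ?case by (cases q) (simp add: \<kappa>.hom_add algebra_simps)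
qed simp

lemma eval_smult: "eval x (Polynomial.smult c p) = \<kappa> c * eval x p"
  by (induction p) (simp_all add: \<kappa>.hom_mult algebra_simps)

lemma eval_mult: "eval x (p * q) = eval x p * eval x q"
  by (induction p) (simp_all add: eval_add eval_smult algebra_simps)

lemma eval_power: "eval x (p ^ n) = eval x p ^ n"
  by (induction n) (simp_all add: eval_mult)

lemma eval_ge_0: "x \<in> K \<Longrightarrow> ge x 0 \<Longrightarrow> ge (eval x p) 0"
proof (induction p)
  case (pCons a p)
  then have "ge (x * eval x p) 0" using ge_mult[of x "eval x p" 0 0] by auto
  then show ?case using pCons ge_add[of "\<kappa> a" "x * eval x p" 0] ge_const by auto
qed (simp add: ge_def)

text \<open>Write p = (X - r)^m q with q(r) nonzero. Since q(x) differs from the constant q(r) by an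
  integral multiple of x - r, it is a unit, and only the power of x - r contributes.\<close>

lemma eval_finite_point:
  assumes x: "x \<in> K" "x \<noteq> \<kappa> r" and e: "w (x - \<kappa> r) > 0" and p: "p \<noteq> 0"
  shows "eval x p \<noteq> 0" "w (eval x p) = w (x - \<kappa> r) * int (Polynomial.order r p)"
proof -
  obtain q where q: "p = [:- r, 1:] ^ Polynomial.order r p * q" "\<not> [:- r, 1:] dvd q"
    using order_decomp[OF p] by blast
  have xr: "x - \<kappa> r \<in> K" "x - \<kappa> r \<noteq> 0" using x by auto
  have ge: "ge x 0"
    using ge_add[of "x - \<kappa> r" "\<kappa> r" 0] e xr ge_const by (auto simp: ge_def)
  have qr: "poly q r \<noteq> 0" using q by (simp add: poly_eq_0_iff_dvd)
  have "[:- r, 1:] dvd q - [:poly q r:]" by (simp flip: poly_eq_0_iff_dvd)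
  then obtain s where s: "q = [:poly q r:] + [:- r, 1:] * s" by (metis add_diff_cancel_left' diff_add_cancel dvdE add.commute)
  have lin: "eval x [:- r, 1:] = x - \<kappa> r" by (simp add: \<kappa>.hom_uminus)
  have "eval x q = \<kappa> (poly q r) + (x - \<kappa> r) * eval x s"
    by (subst s, simp only: eval_add eval_mult lin) simp
  moreover have "ge ((x - \<kappa> r) * eval x s) (w (x - \<kappa> r) + 0)"
    using xr x ge by (intro ge_mult eval_ge_0) (auto simp: ge_def)
  then have "ge ((x - \<kappa> r) * eval x s) (w (\<kappa> (poly q r)) + 1)"
    using e qr by (auto simp: w_const intro: ge_mono)
  ultimately have "eval x q \<noteq> 0 \<and> w (eval x q) = 0"
    using w_add_strict[of "\<kappa> (poly q r)" "(x - \<kappa> r) * eval x s"] xr x qr by (auto simp: w_const)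
  moreover have "eval x p = (x - \<kappa> r) ^ Polynomial.order r p * eval x q"
    by (subst q(1)) (simp only: eval_mult eval_power lin)
  ultimately show "eval x p \<noteq> 0" "w (eval x p) = w (x - \<kappa> r) * int (Polynomial.order r p)"
    using xr x w_power[OF xr, of "Polynomial.order r p"] subfield_power[OF K xr(1)] eval_in[OF x(1), of q]
      w_mult[of "(x - \<kappa> r) ^ Polynomial.order r p" "eval x q"] by auto
qed

text \<open>At a pole of x the leading term dominates: in each Horner step the product with x has
  negative value, so adding a constant does not change it.\<close>

lemma eval_infinite_point:
  assumes x: "x \<in> K" "x \<noteq> 0" and e: "w x < 0" and p: "p \<noteq> 0"
  shows "eval x p \<noteq> 0 \<and> w (eval x p) = w x * int (Polynomial.degree p)"
  using p
proof (induction p)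
  case (pCons a p)
  show ?case
  proof (cases "p = 0")
    case True
    then show ?thesis using pCons by (simp add: w_const)
  next
    case False
    then have IH: "eval x p \<noteq> 0" "w (eval x p) = w x * int (Polynomial.degree p)" using pCons by auto
    have wx: "w (x * eval x p) = w x * int (Suc (Polynomial.degree p))"
      using IH x by (subst w_mult) (auto simp: algebra_simps)
    have "w x * int (Suc (Polynomial.degree p)) < 0" using e by (simp only: mult_less_0_iff) simp
    with wx have "ge (\<kappa> a) (w (x * eval x p) + 1)"
      using ge_const[of a] by (auto intro: ge_mono)
    then have "x * eval x p + \<kappa> a \<noteq> 0" "w (x * eval x p + \<kappa> a) = w (x * eval x p)"
      using w_add_strict[of "x * eval x p" "\<kappa> a"] IH x by auto
    then show ?thesis using wx False by (simp add: add.commute)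
  qed
qed simp

end

lemma valn_fls_subdegree: "valn UNIV fls_const (fls_subdegree :: 'a::field fls \<Rightarrow> int)"
proof -
  have "comm_ring_hom (fls_const :: 'a \<Rightarrow> 'a fls)"
    by unfold_locales (simp_all add: flip: fls_plus_const)
  then show ?thesis
    by (intro valn.intro) (auto simp: is_subfield_UNIV fls_plus_subdegree)
qed

subsection \<open>Derivations in characteristic 3\<close>

locale deriv3 =
  fixes D :: "'l::field \<Rightarrow> 'l"
  assumes D_add: "D (f + g) = D f + D g" and D_mult: "D (f * g) = D f * g + f * D g"
    and D_D_D: "D (D (D f)) = 0" and three: "(3 :: 'l) = 0"
begin

lemma two: "(2 :: 'l) = - 1"
proof -
  have "(2 :: 'l) = 3 - 1" by simp
  then show ?thesis using three by simp
qed

lemma D_0 [simp]: "D 0 = 0"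
  using D_add[of 0 0] by (simp only: add_0_left add_cancel_right_right)

lemma D_1 [simp]: "D 1 = 0"
  using D_mult[of 1 1] by (simp only: mult_1 mult_1_right add_cancel_right_right)

lemma D_uminus: "D (- f) = - D f"
  using D_add[of f "- f"] by (simp add: eq_neg_iff_add_eq_0 add.commute)

lemma D_diff: "D (f - g) = D f - D g"
  using D_add[of f "- g"] by (simp add: D_uminus)

lemma D_cube: "D (f ^ 3) = 0"
proof -
  have "D (f ^ 3) = 3 * f ^ 2 * D f"
    by (simp add: power3_eq_cube power2_eq_square D_mult algebra_simps)
  then show ?thesis using three by simp
qed

lemma D_inverse: "f \<noteq> 0 \<Longrightarrow> D (inverse f) = - D f / f ^ 2"
proof -
  assume f: "f \<noteq> 0"
  have "D f * inverse f + f * D (inverse f) = 0" using D_mult[of f "inverse f"] f by simp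
  then have "f * D (inverse f) = - (D f * inverse f)" by (metis add_eq_0_iff)
  then show ?thesis using f by (simp add: field_simps power2_eq_square)
qed

lemma D_divide: "g \<noteq> 0 \<Longrightarrow> D (f / g) = (D f * g - f * D g) / g ^ 2"
  by (simp add: divide_inverse D_mult D_inverse) (simp add: field_simps power2_eq_square)

text \<open>The case \<open>p = 3\<close> of Hochschild's formula
  \<open>(h D)\<^sup>p = h\<^sup>p D\<^sup>p + (h D)\<^sup>p\<^sup>-\<^sup>1(h) D\<close>, applied with \<open>h = 1 / D t\<close>.\<close>

lemma normalised_derivation:
  assumes t: "D t \<noteq> 0"
  shows "D (D (D f / D t) / D t) / D t * D t = D (D (D f / D t) / D t)"
    and "D (D (D f / D t) / D t) = 0"
proof -
  define h where "h = inverse (D t)"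
  have h: "h \<noteq> 0" "h * D t = 1" using t by (auto simp: h_def)
  have e1: "D h * D t + h * D (D t) = 0"
    using arg_cong[OF h(2), of D] by (simp add: D_mult)
  have e2: "D (D h) * D t + 2 * (D h * D (D t)) = 0"
    using arg_cong[OF e1, of D] by (simp add: D_mult D_add D_D_D algebra_simps)
  have "0 = h * (D (D h) * D t + 2 * (D h * D (D t)))" using e2 by simp
  also have "\<dots> = (h * D t) * D (D h) + 2 * D h * (h * D (D t))" by (simp only: algebra_simps)
  also have "h * D (D t) = - (D h * D t)" using e1 by (simp add: eq_neg_iff_add_eq_0 add.commute)
  finally have "D (D h) = 2 * D h * (D h * D t)" using h(2) by simp
  \<comment> \<open>Differentiating h D t = 1 twice has produced 2 (D h)^2; the further (D h)^2
    coming from the outer derivative completes it to a multiple of 3.\<close>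
  then have "h * D (D h) = 2 * D h * D h * (h * D t)" by (simp only: mult_ac)
  then have "h * D (D h) + D h * D h = 3 * (D h * D h)" using h(2) by simp
  then have key: "h * D (D h) + D h * D h = 0" using three by simp
  have "D (D (D f * h) * h) = (h * D (D h) + D h * D h) * D f + 3 * (h * D h * D (D f))"
    by (simp add: D_mult D_add D_D_D algebra_simps)
  then show "D (D (D f / D t) / D t) = 0" using key three by (simp add: divide_inverse h_def)
  show "D (D (D f / D t) / D t) / D t * D t = D (D (D f / D t) / D t)" using t by simp
qed

text \<open>With \<open>d\<close> = d/dt and 2 = -1, the shape a + b t + c t^2 forces d d f = -c and
  d f = b - c t, which are solved for \<open>c\<close> and \<open>b\<close>. That the coefficients
  have derivative 0 rests on the third iterate of d/dt being 0.\<close>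

lemma taylor:
  fixes f t :: 'l
  assumes t: "D t \<noteq> 0"
  defines "d \<equiv> \<lambda>f. D f / D t"
  defines "c \<equiv> - d (d f)"
  defines "b \<equiv> d f + c * t"
  defines "a \<equiv> f - b * t - c * t ^ 2"
  shows "f = a + b * t + c * t ^ 2" "D a = 0" "D b = 0" "D c = 0"
proof -
  show "f = a + b * t + c * t ^ 2" by (simp add: a_def)
  show c: "D c = 0" using normalised_derivation(2)[OF t, of f] by (simp add: c_def d_def D_uminus)
  have "D b = D (d f) + c * D t" using c by (simp add: b_def D_add D_mult)
  also have "c * D t = - D (d f)" using t by (simp add: c_def d_def)
  finally show b: "D b = 0" by simp
  have "D a = D f - b * D t - 2 * c * t * D t"
    using b c by (simp add: a_def D_add D_diff D_mult power2_eq_square algebra_simps)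
  also have "b * D t = D f + c * t * D t" using t by (simp add: b_def d_def algebra_simps)
  finally have "D a = - (3 * (c * t * D t))" by (simp add: algebra_simps)
  then show "D a = 0" using three by simp
qed

text \<open>Jacobson's criterion for \<open>p = 3\<close>: \<open>\<omega>\<close> is a logarithmic derivative iff its
  \<open>p\<close>-curvature \<open>\<omega>'' + \<omega>\<^sup>3\<close> vanishes. The solution is \<open>f = (D - \<omega>)\<^sup>2 g\<close>, since \<open>(D - \<omega>)\<^sup>3 = 0\<close>.\<close>

lemma log_derivative_imp_curvature_0:
  assumes "f \<noteq> 0" "D f = \<omega> * f"
  shows "D (D \<omega>) + \<omega> ^ 3 = 0"
proof -
  have "D (D (D f)) = (D (D \<omega>) + \<omega> ^ 3) * f + 3 * (\<omega> * D \<omega> * f)"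
    by (simp add: assms(2) D_mult D_add power3_eq_cube algebra_simps)
  then show ?thesis using assms(1) three D_D_D by simp
qed

lemma curvature_0_imp_log_derivative:
  assumes curv: "D (D \<omega>) + \<omega> ^ 3 = 0" and x: "D x = 1"
  obtains g where "g \<in> {1, x, x ^ 2}" "D (D g) - D \<omega> * g - 2 * \<omega> * D g + \<omega> ^ 2 * g \<noteq> 0"
    "D (D (D g) - D \<omega> * g - 2 * \<omega> * D g + \<omega> ^ 2 * g) = \<omega> * (D (D g) - D \<omega> * g - 2 * \<omega> * D g + \<omega> ^ 2 * g)"
proof -
  define T where "T g = D (D g) - D \<omega> * g - 2 * \<omega> * D g + \<omega> ^ 2 * g" for g
  have D_2: "D 2 = 0" using D_add[of 1 1] by simp
  have D_pow: "D (\<omega> ^ 2) = 2 * \<omega> * D \<omega>" by (simp add: power2_eq_square D_mult algebra_simps)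
  have "D (T g) - \<omega> * T g = - ((D (D \<omega>) + \<omega> ^ 3) * g) + 3 * (\<omega> * D \<omega> * g + \<omega> ^ 2 * D g - D \<omega> * D g - \<omega> * D (D g))" for g
    unfolding T_def by (simp add: D_mult D_add D_diff D_D_D D_2 D_pow) (simp add: algebra_simps power2_eq_square power3_eq_cube)
  then have sol: "D (T g) = \<omega> * T g" for g using curv three by simp
  have Dx2: "D (x ^ 2) = 2 * x" by (simp add: power2_eq_square D_mult x)
  \<comment> \<open>If all three vanished, T(x) - x T(1) = -2 \<omega> would give \<omega> = 0, and
    then T(x^2) would be the second derivative 2 of x^2.\<close>
  have "T 1 \<noteq> 0 \<or> T x \<noteq> 0 \<or> T (x ^ 2) \<noteq> 0"
  proof (rule ccontr)
    assume "\<not> ?thesis"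
    then have 0: "T 1 = 0" "T x = 0" "T (x ^ 2) = 0" by auto
    have "T x = x * T 1 - 2 * \<omega>" by (simp add: T_def x algebra_simps)
    then have \<omega>: "\<omega> = 0" using 0 two by simp
    have "T (x ^ 2) = 2" by (simp add: T_def \<omega> Dx2 D_mult D_2 x)
    then show False using 0 two by simp
  qed
  then show ?thesis using that sol unfolding T_def by blast
qed

end

section \<open>Valuations of derivatives\<close>

locale deriv3_valn = deriv3 D + valn K \<kappa> w
  for D :: "'l::field \<Rightarrow> 'l" and K :: "'l set" and \<kappa> :: "'a::field \<Rightarrow> 'l" and w :: "'l \<Rightarrow> int" +
  assumes D_in: "f \<in> K \<Longrightarrow> D f \<in> K" and D_eq_0_imp_cube: "f \<in> K \<Longrightarrow> D f = 0 \<Longrightarrow> \<exists>g\<in>K. f = g ^ 3"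
begin

lemma w_sum_distinct:
  assumes "f \<in> K" "g \<in> K" "f \<noteq> 0 \<Longrightarrow> g \<noteq> 0 \<Longrightarrow> w f \<noteq> w g" "f + g \<noteq> 0"
  shows "ge f (w (f + g)) \<and> ge g (w (f + g)) \<and> (f \<noteq> 0 \<and> w f = w (f + g) \<or> g \<noteq> 0 \<and> w g = w (f + g))"
proof (cases "f = 0 \<or> g = 0")
  case True
  then show ?thesis using assms by (auto simp: ge_def)
next
  case False
  then consider "w f < w g" | "w g < w f" using assms(3) by linarith
  then show ?thesis
  proof cases
    case 1
    then have "w (f + g) = w f" using w_add_strict(2)[of f g] False assms by (auto simp: ge_def)
    then show ?thesis using 1 False by (auto simp: ge_def)
  next
    case 2
    then have "w (g + f) = w g" using w_add_strict(2)[of g f] False assms by (auto simp: ge_def)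
    then show ?thesis using 2 False by (auto simp: ge_def add.commute)
  qed
qed

text \<open>The Taylor coefficients of \<open>f\<close> with respect to \<open>t\<close> have
  derivative 0, hence are cubes in \<open>K\<close>. This replaces a power series expansion in a
  completion at the place.\<close>

lemma cube_decomposition:
  assumes t: "t \<in> K" "D t \<noteq> 0" and f: "f \<in> K"
  obtains a b c where "a \<in> K" "b \<in> K" "c \<in> K" "f = a ^ 3 + b ^ 3 * t + c ^ 3 * t ^ 2"
    "D f = (b ^ 3 - c ^ 3 * t) * D t"
proof -
  define d where "d = (\<lambda>f. D f / D t)"
  have d_in: "d g \<in> K" if "g \<in> K" for g
    unfolding d_def using that t by (intro subfield_divide[OF K] D_in)
  define c where "c = - d (d f)"
  define b where "b = d f + c * t"
  define a where "a = f - b * t - c * t ^ 2"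
  have tay: "f = a + b * t + c * t ^ 2" "D a = 0" "D b = 0" "D c = 0"
    using taylor[OF t(2), of f] unfolding a_def b_def c_def d_def by blast+
  have "c \<in> K" unfolding c_def using d_in f by auto
  then have "b \<in> K" unfolding b_def using d_in f t by auto
  then have "a \<in> K" unfolding a_def using \<open>c \<in> K\<close> f t by (auto intro!: subfield_diff[OF K])
  obtain a' where a': "a' \<in> K" "a = a' ^ 3" using D_eq_0_imp_cube[OF \<open>a \<in> K\<close> tay(2)] by blast
  obtain b' where b': "b' \<in> K" "b = b' ^ 3" using D_eq_0_imp_cube[OF \<open>b \<in> K\<close> tay(3)] by blast
  obtain c' where c': "c' \<in> K" "c = c' ^ 3" using D_eq_0_imp_cube[OF \<open>c \<in> K\<close> tay(4)] by blast
  have "D f = b * D t + 2 * c * t * D t"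
    by (subst tay(1)) (simp add: D_add D_mult tay(2-4) power2_eq_square algebra_simps)
  then have "D f = (b - c * t) * D t" using two by (simp add: algebra_simps)
  then show ?thesis using that[OF a'(1) b'(1) c'(1)] tay(1) unfolding a'(2) b'(2) c'(2) by blast
qed

text \<open>Let f = a^3 + b^3 t + c^3 t^2. The nonzero terms have values 0, 1, 2 modulo 3, so none
  cancel, and D f = (b^3 - c^3 t) D t has terms with values 0 and 1 modulo 3 before the shift by
  \<open>w (D t)\<close>. Differentiation therefore lowers the value by exactly 1, up to that shift,
  unless the leading term is the cube.\<close>

lemma
  assumes t: "t \<in> K" "t \<noteq> 0" "w t = 1" and f: "f \<in> K" "f \<noteq> 0"
  shows D_uniformizer_nonzero: "D t \<noteq> 0"
    and ge_D: "ge (D f) (w f - 1 + w (D t))"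
    and ge_D_of_dvd: "3 dvd w f \<Longrightarrow> ge (D f) (w f + w (D t))"
    and w_D_of_not_dvd: "\<not> 3 dvd w f \<Longrightarrow> D f \<noteq> 0 \<and> w (D f) = w f - 1 + w (D t)"
proof -
  show Dt: "D t \<noteq> 0"
  proof
    assume "D t = 0"
    then obtain g where "g \<in> K" "t = g ^ 3" using D_eq_0_imp_cube t by blast
    then have "w t = 3 * w g" using w_power[of g 3] t by auto
    then show False using t by presburger
  qed
  obtain a b c where abc: "a \<in> K" "b \<in> K" "c \<in> K" "f = a ^ 3 + b ^ 3 * t + c ^ 3 * t ^ 2"
    and Df: "D f = (b ^ 3 - c ^ 3 * t) * D t"
    using cube_decomposition[OF t(1) Dt f(1)] by blast
  define A B C where "A = a ^ 3" and "B = b ^ 3 * t" and "C = c ^ 3 * t ^ 2"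
  have in_K: "A \<in> K" "B \<in> K" "C \<in> K" "B + C \<in> K" using abc t by (auto simp: A_def B_def C_def)
  have pw: "b ^ 3 \<in> K" "c ^ 3 \<in> K" "t ^ 2 \<in> K" using abc t by auto
  have wA: "w A = 3 * w a" if "A \<noteq> 0" using that abc by (auto simp: A_def w_power)
  have wB: "w B = 3 * w b + 1" "w (b ^ 3) = w B - 1" if "B \<noteq> 0"
    using that abc t pw w_mult[of "b ^ 3" t] w_power[of b 3] by (auto simp: B_def)
  have wC: "w C = 3 * w c + 2" "w (c ^ 3 * t) = w C - 1" if "C \<noteq> 0"
    using that abc t pw w_mult[of "c ^ 3" "t ^ 2"] w_mult[of "c ^ 3" t] w_power[of c 3] w_power[of t 2]
    by (auto simp: C_def)
  have BC: "ge B (w (B + C)) \<and> ge C (w (B + C)) \<and> (B \<noteq> 0 \<and> w B = w (B + C) \<or> C \<noteq> 0 \<and> w C = w (B + C))"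
    if "B + C \<noteq> 0"
    using that in_K wB wC by (intro w_sum_distinct) (auto, presburger)
  have fABC: "f = A + (B + C)" using abc by (simp add: A_def B_def C_def)
  have "ge A (w f) \<and> ge (B + C) (w f) \<and> (A \<noteq> 0 \<and> w A = w f \<or> B + C \<noteq> 0 \<and> w (B + C) = w f)"
    unfolding fABC using f(2) in_K
  proof (intro w_sum_distinct)
    assume "A \<noteq> 0" "B + C \<noteq> 0"
    then consider "B \<noteq> 0" "w B = w (B + C)" | "C \<noteq> 0" "w C = w (B + C)" using BC by blast
    then show "w A \<noteq> w (B + C)"
    proof cases
      case 1
      then show ?thesis using wA[OF \<open>A \<noteq> 0\<close>] wB(1) by presburger
    next
      case 2
      then show ?thesis using wA[OF \<open>A \<noteq> 0\<close>] wC(1) by presburger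
    qed
  qed (auto simp: fABC)
  then have gef: "ge A (w f)" "ge B (w f)" "ge C (w f)"
    and eqf: "A \<noteq> 0 \<and> w A = w f \<or> B \<noteq> 0 \<and> w B = w f \<or> C \<noteq> 0 \<and> w C = w f"
  proof -
    assume *: "ge A (w f) \<and> ge (B + C) (w f) \<and> (A \<noteq> 0 \<and> w A = w f \<or> B + C \<noteq> 0 \<and> w (B + C) = w f)"
    then show "ge A (w f)" by simp
    show "A \<noteq> 0 \<and> w A = w f \<or> B \<noteq> 0 \<and> w B = w f \<or> C \<noteq> 0 \<and> w C = w f" using * BC by auto
    show "ge B (w f)" "ge C (w f)"
    proof (atomize (full), cases "B + C = 0")
      case True
      have "B = 0"
      proof (rule ccontr)
        assume "B \<noteq> 0"
        have CB: "C = - B" using True by (simp add: eq_neg_iff_add_eq_0 add.commute)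
        then have "C \<noteq> 0" "w C = w B" using \<open>B \<noteq> 0\<close> in_K by auto
        then show False using wB(1)[OF \<open>B \<noteq> 0\<close>] wC(1)[OF \<open>C \<noteq> 0\<close>] by presburger
      qed
      then show "ge B (w f) \<and> ge C (w f)" using True by (auto simp: ge_def)
    next
      case False
      then have "w f \<le> w (B + C)" using * by (auto simp: ge_def)
      then show "ge B (w f) \<and> ge C (w f)" using BC[OF False] by (auto intro: ge_mono)
    qed
  qed
  define E where "E = b ^ 3 - c ^ 3 * t"
  have E: "E \<in> K" "b ^ 3 \<in> K" "c ^ 3 * t \<in> K" using abc t by (auto simp: E_def intro!: subfield_diff[OF K])
  have DfE: "D f = E * D t" by (simp add: Df E_def)
  have b0: "b ^ 3 = 0 \<longleftrightarrow> B = 0" and c0: "c ^ 3 * t = 0 \<longleftrightarrow> C = 0" using t by (auto simp: B_def C_def)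
  have geb: "ge (b ^ 3) n" if "B \<noteq> 0 \<Longrightarrow> n \<le> w B - 1" for n using that wB b0 by (auto simp: ge_def)
  have gec: "ge (c ^ 3 * t) n" if "C \<noteq> 0 \<Longrightarrow> n \<le> w C - 1" for n using that wC c0 by (auto simp: ge_def)
  have gefB: "B \<noteq> 0 \<Longrightarrow> w f \<le> w B" and gefC: "C \<noteq> 0 \<Longrightarrow> w f \<le> w C" using gef by (auto simp: ge_def)
  have geDt: "ge (D t) (w (D t))" by (simp add: ge_def)
  have DtK: "D t \<in> K" using D_in t by blast
  have "ge E (w f - 1)" unfolding E_def using E gefB gefC by (intro ge_diff geb gec) auto
  then show "ge (D f) (w f - 1 + w (D t))" unfolding DfE using E DtK geDt by (intro ge_mult)
  show "ge (D f) (w f + w (D t))" if "3 dvd w f"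
  proof -
    have "ge E (w f)" unfolding E_def
    proof (intro ge_diff geb gec)
      show "w f \<le> w B - 1" if "B \<noteq> 0" using gefB[OF that] wB(1)[OF that] \<open>3 dvd w f\<close> by presburger
      show "w f \<le> w C - 1" if "C \<noteq> 0" using gefC[OF that] wC(1)[OF that] \<open>3 dvd w f\<close> by presburger
    qed (use E in auto)
    then show ?thesis unfolding DfE using E DtK geDt by (intro ge_mult)
  qed
  show "D f \<noteq> 0 \<and> w (D f) = w f - 1 + w (D t)" if n3: "\<not> 3 dvd w f"
  proof -
    have "E \<noteq> 0 \<and> w E = w f - 1"
    proof (cases "B \<noteq> 0 \<and> w B = w f")
      case True
      have "ge (c ^ 3 * t) (w (b ^ 3) + 1)"
      proof (rule gec)
        assume "C \<noteq> 0"
        have "B \<noteq> 0" "w B = w f" using True by auto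
        then show "w (b ^ 3) + 1 \<le> w C - 1"
          using wB[OF \<open>B \<noteq> 0\<close>] wC(1)[OF \<open>C \<noteq> 0\<close>] gefC[OF \<open>C \<noteq> 0\<close>] by presburger
      qed
      then have "ge (- (c ^ 3 * t)) (w (b ^ 3) + 1)" using ge_uminus E by blast
      then show ?thesis
        using w_add_strict[of "b ^ 3" "- (c ^ 3 * t)"] True wB(2) b0 E by (auto simp: E_def)
    next
      case False
      have "\<not> (A \<noteq> 0 \<and> w A = w f)" using wA n3 by auto
      then have C: "C \<noteq> 0" "w C = w f" using eqf False by blast+
      have "ge (b ^ 3) (w (- (c ^ 3 * t)) + 1)"
      proof (rule geb)
        assume "B \<noteq> 0"
        have "w (- (c ^ 3 * t)) = w C - 1" using wC(2)[OF C(1)] E by simp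
        then show "w (- (c ^ 3 * t)) + 1 \<le> w B - 1"
          using wB(1)[OF \<open>B \<noteq> 0\<close>] wC(1)[OF C(1)] C(2) False gefB[OF \<open>B \<noteq> 0\<close>] \<open>B \<noteq> 0\<close> by presburger
      qed
      then have "- (c ^ 3 * t) + b ^ 3 \<noteq> 0 \<and> w (- (c ^ 3 * t) + b ^ 3) = w (- (c ^ 3 * t))"
        using w_add_strict[of "- (c ^ 3 * t)" "b ^ 3"] C c0 E by auto
      then show ?thesis using C wC(2) E by (auto simp: E_def)
    qed
    then show ?thesis unfolding DfE using w_mult[of E "D t"] E DtK Dt by auto
  qed
qed

end

subsection \<open>Embeddings of the function field into Laurent series\<close>

definition norm_fract :: "'a::field poly \<Rightarrow> 'a poly fract \<times> 'a poly fract \<Rightarrow> 'a poly fract" where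
  "norm_fract F p = fst p ^ 2 - snd p ^ 2 * Fract F 1"

definition conj_fract :: "'a::field poly fract \<times> 'a poly fract \<Rightarrow> 'a poly fract \<times> 'a poly fract" where
  "conj_fract p = (fst p, - snd p)"

definition mult_ff :: "'a::field poly \<Rightarrow> 'a poly fract \<times> 'a poly fract \<Rightarrow> 'a poly fract \<times> 'a poly fract \<Rightarrow> 'a poly fract \<times> 'a poly fract" where
  "mult_ff F p q = (fst p * fst q + snd p * snd q * Fract F 1, fst p * snd q + snd p * fst q)"

lemma places_iff:
  "v \<in> places F \<longleftrightarrow> v 0 = 0 \<and> (\<forall>f g. f \<noteq> 0 \<longrightarrow> g \<noteq> 0 \<longrightarrow> v (mult_ff F f g) = v f + v g) \<and>
     (\<forall>f g. f \<noteq> 0 \<longrightarrow> g \<noteq> 0 \<longrightarrow> f + g \<noteq> 0 \<longrightarrow> min (v f) (v g) \<le> v (f + g)) \<and>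
     (\<forall>c. c \<noteq> 0 \<longrightarrow> v (Fract [:c:] 1, 0) = 0) \<and> (\<exists>t. t \<noteq> 0 \<and> v t = 1)"
  unfolding places_def function_field_def Let_def
  by (simp add: mult_ff_def plus_prod_def case_prod_beta zero_prod_def[symmetric] Ball_def Bex_def)

abbreviation ev :: "'a::field fls \<Rightarrow> 'a poly \<Rightarrow> 'a fls" where
  "ev \<equiv> valn.eval fls_const"

interpretation fls_val: valn UNIV fls_const "fls_subdegree :: 'a::field fls \<Rightarrow> int"
  by (rule valn_fls_subdegree)

lemma ev_comm_ring_hom: "comm_ring_hom (ev \<xi>)"
  by unfold_locales (simp_all add: fls_val.eval_add fls_val.eval_mult)

section \<open>Local parametrisations of the geometric curve\<close>

locale hyperelliptic =
  fixes F :: "'a::alg_closed_field poly"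
  assumes char3: "CHAR('a) = 3" and deg_F: "Polynomial.degree F \<in> {5, 6}" and sf: "rsquarefree F"
begin

lemma three_eq_0: "(3 :: 'a) = 0" and two_eq: "(2 :: 'a) = - 1" and two_neq_0: "(2 :: 'a) \<noteq> 0"
proof -
  have "of_nat 3 = (0 :: 'a)" by (metis char3 of_nat_CHAR)
  then show *: "(3 :: 'a) = 0" by simp
  have "(2 :: 'a) = 3 - 1" by simp
  then show "(2 :: 'a) = - 1" using * by simp
  then show "(2 :: 'a) \<noteq> 0" by (simp only: neg_equal_0_iff_equal one_neq_zero not_False_eq_True)
qed

lemma F_neq_0 [simp]: "F \<noteq> 0"
  using deg_F by auto

lemma order_F: "poly F r = 0 \<Longrightarrow> Polynomial.order r F = 1"
  by (metis F_neq_0 One_nat_def order_root rsquarefree_def sf)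

text \<open>Points of the projective line: \<open>Some r\<close> is \<open>x = r\<close> and \<open>None\<close> is infinity.\<close>

definition ram :: "'a option \<Rightarrow> nat" where
  "ram b = (case b of Some r \<Rightarrow> if poly F r = 0 then 2 else 1 | None \<Rightarrow> if Polynomial.degree F = 5 then 2 else 1)"

text \<open>The coordinate x in terms of a local parameter z of the curve, with the ramification
  index as exponent. For this exponent F(x) has even order, so its square root y exists as a Laurent
  series in z.\<close>

definition \<xi> :: "'a option \<Rightarrow> 'a fls" where
  "\<xi> b = (case b of Some r \<Rightarrow> fls_const r + fls_X ^ ram b | None \<Rightarrow> fls_X_inv ^ ram b)"

definition ord_pt :: "'a option \<Rightarrow> 'a poly \<Rightarrow> int" where
  "ord_pt b p = (case b of Some r \<Rightarrow> int (Polynomial.order r p) | None \<Rightarrow> - int (Polynomial.degree p))"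

lemma ram_cases: "ram b = 1 \<or> ram b = 2"
  by (auto simp: ram_def split: option.splits)

lemma ev_\<xi>:
  assumes "p \<noteq> 0"
  shows "ev (\<xi> b) p \<noteq> 0 \<and> fls_subdegree (ev (\<xi> b) p) = int (ram b) * ord_pt b p"
proof (cases b)
  case (Some r)
  have "\<xi> b - fls_const r = fls_X ^ ram b" by (simp add: \<xi>_def Some)
  moreover have "\<xi> b \<noteq> fls_const r" by (simp add: \<xi>_def Some)
  moreover have "fls_subdegree (fls_X ^ ram b :: 'a fls) = int (ram b)" by (simp add: fls_subdegree_pow)
  moreover have "ram b > 0" using ram_cases[of b] by auto
  ultimately show ?thesis
    using fls_val.eval_finite_point[of "\<xi> b" r p] assms Some
    by (auto simp: ord_pt_def)
next
  case None
  have "\<xi> b = fls_X_inv ^ ram b" by (simp add: \<xi>_def None)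
  moreover have "fls_subdegree (fls_X_inv ^ ram b :: 'a fls) = - int (ram b)" by (simp add: fls_subdegree_pow)
  moreover have "ram b > 0" using ram_cases[of b] by auto
  ultimately show ?thesis
    using fls_val.eval_infinite_point[of "\<xi> b" p] assms None
    by (auto simp: ord_pt_def)
qed

definition \<phi> :: "'a option \<Rightarrow> 'a poly fract \<Rightarrow> 'a fls" where
  "\<phi> b = fract_lift (ev (\<xi> b))"

lemma \<phi>_hom: "comm_ring_hom (\<phi> b)"
  unfolding \<phi>_def using ev_\<xi> by (intro fract_lift_hom ev_comm_ring_hom) blast

lemma \<phi>_eq_0 [simp]: "\<phi> b q = 0 \<longleftrightarrow> q = 0"
proof -
  interpret comm_ring_hom "\<phi> b" by (rule \<phi>_hom)
  show ?thesis using comm_ring_hom_field_inj[OF \<phi>_hom] by auto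
qed

lemma \<phi>_0 [simp]: "\<phi> b 0 = 0" by simp

lemma \<phi>_1 [simp]: "\<phi> b 1 = 1"
proof -
  interpret comm_ring_hom "\<phi> b" by (rule \<phi>_hom)
  show ?thesis by (rule hom_one)
qed

lemma \<phi>_Fract: "s \<noteq> 0 \<Longrightarrow> \<phi> b (Fract p s) = ev (\<xi> b) p / ev (\<xi> b) s"
  unfolding \<phi>_def using ev_\<xi> by (intro fract_lift_Fract ev_comm_ring_hom) blast

lemma \<phi>_poly: "\<phi> b (Fract p 1) = ev (\<xi> b) p"
  by (simp add: \<phi>_Fract)

lemma \<phi>_subdegree_dvd: "int (ram b) dvd fls_subdegree (\<phi> b q)"
proof -
  obtain p s where q: "q = Fract p s" "s \<noteq> 0" by (meson Fract_cases)
  show ?thesis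
  proof (cases "p = 0")
    case True
    then have "q = 0" using q by (simp add: fract_collapse)
    interpret comm_ring_hom "\<phi> b" by (rule \<phi>_hom)
    show ?thesis using \<open>q = 0\<close> by simp
  next
    case False
    then show ?thesis using q ev_\<xi>[of p b] ev_\<xi>[of s b] fls_val.w_divide[of "ev (\<xi> b) p" "ev (\<xi> b) s"]
      by (simp add: \<phi>_Fract)
  qed
qed

text \<open>Over a root r of F, which is simple, every rational function has even order in the local
  parameter. A square thus has order divisible by 4, whereas F has order 2. The norm form is
  therefore anisotropic, which makes the pairs a field.\<close>

lemma not_square: "p \<noteq> 0 \<Longrightarrow> norm_fract F p \<noteq> 0"
proof
  assume p: "p \<noteq> 0" and "norm_fract F p = 0"
  then have eq: "fst p ^ 2 = snd p ^ 2 * Fract F 1" by (simp add: norm_fract_def)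
  obtain r where r: "poly F r = 0" using alg_closed_imp_poly_has_root[of F] deg_F by auto
  let ?b = "Some r"
  interpret comm_ring_hom "\<phi> ?b" by (rule \<phi>_hom)
  have FF: "Fract F 1 \<noteq> 0" by (simp add: Zero_fract_def eq_fract)
  have 0: "fst p \<noteq> 0" "snd p \<noteq> 0" using p eq FF by (auto simp: prod_eq_iff)
  have ram: "ram ?b = 2" using r by (simp add: ram_def)
  have "fls_subdegree (\<phi> ?b (fst p ^ 2)) = 2 * fls_subdegree (\<phi> ?b (fst p))"
    using 0 by (simp add: hom_power fls_subdegree_pow)
  moreover have "fls_subdegree (\<phi> ?b (snd p ^ 2 * Fract F 1)) = 2 * fls_subdegree (\<phi> ?b (snd p)) + 2"
    using 0 ev_\<xi>[of F ?b] order_F[OF r] ram by (simp add: hom_power hom_mult fls_subdegree_pow \<phi>_poly ord_pt_def)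
  moreover obtain i j where "fls_subdegree (\<phi> ?b (fst p)) = 2 * i" "fls_subdegree (\<phi> ?b (snd p)) = 2 * j"
    using \<phi>_subdegree_dvd[of ?b] ram by (metis dvdE of_nat_numeral)
  ultimately have "2 * (2 * i) = 2 * (2 * j) + 2" using eq by simp
  then show False by presburger
qed

definition emb :: "'a option \<Rightarrow> 'a fls \<Rightarrow> 'a poly fract \<times> 'a poly fract \<Rightarrow> 'a fls" where
  "emb b S p = \<phi> b (fst p) + \<phi> b (snd p) * S"

definition roots_F :: "'a option \<Rightarrow> 'a fls set" where
  "roots_F b = {S. S ^ 2 = ev (\<xi> b) F}"

lemma even_subdegree_F: "even (fls_subdegree (ev (\<xi> b) F))"
  using ev_\<xi>[of F b] order_F deg_F order_root[of F]
  by (auto simp: ram_def ord_pt_def split: option.splits)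

lemma roots_F_nonempty: "roots_F b \<noteq> {}"
  using fls_sqrt_exists[OF even_subdegree_F two_neq_0, of b] by (auto simp: roots_F_def)

lemma roots_F_uminus: "S \<in> roots_F b \<Longrightarrow> - S \<in> roots_F b"
  by (simp add: roots_F_def)

lemma roots_F_neq_0: "S \<in> roots_F b \<Longrightarrow> S \<noteq> 0"
  using ev_\<xi>[of F b] by (auto simp: roots_F_def)

lemma roots_F_subdegree: "S \<in> roots_F b \<Longrightarrow> 2 * fls_subdegree S = int (ram b) * ord_pt b F"
  using ev_\<xi>[of F b] roots_F_neq_0[of S b] fls_subdegree_pow[of S 2] by (auto simp: roots_F_def)

lemma emb_add: "emb b S (p + q) = emb b S p + emb b S q"
proof -
  interpret comm_ring_hom "\<phi> b" by (rule \<phi>_hom)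
  show ?thesis by (simp add: emb_def hom_add algebra_simps)
qed

lemma emb_mult: "S \<in> roots_F b \<Longrightarrow> emb b S (mult_ff F p q) = emb b S p * emb b S q"
proof -
  assume S: "S \<in> roots_F b"
  interpret comm_ring_hom "\<phi> b" by (rule \<phi>_hom)
  have "\<phi> b (Fract F 1) = S * S" using S by (simp add: roots_F_def \<phi>_poly power2_eq_square)
  then show ?thesis by (simp add: emb_def mult_ff_def hom_distribs algebra_simps)
qed

lemma emb_0 [simp]: "emb b S 0 = 0"
  using emb_add[of b S 0 0] by (simp only: add_0_left add_cancel_right_right)

lemma emb_conj: "emb b S (conj_fract p) = emb b (- S) p"
proof -
  interpret comm_ring_hom "\<phi> b" by (rule \<phi>_hom)
  show ?thesis by (simp add: emb_def conj_fract_def hom_uminus)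
qed

lemma emb_norm: "S \<in> roots_F b \<Longrightarrow> emb b S p * emb b (- S) p = \<phi> b (norm_fract F p)"
proof -
  assume S: "S \<in> roots_F b"
  interpret comm_ring_hom "\<phi> b" by (rule \<phi>_hom)
  have "\<phi> b (Fract F 1) = S * S" using S by (simp add: roots_F_def \<phi>_poly power2_eq_square)
  then show ?thesis by (simp add: emb_def norm_fract_def hom_distribs power2_eq_square algebra_simps)
qed

lemma emb_eq_0: "S \<in> roots_F b \<Longrightarrow> emb b S p = 0 \<longleftrightarrow> p = 0"
  by (metis emb_0 emb_norm mult_zero_left not_square \<phi>_eq_0)

lemma emb_const: "emb b S (Fract [:c:] 1, 0) = fls_const c"
proof -
  interpret comm_ring_hom "\<phi> b" by (rule \<phi>_hom)
  show ?thesis by (simp add: emb_def \<phi>_poly)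
qed

lemma inj_emb: "S \<in> roots_F b \<Longrightarrow> inj (emb b S)"
proof (rule injI)
  fix p q assume "S \<in> roots_F b" "emb b S p = emb b S q"
  moreover have "emb b S p = emb b S (p - q) + emb b S q" by (simp flip: emb_add)
  ultimately show "p = q" using emb_eq_0[of S b "p - q"] by simp
qed

definition place_of :: "'a option \<Rightarrow> 'a fls \<Rightarrow> 'a poly fract \<times> 'a poly fract \<Rightarrow> int" where
  "place_of b S p = fls_subdegree (emb b S p)"

text \<open>The uniformizers are y over a finite branch point, x - r over any other finite point,
  1/x at an unramified infinity, and y/x^3 at a ramified one, where y has order -5 and x order
  -2.\<close>

lemma place_of_uniformizer:
  assumes S: "S \<in> roots_F b"
  obtains t where "t \<noteq> 0" "place_of b S t = 1"
proof -
  interpret comm_ring_hom "\<phi> b" by (rule \<phi>_hom)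
  let ?X = "[:0, 1:] :: 'a poly"
  have X: "Fract ?X 1 \<noteq> 0" "Fract 1 ?X \<noteq> 0" "Fract 1 (?X ^ 3) \<noteq> 0" by (simp_all add: Zero_fract_def eq_fract)
  note pl = place_of_def emb_def
  have ne: "t \<noteq> 0" if "place_of b S t = 1" for t
    using that by (auto simp: place_of_def)
  show ?thesis
  proof (cases b)
    case (Some r)
    show ?thesis
    proof (cases "poly F r = 0")
      case True
      have "place_of b S (0, 1) = 1"
        using roots_F_subdegree[OF S] order_F[OF True] True Some by (simp add: pl ord_pt_def ram_def)
      then show ?thesis using that ne by blast
    next
      case False
      then have "ram (Some r) = 1" by (simp add: ram_def)
      then have "ev (\<xi> b) [:- r, 1:] = fls_X" by (simp add: \<xi>_def Some)
      then have "place_of b S (Fract [:- r, 1:] 1, 0) = 1" by (simp add: pl \<phi>_poly)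
      then show ?thesis using that ne by blast
    qed
  next
    case None
    have \<xi>: "ev (\<xi> b) ?X = fls_X_inv ^ ram b" by (simp add: \<xi>_def None)
    show ?thesis
    proof (cases "ram b = 1")
      case True
      then have "place_of b S (Fract 1 ?X, 0) = 1" using \<xi> by (simp add: pl \<phi>_Fract fls_inverse_X_inv divide_inverse)
      then show ?thesis using that ne by blast
    next
      case False
      then have r: "ram b = 2" using ram_cases by blast
      then have "Polynomial.degree F = 5" using None by (auto simp: ram_def split: if_splits)
      then have "fls_subdegree S = - 5" using roots_F_subdegree[OF S] r[unfolded None] None by (simp add: ord_pt_def)
      moreover have "\<phi> b (Fract 1 (?X ^ 3)) = fls_X ^ 6"
        using \<xi> r by (simp add: \<phi>_Fract fls_val.eval_power power_mult[symmetric] fls_inverse_X_inv divide_inverse flip: power_inverse)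
      ultimately have "place_of b S (0, Fract 1 (?X ^ 3)) = 1"
        using roots_F_neq_0[OF S] by (simp add: pl fls_subdegree_pow)
      then show ?thesis using that ne by blast
    qed
  qed
qed

lemma place_of_in_places:
  assumes S: "S \<in> roots_F b"
  shows "place_of b S \<in> places F"
  unfolding places_iff
proof (intro conjI allI impI)
  show "place_of b S 0 = 0" by (simp add: place_of_def)
  show "place_of b S (mult_ff F f g) = place_of b S f + place_of b S g" if "f \<noteq> 0" "g \<noteq> 0" for f g
    using that by (simp add: place_of_def emb_mult[OF S] emb_eq_0[OF S])
  show "min (place_of b S f) (place_of b S g) \<le> place_of b S (f + g)" if "f + g \<noteq> 0" for f g
    using fls_plus_subdegree[of "emb b S f" "emb b S g"] emb_eq_0[OF S, of "f + g"] that
    by (simp add: place_of_def emb_add)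
  show "place_of b S (Fract [:c:] 1, 0) = 0" for c by (simp add: place_of_def emb_const)
  show "\<exists>t. t \<noteq> 0 \<and> place_of b S t = 1" using place_of_uniformizer[OF S] by metis
qed

end

section \<open>Formal derivatives and cubes in characteristic 3\<close>

lemma fls_deriv_deriv3:
  assumes "CHAR('a::field) = 3"
  shows "deriv3 (fls_deriv :: 'a fls \<Rightarrow> 'a fls)"
proof
  have three: "of_nat 3 = (0 :: 'a)" by (metis assms of_nat_CHAR)
  then show "(3 :: 'a fls) = 0"
    by (metis fls_const_0 fls_const_numeral of_nat_numeral fls_of_nat)
  fix f g :: "'a fls"
  show "fls_deriv (f + g) = fls_deriv f + fls_deriv g" by simp
  show "fls_deriv (f * g) = fls_deriv f * g + f * fls_deriv g" by simp
  show "fls_deriv (fls_deriv (fls_deriv f)) = 0"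
  proof (rule fls_eqI)
    fix n :: int
    \<comment> \<open>A third derivative multiplies each coefficient by three consecutive
      integers.\<close>
    have "3 dvd n + 1 \<or> 3 dvd n + 1 + 1 \<or> 3 dvd n + 1 + 1 + 1" by presburger
    then have "3 dvd (n + 1) * (n + 1 + 1) * (n + 1 + 1 + 1)" by (auto intro: dvd_mult dvd_mult2)
    then obtain m where m: "(n + 1) * (n + 1 + 1) * (n + 1 + 1 + 1) = 3 * m" by (elim dvdE)
    have "fls_nth (fls_deriv (fls_deriv (fls_deriv f))) n = of_int ((n + 1) * (n + 1 + 1) * (n + 1 + 1 + 1)) * fls_nth f (n + 1 + 1 + 1)"
      by (simp only: fls_deriv_nth of_int_mult mult.assoc)
    also have "\<dots> = 0" using three unfolding m by simp
    finally show "fls_nth (fls_deriv (fls_deriv (fls_deriv f))) n = fls_nth 0 n" by simp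
  qed
qed

text \<open>Over a finite field, the product of all X - a, plus 1, has positive degree and no
  root.\<close>

lemma infinite_UNIV_alg_closed: "infinite (UNIV :: 'a::alg_closed_field set)"
proof
  assume fin: "finite (UNIV :: 'a set)"
  define p where "p = (\<Prod>a\<in>(UNIV :: 'a set). [:- a, 1:])"
  have pr: "poly p r = 0" for r unfolding p_def poly_prod using fin by (intro prod_zero) auto
  have "p \<noteq> 0" unfolding p_def using fin by simp
  moreover have "Polynomial.degree p \<noteq> 0"
  proof
    assume "Polynomial.degree p = 0"
    then obtain c where "p = [:c:]" by (meson degree_eq_zeroE)
    then show False using pr[of 0] \<open>p \<noteq> 0\<close> by simp
  qed
  ultimately have "Polynomial.degree (p + 1) > 0" by (subst degree_add_eq_left) auto
  then obtain r where "poly (p + 1) r = 0" using alg_closed_imp_poly_has_root by blast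
  then show False using pr[of r] by simp
qed

text \<open>Only exponents divisible by 3 survive, the coefficients have cube roots, and cubing is
  additive.\<close>

lemma poly_cube_of_pderiv_0:
  fixes p :: "'a::alg_closed_field poly"
  assumes "CHAR('a) = 3" "pderiv p = 0"
  obtains q where "p = q ^ 3"
proof -
  have cube_add: "(a + b) ^ 3 = a ^ 3 + b ^ 3" for a b :: "'a poly"
  proof -
    have "of_nat 3 = (0 :: 'a)" by (metis assms(1) of_nat_CHAR)
    then have "[:of_nat 3 :: 'a:] = 0" by simp
    then have 3: "(3 :: 'a poly) = 0" by (simp add: numeral_poly)
    have "(a + b) ^ 3 = a ^ 3 + b ^ 3 + 3 * (a ^ 2 * b + a * b ^ 2)"
      by (simp add: power3_eq_cube power2_eq_square algebra_simps)
    then show ?thesis using 3 by simp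
  qed
  have cube_sum: "(\<Sum>i\<in>A. f i) ^ 3 = (\<Sum>i\<in>A. f i ^ 3)" for f :: "nat \<Rightarrow> 'a poly" and A
    by (induction A rule: infinite_finite_induct) (simp_all add: cube_add)
  have zero: "Polynomial.coeff p n = 0" if nd: "\<not> 3 dvd n" for n
  proof -
    obtain m where m: "n = Suc m" using nd by (cases n) auto
    have "of_nat n * Polynomial.coeff p n = 0"
      using arg_cong[OF assms(2), of "\<lambda>q. Polynomial.coeff q m"] by (simp add: coeff_pderiv m)
    moreover have "of_nat n \<noteq> (0 :: 'a)" using nd assms(1) by (simp add: of_nat_eq_0_iff_char_dvd)
    ultimately show ?thesis by simp
  qed
  define c where "c i = (SOME x. x ^ 3 = Polynomial.coeff p (3 * i))" for i
  have c: "c i ^ 3 = Polynomial.coeff p (3 * i)" for i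
    unfolding c_def by (rule someI_ex) (rule nth_root_exists, simp)
  define q where "q = (\<Sum>i\<le>Polynomial.degree p. Polynomial.monom (c i) i)"
  have "q ^ 3 = (\<Sum>i\<le>Polynomial.degree p. Polynomial.monom (Polynomial.coeff p (3 * i)) (3 * i))"
    by (simp add: q_def cube_sum monom_power c mult.commute)
  also have "\<dots> = p"
  proof (rule poly_eqI)
    fix n
    show "Polynomial.coeff (\<Sum>i\<le>Polynomial.degree p. Polynomial.monom (Polynomial.coeff p (3 * i)) (3 * i)) n = Polynomial.coeff p n"
    proof (cases "3 dvd n")
      case True
      then obtain m where m: "n = 3 * m" by (elim dvdE)
      have "Polynomial.coeff (\<Sum>i\<le>Polynomial.degree p. Polynomial.monom (Polynomial.coeff p (3 * i)) (3 * i)) n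
          = (\<Sum>i\<le>Polynomial.degree p. if i = m then Polynomial.coeff p n else 0)"
        by (auto simp: coeff_sum m intro!: sum.cong)
      also have "\<dots> = Polynomial.coeff p n" by (auto simp: m intro!: coeff_eq_0)
      finally show ?thesis .
    next
      case False
      then show ?thesis by (auto simp: coeff_sum zero[OF False] intro!: sum.neutral)
    qed
  qed
  finally show ?thesis using that by metis
qed

section \<open>The function field inside the Laurent series at an unramified point\<close>

context hyperelliptic
begin

text \<open>At a finite point that is not a branch point, x is r + z, so the formal derivative of
  Laurent series restricts to d/dx on the function field.\<close>

definition base :: "'a option" where
  "base = Some (SOME r. poly F r \<noteq> 0)"

definition y :: "'a fls" where "y = (SOME S. S \<in> roots_F base)"

definition E :: "'a poly fract \<times> 'a poly fract \<Rightarrow> 'a fls" where "E = emb base y"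

definition K :: "'a fls set" where "K = range E"

abbreviation x :: "'a fls" where "x \<equiv> \<xi> base"

abbreviation D :: "'a fls \<Rightarrow> 'a fls" where "D \<equiv> fls_deriv"

abbreviation \<iota> :: "'a poly fract \<Rightarrow> 'a fls" where "\<iota> \<equiv> \<phi> base"

lemma ram_base: "ram base = 1"
proof -
  have "finite {r. poly F r = 0}" by (simp add: poly_roots_finite)
  then obtain r where "poly F r \<noteq> 0"
    using ex_new_if_finite[OF infinite_UNIV_alg_closed] by blast
  then have "poly F (SOME r. poly F r \<noteq> 0) \<noteq> 0" by (rule someI)
  then show ?thesis by (simp add: base_def ram_def)
qed

lemma y_in: "y \<in> roots_F base"
  unfolding y_def using roots_F_nonempty by (simp add: some_in_eq)

lemma E_add: "E (p + q) = E p + E q"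
  and E_mult: "E (mult_ff F p q) = E p * E q"
  and E_eq_0 [simp]: "E p = 0 \<longleftrightarrow> p = 0"
  and E_const: "E (Fract [:c:] 1, 0) = fls_const c"
  and inj_E: "inj E"
  and E_norm: "E p * E (conj_fract p) = \<iota> (norm_fract F p)"
  unfolding E_def using emb_add emb_mult emb_eq_0 emb_const inj_emb emb_norm emb_conj y_in by metis+

lemma E_def2: "E p = \<iota> (fst p) + \<iota> (snd p) * y"
  by (simp add: E_def emb_def)

lemma y_square: "y ^ 2 = ev x F"
  using y_in by (simp add: roots_F_def)

lemma \<iota>_E: "\<iota> q = E (q, 0)"
  by (simp add: E_def2)

lemma norm_neq_0: "p \<noteq> 0 \<Longrightarrow> norm_fract F p \<noteq> 0"
  by (rule not_square)

lemma Fract_F_neq_0 [simp]: "Fract F 1 \<noteq> 0"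
  by (simp add: Zero_fract_def eq_fract)

lemma K_subfield: "is_subfield K"
proof -
  interpret \<iota>: comm_ring_hom \<iota> by (rule \<phi>_hom)
  have inv: "inverse (E p) \<in> K" for p
  proof (cases "p = 0")
    case True
    have E0: "E 0 = 0" by simp
    have "inverse (E p) = E 0" by (simp only: True E0 inverse_zero)
    then show ?thesis by (simp add: K_def)
  next
    case False
    define n where "n = norm_fract F p"
    have n: "n \<noteq> 0" using norm_neq_0[OF False] by (simp add: n_def)
    \<comment> \<open>The inverse is the conjugate divided by the norm.\<close>
    have "E p * (E (conj_fract p) * \<iota> (inverse n)) = \<iota> (n * inverse n)"
      using E_norm[of p] by (simp add: n_def \<iota>.hom_mult mult.assoc[symmetric])
    also have "\<dots> = 1" using n by simp
    finally have "inverse (E p) = E (conj_fract p) * \<iota> (inverse n)" by (rule inverse_unique)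
    also have "\<dots> \<in> K" unfolding K_def \<iota>_E by (metis E_mult rangeI)
    finally show ?thesis .
  qed
  have "E 0 = 0" by simp
  moreover have "E (1, 0) = 1" by (simp flip: \<iota>_E)
  moreover have "- E p = E (- p)" for p by (intro minus_unique) (simp flip: E_add)
  ultimately show ?thesis
    unfolding is_subfield_def K_def using inv E_add E_mult
    by (auto simp: K_def) (metis rangeI)+
qed

lemma E_in_K [simp]: "E p \<in> K" by (simp add: K_def)

lemma \<iota>_in_K [simp]: "\<iota> q \<in> K" by (simp add: \<iota>_E)

lemma y_in_K [simp]: "y \<in> K"
proof -
  have "y = E (0, 1)" by (simp add: E_def2)
  then show ?thesis by simp
qed

lemma fls_const_in_K [simp]: "fls_const c \<in> K"
  by (metis E_const E_in_K)

lemma D_x: "D x = 1"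
  using ram_base by (simp add: \<xi>_def base_def)

lemma ev_\<iota>: "ev x p = \<iota> (Fract p 1)"
  by (simp add: \<phi>_poly)

lemma x_\<iota>: "x = \<iota> (Fract [:0, 1:] 1)"
  by (simp flip: ev_\<iota>)

lemma x_in_K [simp]: "x \<in> K"
  by (subst x_\<iota>) (rule \<iota>_in_K)

lemma D_ev: "D (ev x p) = ev x (pderiv p)"
  by (induction p) (simp_all add: pderiv_pCons D_x fls_val.eval_add)

sublocale deriv3 D
  by (rule fls_deriv_deriv3[OF char3])

lemma D_\<iota>: "\<exists>q'. D (\<iota> q) = \<iota> q'"
proof -
  obtain p s where q: "q = Fract p s" "s \<noteq> 0" by (meson Fract_cases)
  have s: "ev x s \<noteq> 0" using ev_\<xi>[OF q(2)] by blast
  have "D (\<iota> q) = (ev x (pderiv p) * ev x s - ev x p * ev x (pderiv s)) / ev x s ^ 2"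
    using s unfolding q(1) \<phi>_Fract[OF q(2)] by (subst D_divide) (simp_all add: D_ev)
  also have "\<dots> = ev x (pderiv p * s - p * pderiv s) / ev x (s ^ 2)"
  proof -
    interpret evx: comm_ring_hom "ev x" by (rule ev_comm_ring_hom)
    show ?thesis by (simp add: evx.hom_mult evx.hom_minus evx.hom_power)
  qed
  also have "\<dots> = \<iota> (Fract (pderiv p * s - p * pderiv s) (s ^ 2))"
    using q(2) by (simp add: \<phi>_Fract)
  finally show ?thesis by blast
qed

text \<open>Since \<open>D (y\<^sup>3) = 0\<close> and \<open>y = y\<^sup>3 / F\<close>, derivatives of \<open>\<alpha> + \<beta> y\<close> are computed
  from \<open>\<alpha> + (\<beta> / F) y\<^sup>3\<close> coefficientwise.\<close>

lemma E_cube_form: "E p = \<iota> (fst p) + \<iota> (snd p / Fract F 1) * y ^ 3"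
proof -
  interpret \<iota>: comm_ring_hom \<iota> by (rule \<phi>_hom)
  have F: "\<iota> (Fract F 1) = y ^ 2" by (simp add: y_square ev_\<iota>)
  have "y \<noteq> 0" using roots_F_neq_0[OF y_in] .
  then show ?thesis
    by (simp add: E_def2 comm_ring_hom_divide[OF \<phi>_hom] F power3_eq_cube power2_eq_square)
qed

lemma cube_form_in_K: "\<iota> a + \<iota> b * y ^ 3 \<in> K"
  using K_subfield by (intro subfield_add subfield_mult subfield_power) auto

lemma D_in_K: "f \<in> K \<Longrightarrow> D f \<in> K"
proof -
  assume "f \<in> K"
  then obtain p where p: "f = E p" by (auto simp: K_def)
  obtain a b where "D (\<iota> (fst p)) = \<iota> a" "D (\<iota> (snd p / Fract F 1)) = \<iota> b" using D_\<iota> by meson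
  then have "D f = \<iota> a + \<iota> b * y ^ 3"
    unfolding p by (subst E_cube_form) (simp only: D_add D_mult D_cube mult_zero_right add_0_right)
  then show ?thesis by (simp only: cube_form_in_K)
qed

text \<open>Writing p/s as p s^2 / s^3 reduces the claim to the polynomial p s^2, since cubes behave
  as constants.\<close>

lemma \<iota>_cube: "D (\<iota> q) = 0 \<Longrightarrow> \<exists>u. q = u ^ 3"
proof -
  assume D0: "D (\<iota> q) = 0"
  obtain p s where q: "q = Fract p s" "s \<noteq> 0" by (meson Fract_cases)
  have s: "ev x s \<noteq> 0" using ev_\<xi>[OF q(2)] by blast
  have "\<iota> q * ev x s ^ 3 = ev x (p * s ^ 2)"
    using s by (simp add: q \<phi>_Fract fls_val.eval_mult fls_val.eval_power power3_eq_cube power2_eq_square)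
  then have "ev x (pderiv (p * s ^ 2)) = D (\<iota> q * ev x s ^ 3)" by (simp only: D_ev)
  also have "\<dots> = 0" by (simp only: D_mult D_cube D0 mult_zero_left mult_zero_right add_0_left)
  finally have "pderiv (p * s ^ 2) = 0" using ev_\<xi> by blast
  then obtain u where u: "p * s ^ 2 = u ^ 3" using poly_cube_of_pderiv_0[OF char3] by blast
  have "q = Fract (p * s ^ 2) (s ^ 3)"
    using q by (simp add: eq_fract power3_eq_cube power2_eq_square)
  also have "\<dots> = Fract u s ^ 3" unfolding u by (simp add: power3_eq_cube)
  finally show ?thesis by blast
qed

lemma cube_add_fls: "(a + b) ^ 3 = a ^ 3 + b ^ 3" for a b :: "'a fls"
proof -
  have "(a + b) ^ 3 = a ^ 3 + b ^ 3 + 3 * (a ^ 2 * b + a * b ^ 2)"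
    by (simp add: power3_eq_cube power2_eq_square algebra_simps)
  then show ?thesis using three by simp
qed

text \<open>In the basis 1, y^3 over the rational functions differentiation acts on the two
  coordinates separately, so each has derivative 0 and is a cube of a rational function.\<close>

lemma D_eq_0_cube: "f \<in> K \<Longrightarrow> D f = 0 \<Longrightarrow> \<exists>g\<in>K. f = g ^ 3"
proof -
  assume "f \<in> K" and D0: "D f = 0"
  then obtain p where p: "f = E p" by (auto simp: K_def)
  interpret \<iota>: comm_ring_hom \<iota> by (rule \<phi>_hom)
  obtain a b where ab: "D (\<iota> (fst p)) = \<iota> a" "D (\<iota> (snd p / Fract F 1)) = \<iota> b" using D_\<iota> by meson
  then have "D f = \<iota> a + \<iota> b * y ^ 3"
    unfolding p by (subst E_cube_form) (simp only: D_add D_mult D_cube mult_zero_right add_0_right)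
  also have "\<dots> = E (a, b * Fract F 1)"
    by (simp add: E_cube_form)
  finally have "(a, b * Fract F 1) = 0" using D0 by simp
  then have "a = 0" "b = 0" by (simp_all add: prod_eq_iff)
  then obtain u v where uv: "fst p = u ^ 3" "snd p / Fract F 1 = v ^ 3" using ab \<iota>_cube by (metis \<phi>_0)
  have "f = \<iota> u ^ 3 + \<iota> v ^ 3 * y ^ 3" unfolding p by (subst E_cube_form) (simp only: uv \<iota>.hom_power)
  also have "\<dots> = E (u, v) ^ 3" by (simp add: E_def2 cube_add_fls power_mult_distrib)
  finally show ?thesis using E_in_K by blast
qed

definition val :: "('a poly fract \<times> 'a poly fract \<Rightarrow> int) \<Rightarrow> 'a fls \<Rightarrow> int" where
  "val v f = v (inv_into UNIV E f)"

lemma val_E [simp]: "val v (E p) = v p"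
  by (simp add: val_def inj_E)

lemma val_deriv3_valn:
  assumes "v \<in> places F"
  shows "deriv3_valn D K fls_const (val v)"
proof -
  have "comm_ring_hom (fls_const :: 'a \<Rightarrow> _)" by (rule fls_val.\<kappa>)
  moreover note v = assms[unfolded places_iff]
  have "val v (f * g) = val v f + val v g" if "f \<in> K" "g \<in> K" "f \<noteq> 0" "g \<noteq> 0" for f g
    using that v unfolding K_def by (auto simp flip: E_mult)
  moreover have "min (val v f) (val v g) \<le> val v (f + g)" if "f \<in> K" "g \<in> K" "f \<noteq> 0" "g \<noteq> 0" "f + g \<noteq> 0" for f g
    using that v unfolding K_def by (auto simp flip: E_add)
  moreover have "val v (fls_const c) = 0" if "c \<noteq> 0" for c
    using that v by (simp flip: E_const)
  ultimately have "valn K fls_const (val v)"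
    by (intro valn.intro K_subfield) auto
  then show ?thesis
    by (intro deriv3_valn.intro deriv3_valn_axioms.intro deriv3_axioms D_in_K D_eq_0_cube) 
qed

lemma val_uniformizer:
  assumes "v \<in> places F"
  obtains t where "t \<in> K" "t \<noteq> 0" "val v t = 1"
proof -
  obtain p where "p \<noteq> 0" "v p = 1" using assms by (auto simp: places_iff)
  then show ?thesis using that[of "E p"] by simp
qed

lemma places_eqI:
  assumes "v \<in> places F" "v' \<in> places F" "\<And>f. f \<in> K \<Longrightarrow> f \<noteq> 0 \<Longrightarrow> val v f = val v' f"
  shows "v = v'"
proof
  fix p
  show "v p = v' p"
    using assms(1,2) assms(3)[of "E p"] by (cases "p = 0") (auto simp: places_iff)
qed

end

context hyperelliptic
begin

subsection \<open>Places above a point of the projective line\<close>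

definition \<pi> :: "'a option \<Rightarrow> 'a poly fract" where
  "\<pi> b = (case b of Some r \<Rightarrow> Fract [:- r, 1:] 1 | None \<Rightarrow> Fract 1 [:0, 1:])"

definition above :: "'a option \<Rightarrow> ('a poly fract \<times> 'a poly fract \<Rightarrow> int) set" where
  "above b = {v \<in> places F. v (\<pi> b, 0) > 0}"

lemma \<pi>_neq_0 [simp]: "\<pi> b \<noteq> 0"
  by (auto simp: \<pi>_def Zero_fract_def eq_fract split: option.splits)

lemma \<phi>_\<pi>: "\<phi> b (\<pi> b) = fls_X ^ ram b"
proof (cases b)
  case (Some r)
  then show ?thesis by (simp add: \<pi>_def \<phi>_poly \<xi>_def)
next
  case None
  then show ?thesis
    by (simp add: \<pi>_def \<phi>_Fract \<xi>_def fls_inverse_X_inv divide_inverse flip: power_inverse)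
qed

lemma \<iota>_\<pi>: "\<iota> (\<pi> b) = (case b of Some r \<Rightarrow> x - fls_const r | None \<Rightarrow> inverse x)"
  by (cases b) (simp_all add: \<pi>_def \<phi>_Fract divide_inverse)

lemma above_place: "v \<in> above b \<Longrightarrow> v \<in> places F"
  by (simp add: above_def)

lemma val_\<iota>: "val v (\<iota> q) = v (q, 0)"
  by (simp add: \<iota>_E)

lemma above_poly:
  assumes v: "v \<in> above b" and p: "p \<noteq> 0"
  shows "val v (ev x p) = v (\<pi> b, 0) * ord_pt b p"
proof -
  interpret w: deriv3_valn D K fls_const "val v" by (rule val_deriv3_valn[OF above_place[OF v]])
  have e: "val v (\<iota> (\<pi> b)) > 0" using v by (simp add: above_def val_\<iota>)
  show ?thesis
  proof (cases b)
    case (Some r)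
    have "x - fls_const r \<noteq> 0" using \<phi>_eq_0[of base "\<pi> b"] by (simp add: \<iota>_\<pi> Some del: \<phi>_eq_0)
    then have "val v (ev x p) = val v (x - fls_const r) * int (Polynomial.order r p)"
      using w.eval_finite_point(2)[of x r p] e p by (simp add: \<iota>_\<pi> Some)
    then show ?thesis using Some by (simp add: \<iota>_\<pi> ord_pt_def flip: val_\<iota>)
  next
    case None
    have x0: "x \<noteq> 0" using \<phi>_eq_0[of base "\<pi> b"] by (simp add: \<iota>_\<pi> None del: \<phi>_eq_0)
    have "val v (inverse x) = - val v x" using w.w_inverse[of x] x0 by simp
    moreover from this have "val v (ev x p) = val v x * int (Polynomial.degree p)"
      using w.eval_infinite_point[of x p] e p x0 by (simp add: \<iota>_\<pi> None)
    ultimately show ?thesis using None by (simp add: \<iota>_\<pi> ord_pt_def flip: val_\<iota>)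
  qed
qed

text \<open>Both sides are the ramification index times v(\<pi>) times the order of q at
  \<open>b\<close>, one computed at the place and one in the parametrisation. The form without
  division anticipates that v(\<pi>) is identified with \<open>ram b\<close> only in
  \<open>above_\<pi>\<close>.\<close>

lemma above_rational:
  assumes v: "v \<in> above b" and q: "q \<noteq> 0"
  shows "int (ram b) * v (q, 0) = v (\<pi> b, 0) * fls_subdegree (\<phi> b q)"
proof -
  interpret w: deriv3_valn D K fls_const "val v" by (rule val_deriv3_valn[OF above_place[OF v]])
  obtain p s where ps: "q = Fract p s" "s \<noteq> 0" by (meson Fract_cases)
  have p: "p \<noteq> 0" using ps q by (auto simp: fract_collapse)
  have "v (q, 0) = val v (ev x p) - val v (ev x s)"
    using ev_\<xi>[OF p] ev_\<xi>[OF ps(2)] unfolding val_\<iota>[symmetric] ps(1) \<phi>_Fract[OF ps(2)]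
    by (intro w.w_divide) auto
  also have "\<dots> = v (\<pi> b, 0) * (ord_pt b p - ord_pt b s)"
    using above_poly[OF v] p ps(2) by (simp add: algebra_simps)
  finally have v1: "v (q, 0) = v (\<pi> b, 0) * (ord_pt b p - ord_pt b s)" .
  have "fls_subdegree (\<phi> b q) = int (ram b) * (ord_pt b p - ord_pt b s)"
    using ev_\<xi>[OF p, of b] ev_\<xi>[OF ps(2), of b] fls_val.w_divide[of "ev (\<xi> b) p" "ev (\<xi> b) s"]
    unfolding ps(1) \<phi>_Fract[OF ps(2)] by (simp add: algebra_simps)
  then show ?thesis using v1 by simp
qed

lemma above_rational_nonneg:
  assumes "v \<in> above b" "q = 0 \<or> 0 \<le> fls_subdegree (\<phi> b q)"
  shows "q = 0 \<or> 0 \<le> v (q, 0)"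
proof (cases "q = 0")
  case False
  have "0 \<le> int (ram b) * v (q, 0)"
    using above_rational[OF assms(1) False] assms False by (simp add: above_def)
  moreover have "int (ram b) > 0" using ram_cases[of b] by auto
  ultimately show ?thesis by (simp add: zero_le_mult_iff)
qed simp

definition cnj :: "'a fls \<Rightarrow> 'a fls" where
  "cnj f = E (conj_fract (inv_into UNIV E f))"

lemma cnj_E [simp]: "cnj (E p) = E (conj_fract p)"
  by (simp add: cnj_def inj_E)

lemma conj_conj [simp]: "conj_fract (conj_fract p) = p"
  by (simp add: conj_fract_def)

lemma conj_eq_0 [simp]: "conj_fract p = 0 \<longleftrightarrow> p = 0"
  by (simp add: conj_fract_def prod_eq_iff)

lemma conj_0 [simp]: "conj_fract 0 = 0"
  using conj_eq_0[of 0] by blast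

lemma placeD:
  assumes "v \<in> places F"
  shows "v 0 = 0"
    and "f \<noteq> 0 \<Longrightarrow> g \<noteq> 0 \<Longrightarrow> v (mult_ff F f g) = v f + v g"
    and "f \<noteq> 0 \<Longrightarrow> g \<noteq> 0 \<Longrightarrow> f + g \<noteq> 0 \<Longrightarrow> min (v f) (v g) \<le> v (f + g)"
    and "c \<noteq> 0 \<Longrightarrow> v (Fract [:c:] 1, 0) = 0"
    and "\<exists>t. t \<noteq> 0 \<and> v t = 1"
  using assms unfolding places_iff by blast+

lemma conj_place:
  assumes v: "v \<in> places F"
  shows "v \<circ> conj_fract \<in> places F"
  unfolding places_iff o_def
proof (intro conjI allI impI)
  show "v (conj_fract 0) = 0" using placeD(1)[OF v] by simp
  show "v (conj_fract (mult_ff F f g)) = v (conj_fract f) + v (conj_fract g)" if "f \<noteq> 0" "g \<noteq> 0" for f g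
  proof -
    have "conj_fract (mult_ff F f g) = mult_ff F (conj_fract f) (conj_fract g)"
      by (simp add: conj_fract_def mult_ff_def)
    then show ?thesis using placeD(2)[OF v, of "conj_fract f" "conj_fract g"] that by simp
  qed
  show "min (v (conj_fract f)) (v (conj_fract g)) \<le> v (conj_fract (f + g))"
    if "f \<noteq> 0" "g \<noteq> 0" "f + g \<noteq> 0" for f g
  proof -
    have eq: "conj_fract (f + g) = conj_fract f + conj_fract g" by (simp add: conj_fract_def)
    then have "conj_fract f + conj_fract g \<noteq> 0" using that conj_eq_0 by metis
    then show ?thesis using placeD(3)[OF v, of "conj_fract f" "conj_fract g"] that by (simp only: eq conj_eq_0 not_False_eq_True)
  qed
  show "v (conj_fract (Fract [:c:] 1, 0)) = 0" if "c \<noteq> 0" for c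
    using placeD(4)[OF v that] by (simp add: conj_fract_def)
  obtain t where "t \<noteq> 0" "v t = 1" using placeD(5)[OF v] by blast
  then show "\<exists>t. t \<noteq> 0 \<and> v (conj_fract t) = 1" by (intro exI[of _ "conj_fract t"]) simp
qed

lemma trace_E: "E p + E (conj_fract p) = \<iota> (2 * fst p)"
proof -
  interpret \<iota>: comm_ring_hom \<iota> by (rule \<phi>_hom)
  have "\<iota> (2 * fst p) = \<iota> (fst p) + \<iota> (fst p)" by (simp only: mult_2 \<iota>.hom_add)
  then show ?thesis by (simp add: E_def2 conj_fract_def \<iota>.hom_uminus)
qed

text \<open>If p had a pole at v, the norm condition would force its conjugate to vanish there, and
  the trace would have the same pole as p.\<close>

lemma integral_imp_nonneg:
  assumes v: "v \<in> places F" and T: "2 * fst p = 0 \<or> 0 \<le> v (2 * fst p, 0)"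
    and N: "norm_fract F p = 0 \<or> 0 \<le> v (norm_fract F p, 0)"
  shows "p = 0 \<or> 0 \<le> v p"
proof (rule ccontr)
  interpret w: deriv3_valn D K fls_const "val v" by (rule val_deriv3_valn[OF v])
  assume "\<not> (p = 0 \<or> 0 \<le> v p)"
  then have p: "p \<noteq> 0" "v p < 0" by auto
  have "val v (E p * E (conj_fract p)) = v p + v (conj_fract p)"
    using p by (subst w.w_mult) auto
  then have "0 \<le> v p + v (conj_fract p)"
    using N norm_neq_0[OF p(1)] by (simp add: E_norm val_\<iota>)
  then have "w.ge (E (conj_fract p)) (val v (E p) + 1)" using p by (simp add: w.ge_def)
  then have "E p + E (conj_fract p) \<noteq> 0" "val v (E p + E (conj_fract p)) = v p"
    using w.w_add_strict[of "E p" "E (conj_fract p)"] p by auto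
  then show False using T p by (auto simp: trace_E val_\<iota>)
qed

lemma two_fract: "(2 :: 'a poly fract) \<noteq> 0"
proof
  assume "(2 :: 'a poly fract) = 0"
  moreover have "(2 :: 'a poly fract) = Fract 2 1" by (metis Fract_of_nat_eq of_nat_numeral)
  ultimately have "(2 :: 'a poly) = 0" by (simp add: Zero_fract_def eq_fract)
  then have "[:2 :: 'a:] = 0" by (simp add: numeral_poly)
  then show False using two_neq_0 by simp
qed

text \<open>Otherwise x is integral and every x - r is a unit at v, so v is trivial on rational
  functions. Integrality via trace and norm then makes v nonnegative everywhere, while an element of
  value 1 has a conjugate of value -1.\<close>

lemma above_exists:
  assumes v: "v \<in> places F"
  shows "\<exists>b. v \<in> above b"
proof (rule ccontr)
  interpret w: deriv3_valn D K fls_const "val v" by (rule val_deriv3_valn[OF v])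
  assume none: "\<not> (\<exists>b. v \<in> above b)"
  have x0: "x \<noteq> 0" using \<phi>_eq_0[of base "\<pi> None"] by (simp add: \<iota>_\<pi> del: \<phi>_eq_0)
  have "v (\<pi> None, 0) \<le> 0" using none v by (auto simp: above_def not_less)
  then have gex: "w.ge x 0"
    using w.w_inverse[of x] x0 by (simp add: \<iota>_\<pi> w.ge_def flip: val_\<iota>)
  have lin: "val v (ev x [:- r, 1:]) = 0" for r
  proof -
    have "v (\<pi> (Some r), 0) \<le> 0" using none v by (auto simp: above_def not_less)
    then have "val v (ev x [:- r, 1:]) \<le> 0" by (simp add: \<pi>_def \<phi>_poly flip: val_\<iota>)
    moreover have "w.ge (ev x [:- r, 1:]) 0" using gex by (intro w.eval_ge_0) auto
    moreover have "ev x [:- r, 1:] \<noteq> 0" using ev_\<xi>[of "[:- r, 1:]" base] by simp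
    ultimately show ?thesis by (simp add: w.ge_def)
  qed
  have poly0: "val v (ev x p) = 0" if "p \<noteq> 0" for p
    using that
  proof (induction "Polynomial.degree p" arbitrary: p)
    case 0
    then obtain c where "p = [:c:]" by (metis degree_eq_zeroE)
    then show ?case using 0 by (simp add: w.w_const)
  next
    case (Suc n)
    then obtain r where "poly p r = 0" using alg_closed_imp_poly_has_root[of p] by auto
    then obtain q where q: "p = [:- r, 1:] * q" by (metis dvdE poly_eq_0_iff_dvd)
    then have q0: "q \<noteq> 0" using Suc by auto
    then have "Polynomial.degree p = Suc (Polynomial.degree q)" unfolding q by (subst degree_mult_eq) auto
    then have IH: "val v (ev x q) = 0" using Suc q0 by auto
    have "val v (ev x [:- r, 1:] * ev x q) = 0"
      using lin[of r] IH ev_\<xi>[of "[:- r, 1:]" base] ev_\<xi>[OF q0, of base] by (subst w.w_mult) auto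
    then show ?case by (simp only: q fls_val.eval_mult)
  qed
  have rat0: "v (q, 0) = 0" if "q \<noteq> 0" for q
  proof -
    obtain p s where ps: "q = Fract p s" "s \<noteq> 0" by (meson Fract_cases)
    have p: "p \<noteq> 0" using ps that by (auto simp: fract_collapse)
    have "v (q, 0) = val v (ev x p) - val v (ev x s)"
      using ev_\<xi>[OF p] ev_\<xi>[OF ps(2)] unfolding val_\<iota>[symmetric] ps(1) \<phi>_Fract[OF ps(2)]
      by (intro w.w_divide) auto
    then show ?thesis using poly0 p ps by simp
  qed
  have nonneg: "0 \<le> v p" if "p \<noteq> 0" for p
    using integral_imp_nonneg[OF v, of p] rat0 that by (metis order_refl)
  obtain t where t: "t \<noteq> 0" "v t = 1" using v by (auto simp: places_iff)
  have "val v (E t * E (conj_fract t)) = v t + v (conj_fract t)" using t by (subst w.w_mult) auto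
  then have "v t + v (conj_fract t) = 0"
    using rat0[OF norm_neq_0[OF t(1)]] by (simp add: E_norm val_\<iota>)
  then show False using nonneg[of "conj_fract t"] t by simp
qed

lemma above_unique: "v \<in> above b \<Longrightarrow> v \<in> above c \<Longrightarrow> b = c"
proof (rule ccontr)
  assume v: "v \<in> above b" "v \<in> above c" and "b \<noteq> c"
  have e: "v (\<pi> b, 0) > 0" "v (\<pi> c, 0) > 0" using v by (auto simp: above_def)
  have *: False if "v \<in> above (Some r)" "v \<in> above b" "b \<noteq> Some r" for r b
  proof -
    have "v (\<pi> (Some r), 0) = v (\<pi> b, 0) * ord_pt b [:- r, 1:]"
      using above_poly[OF that(2), of "[:- r, 1:]"] by (simp add: \<pi>_def \<phi>_poly flip: val_\<iota>)
    moreover have "ord_pt b [:- r, 1:] \<le> 0"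
    proof (cases b)
      case (Some s)
      then have "poly [:- r, 1:] s \<noteq> 0" using that(3) by simp
      then show ?thesis by (simp add: ord_pt_def Some order_0I)
    qed (simp add: ord_pt_def)
    ultimately show False using that(1,2)
      by (simp add: above_def) (smt (verit) mult_nonneg_nonpos)
  qed
  show False using *[of _ b] *[of _ c] v \<open>b \<noteq> c\<close> by (cases b; cases c) auto
qed

text \<open>A function regular at both Laurent places over \<open>b\<close> has trace and norm of
  nonnegative order in the local parameter, hence at v, and integrality applies. This bounds every
  place over \<open>b\<close> by the two explicit ones.\<close>

lemma above_nonneg:
  assumes v: "v \<in> above b" and S: "S \<in> roots_F b" and f: "f \<in> K"
    and nn: "0 \<le> val (place_of b S) f" "0 \<le> val (place_of b (- S)) f"
  shows "f = 0 \<or> 0 \<le> val v f"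
proof -
  obtain p where p: "f = E p" using f by (auto simp: K_def)
  interpret \<phi>: comm_ring_hom "\<phi> b" by (rule \<phi>_hom)
  have nn: "fls_val.ge (emb b S p) 0" "fls_val.ge (emb b (- S) p) 0"
    using nn by (simp_all add: p place_of_def fls_val.ge_def)
  have "emb b S p + emb b (- S) p = \<phi> b (2 * fst p)"
  proof -
    have "\<phi> b (2 * fst p) = \<phi> b (fst p) + \<phi> b (fst p)" by (simp only: mult_2 \<phi>.hom_add)
    then show ?thesis by (simp add: emb_def)
  qed
  then have "fls_val.ge (\<phi> b (2 * fst p)) 0" using fls_val.ge_add[OF _ _ nn] by simp
  then have T: "2 * fst p = 0 \<or> 0 \<le> v (2 * fst p, 0)"
    by (intro above_rational_nonneg[OF v]) (simp add: fls_val.ge_def)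
  have "fls_val.ge (\<phi> b (norm_fract F p)) 0"
    using fls_val.ge_mult[OF _ _ nn] by (simp add: emb_norm[OF S])
  then have "norm_fract F p = 0 \<or> 0 \<le> v (norm_fract F p, 0)"
    by (intro above_rational_nonneg[OF v]) (simp add: fls_val.ge_def)
  with T show ?thesis using integral_imp_nonneg[OF above_place[OF v], of p] by (simp add: p)
qed

text \<open>Inclusion of valuation rings suffices: units of v' are units of v, so v is v(t) times v'
  for a uniformizer t of v', and v taking the value 1 forces v(t) = 1.\<close>

lemma dominated_places_eq:
  assumes v: "v \<in> places F" and v': "v' \<in> places F"
    and dom: "\<And>f. f \<in> K \<Longrightarrow> f \<noteq> 0 \<Longrightarrow> 0 \<le> val v' f \<Longrightarrow> 0 \<le> val v f"
  shows "v = v'"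
proof -
  interpret w: deriv3_valn D K fls_const "val v" by (rule val_deriv3_valn[OF v])
  interpret w': deriv3_valn D K fls_const "val v'" by (rule val_deriv3_valn[OF v'])
  have unit: "val v f = 0" if "f \<in> K" "f \<noteq> 0" "val v' f = 0" for f
    using dom[of f] dom[of "inverse f"] w.w_inverse[of f] w'.w_inverse[of f] that by auto
  obtain t where t: "t \<in> K" "t \<noteq> 0" "val v' t = 1" using val_uniformizer[OF v'] by blast
  have eq: "val v f = val v' f * val v t" if f: "f \<in> K" "f \<noteq> 0" for f
  proof (cases "0 \<le> val v' f")
    case True
    define n where "n = nat (val v' f)"
    have "val v' (f / t ^ n) = 0" using f t True by (subst w'.w_divide) (auto simp: w'.w_power n_def)
    then have "val v (f / t ^ n) = 0" using f t by (intro unit) auto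
    moreover have "val v (f / t ^ n) = val v f - int n * val v t"
      using f t by (subst w.w_divide) (auto simp: w.w_power)
    ultimately show ?thesis using True by (simp add: n_def)
  next
    case False
    define n where "n = nat (- val v' f)"
    have "val v' (f * t ^ n) = 0" using f t False by (subst w'.w_mult) (auto simp: w'.w_power n_def)
    then have "val v (f * t ^ n) = 0" using f t by (intro unit) auto
    moreover have "val v (f * t ^ n) = val v f + int n * val v t"
      using f t by (subst w.w_mult) (auto simp: w.w_power)
    ultimately show ?thesis using False by (simp add: n_def)
  qed
  obtain s where s: "s \<in> K" "s \<noteq> 0" "val v s = 1" using val_uniformizer[OF v] by blast
  have "val v' s * val v t = 1" using eq[OF s(1,2)] s by simp
  moreover have "0 \<le> val v t" using dom[of t] t by simp
  ultimately have "val v t = 1" by (auto simp: zmult_eq_1_iff)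
  then show ?thesis using eq by (intro places_eqI[OF v v']) simp
qed

lemma place_of_above: "S \<in> roots_F b \<Longrightarrow> place_of b S \<in> above b"
  and place_of_\<pi>: "place_of b S (\<pi> b, 0) = int (ram b)"
proof -
  show *: "place_of b S (\<pi> b, 0) = int (ram b)" for S
    by (simp add: place_of_def emb_def \<phi>_\<pi> fls_subdegree_pow)
  then show "S \<in> roots_F b \<Longrightarrow> place_of b S \<in> above b"
    using place_of_in_places[of S b] ram_cases[of b] by (auto simp: above_def)
qed

lemma place_of_conj: "place_of b S (conj_fract p) = place_of b (- S) p"
  by (simp add: place_of_def emb_conj)

text \<open>Over a branch point rational functions have even order and y has odd order, so the two
  parts of a + b y never cancel and the sign of y does not affect the order.\<close>

lemma place_of_ramified:
  assumes S: "S \<in> roots_F b" and r: "ram b = 2"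
  shows "place_of b (- S) = place_of b S"
proof
  fix p
  define A B where "A = \<phi> b (fst p)" and "B = \<phi> b (snd p) * S"
  have emb: "emb b S p = A + B" "emb b (- S) p = A + - B" by (simp_all add: A_def B_def emb_def)
  have A: "even (fls_subdegree A)" unfolding A_def using \<phi>_subdegree_dvd[of b "fst p"] r by simp
  have "fls_subdegree S = ord_pt b F" using roots_F_subdegree[OF S] r by simp
  then have "odd (fls_subdegree S)"
    using r order_F by (auto simp: ram_def ord_pt_def split: option.splits if_splits)
  then have B: "odd (fls_subdegree B)" if "B \<noteq> 0"
    using that \<phi>_subdegree_dvd[of b "snd p"] r unfolding B_def by (subst fls_subdegree_mult) auto
  consider "A = 0" | "B = 0" | "A \<noteq> 0" "B \<noteq> 0" "fls_subdegree A < fls_subdegree B"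
    | "A \<noteq> 0" "B \<noteq> 0" "fls_subdegree B < fls_subdegree A"
    using A B by (metis linorder_neqE_linordered_idom)
  then have "fls_subdegree (A + B) = fls_subdegree (A + - B)"
  proof cases
    case 3
    then show ?thesis by (simp add: fls_subdegree_add_eq1 fls_subdegree_diff_eq1)
  next
    case 4
    then show ?thesis by (simp add: fls_subdegree_add_eq2 fls_subdegree_diff_eq2)
  qed auto
  then show "place_of b (- S) p = place_of b S p" by (simp add: place_of_def emb)
qed

lemma above_ramified:
  assumes v: "v \<in> above b" and S: "S \<in> roots_F b" and r: "ram b = 2"
  shows "v = place_of b S"
  using above_nonneg[OF v S] place_of_ramified[OF S r]
  by (intro dominated_places_eq[OF above_place[OF v] place_of_in_places[OF S]]) auto

text \<open>The function \<open>h\<close> is a unit at \<open>v\<close> and at the place of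
  \<open>S\<close> but vanishes at the conjugate place. Multiplying f by a power of \<open>h\<close>
  removes its poles there without changing the other two values, so \<open>above_nonneg\<close>
  applies.\<close>

lemma above_eq_place_of:
  assumes v: "v \<in> above b" and S: "S \<in> roots_F b"
    and h: "h \<in> K" "h \<noteq> 0" "val (place_of b S) h = 0" "1 \<le> val (place_of b (- S)) h" "val v h = 0"
  shows "v = place_of b S"
proof (rule dominated_places_eq[OF above_place[OF v] place_of_in_places[OF S]])
  have S': "- S \<in> roots_F b" using S by (rule roots_F_uminus)
  interpret w: deriv3_valn D K fls_const "val v" by (rule val_deriv3_valn[OF above_place[OF v]])
  interpret w1: deriv3_valn D K fls_const "val (place_of b S)" by (rule val_deriv3_valn[OF place_of_in_places[OF S]])
  interpret w2: deriv3_valn D K fls_const "val (place_of b (- S))" by (rule val_deriv3_valn[OF place_of_in_places[OF S']])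
  fix f assume f: "f \<in> K" "f \<noteq> 0" "0 \<le> val (place_of b S) f"
  define n where "n = nat (- val (place_of b (- S)) f)"
  have "0 \<le> val (place_of b S) (f * h ^ n)"
    using f h by (subst w1.w_mult) (auto simp: w1.w_power)
  moreover have "int n \<le> int n * val (place_of b (- S)) h"
    using h(4) by (metis mult_left_mono mult.right_neutral of_nat_0_le_iff)
  then have "0 \<le> val (place_of b (- S)) (f * h ^ n)"
    using f h by (subst w2.w_mult) (auto simp: w2.w_power n_def)
  ultimately have "0 \<le> val v (f * h ^ n)"
    using above_nonneg[OF v S, of "f * h ^ n"] f h by auto
  also have "val v (f * h ^ n) = val v f" using f h by (subst w.w_mult) (auto simp: w.w_power)
  finally show "0 \<le> val v f" .
qed

text \<open>Take 1 + q y with q rational and q S = 1 plus higher terms: for S the value is 2, which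
  is nonzero, and for -S it is 0.\<close>

lemma unramified_separator:
  assumes S: "S \<in> roots_F b" and r: "ram b = 1"
  obtains p where "p \<noteq> 0" "fst p = 1" "place_of b S p = 0" "1 \<le> place_of b (- S) p"
proof -
  interpret \<phi>: comm_ring_hom "\<phi> b" by (rule \<phi>_hom)
  define m where "m = fls_subdegree S"
  define s where "s = fls_nth S m"
  have S0: "S \<noteq> 0" using roots_F_neq_0[OF S] .
  then have s: "s \<noteq> 0" by (simp add: s_def m_def)
  \<comment> \<open>\<open>P\<close> imitates the order of y with leading coefficient 1: the
    constant 1 at finite points, x^3 at infinity.\<close>
  obtain P where P: "P \<noteq> 0" "fls_subdegree (\<phi> b P) = m" "fls_nth (\<phi> b P) m = 1"
  proof (cases b)
    case (Some a)
    then have "m = 0" using roots_F_subdegree[OF S] r by (auto simp: m_def ram_def ord_pt_def order_0I split: if_splits)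
    then show ?thesis using that[of 1] by simp
  next
    case None
    then have "Polynomial.degree F = 6" using r deg_F by (auto simp: ram_def split: if_splits)
    then have m: "m = - 3" using roots_F_subdegree[OF S] r None by (simp add: m_def ord_pt_def)
    let ?P = "Fract ([:0, 1:] ^ 3) 1"
    have "\<phi> b ?P = fls_X_inv ^ 3" using r by (simp add: \<phi>_poly fls_val.eval_power \<xi>_def None)
    then have "\<phi> b ?P = fls_shift 3 1" by (simp add: fls_X_inv_power_conv_shift_1)
    moreover have "?P \<noteq> 0" by (simp add: Zero_fract_def eq_fract)
    ultimately show ?thesis using that[of ?P] m by simp
  qed
  define q where "q = inverse (Fract [:s:] 1 * P)"
  define u where "u = \<phi> b q * S"
  have c: "\<phi> b (Fract [:s:] 1) = fls_const s" by (simp add: \<phi>_poly)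
  have den: "fls_const s * \<phi> b P \<noteq> 0" using s P by simp
  have "\<phi> b q = inverse (fls_const s * \<phi> b P)"
    using comm_ring_hom_divide[OF \<phi>_hom, of b 1] by (simp add: q_def \<phi>.hom_mult c inverse_eq_divide)
  then have u: "u = S / (fls_const s * \<phi> b P)" by (simp add: u_def divide_inverse mult.commute)
  have uS: "u * (fls_const s * \<phi> b P) = S" unfolding u using den by simp
  have u0: "u \<noteq> 0" using uS S0 by auto
  have "fls_subdegree (u * (fls_const s * \<phi> b P)) = fls_subdegree u + m"
    using u0 s P by (simp add: fls_subdegree_mult)
  then have su: "fls_subdegree u = 0" by (simp add: uS m_def)
  have "fls_nth (u * (fls_const s * \<phi> b P)) (fls_subdegree u + m) = fls_nth u 0 * s"
    using fls_times_base[of u "fls_const s * \<phi> b P"] s P su by simp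
  then have "s = fls_nth u 0 * s" by (simp only: uS su add_0_left flip: s_def)
  then have u1: "fls_nth u 0 = 1" using s by simp
  have e1: "emb b S (1, q) = 1 + u" "emb b (- S) (1, q) = 1 - u" by (simp_all add: emb_def u_def)
  have nz: "(1, q) \<noteq> (0 :: 'a poly fract \<times> 'a poly fract)" by (simp add: prod_eq_iff)
  have neg: "fls_nth u n = 0" if "n < 0" for n using su that by (simp add: fls_eq0_below_subdegree)
  have "place_of b S (1, q) = 0"
    unfolding place_of_def e1 using u1 two_neq_0 neg by (intro fls_subdegree_eqI) auto
  moreover have "1 - u \<noteq> 0" using emb_eq_0[OF roots_F_uminus[OF S], of "(1, q)"] nz e1 by simp
  then have "1 \<le> place_of b (- S) (1, q)"
    unfolding place_of_def e1 using u1 neg by (intro fls_subdegree_geI) auto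
  ultimately show ?thesis using that[of "(1, q)"] nz by simp
qed

lemma place_of_unramified:
  assumes S: "S \<in> roots_F b" and r: "ram b = 1"
  shows "place_of b S \<noteq> place_of b (- S)"
proof -
  obtain p where "place_of b S p = 0" "1 \<le> place_of b (- S) p" using unramified_separator[OF S r] by blast
  then show ?thesis by auto
qed

text \<open>A separator and its conjugate add up to the unit 2, so one of them is a unit at
  \<open>v\<close>, and that one tells which of the two places \<open>v\<close> is.\<close>

lemma above_unramified:
  assumes v: "v \<in> above b" and S: "S \<in> roots_F b" and r: "ram b = 1"
  shows "v = place_of b S \<or> v = place_of b (- S)"
proof -
  have S': "- S \<in> roots_F b" using S by (rule roots_F_uminus)
  interpret w: deriv3_valn D K fls_const "val v" by (rule val_deriv3_valn[OF above_place[OF v]])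
  obtain p where p: "p \<noteq> 0" "fst p = 1" "place_of b S p = 0" "1 \<le> place_of b (- S) p"
    using unramified_separator[OF S r] by blast
  have q: "place_of b S (conj_fract p) = place_of b (- S) p" "place_of b (- S) (conj_fract p) = place_of b S p"
    by (simp_all add: place_of_conj)
  have nn: "0 \<le> v p" "0 \<le> v (conj_fract p)"
    using above_nonneg[OF v S, of "E p"] above_nonneg[OF v S, of "E (conj_fract p)"] p q by auto
  have "E p + E (conj_fract p) = \<iota> 2" using trace_E[of p] p by simp
  also have "\<iota> 2 = 2" 
  proof -
    interpret \<iota>: comm_ring_hom \<iota> by (rule \<phi>_hom)
    show ?thesis using \<iota>.hom_add[of 1 1] by simp
  qed
  also have "(2 :: 'a fls) = fls_const 2" by (metis fls_const_numeral)
  finally have "E p + E (conj_fract p) = fls_const 2" .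
  then have "val v (E p + E (conj_fract p)) = 0" using w.w_const[OF two_neq_0] by (simp only:)
  moreover have "E p + E (conj_fract p) \<noteq> 0"
    using \<open>E p + E (conj_fract p) = \<iota> 2\<close> two_fract by simp
  then have "min (val v (E p)) (val v (E (conj_fract p))) \<le> val v (E p + E (conj_fract p))"
    using p by (intro w.w_add) auto
  ultimately have "v p = 0 \<or> v (conj_fract p) = 0" using nn by auto
  then show ?thesis
  proof
    assume "v p = 0"
    then have "v = place_of b S" using p by (intro above_eq_place_of[OF v S, of "E p"]) auto
    then show ?thesis ..
  next
    assume "v (conj_fract p) = 0"
    then have "v = place_of b (- S)"
      using p q by (intro above_eq_place_of[OF v S', of "E (conj_fract p)"]) auto
    then show ?thesis ..
  qed
qed

text \<open>The fundamental identity of a double cover: either one place of index 2 or two places of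
  index 1.\<close>

lemma finite_above: "finite (above b)"
  and sum_above: "(\<Sum>v\<in>above b. v (\<pi> b, 0)) = 2"
  and above_\<pi>: "v \<in> above b \<Longrightarrow> v (\<pi> b, 0) = int (ram b)"
  and above_nonempty: "above b \<noteq> {}"
proof -
  obtain S where S: "S \<in> roots_F b" using roots_F_nonempty by blast
  have *: "above b = {place_of b S, place_of b (- S)} \<and> (ram b = 1 \<longrightarrow> place_of b S \<noteq> place_of b (- S))"
    using ram_cases[of b] above_ramified[OF _ S] above_unramified[OF _ S] place_of_above[OF S]
      place_of_above[OF roots_F_uminus[OF S]] place_of_unramified[OF S] by auto
  then show "finite (above b)" "above b \<noteq> {}" by auto
  show "v \<in> above b \<Longrightarrow> v (\<pi> b, 0) = int (ram b)" using * place_of_\<pi> by auto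
  show "(\<Sum>v\<in>above b. v (\<pi> b, 0)) = 2"
    using ram_cases[of b] * place_of_ramified[OF S] place_of_\<pi> by auto
qed

end

context hyperelliptic
begin

subsection \<open>Principal divisors\<close>

definition supp :: "'a poly fract \<times> 'a poly fract \<Rightarrow> ('a poly fract \<times> 'a poly fract \<Rightarrow> int) set" where
  "supp p = {v \<in> places F. v p \<noteq> 0}"

lemma rational_poly:
  assumes v: "v \<in> above b" and p: "p \<noteq> 0"
  shows "v (Fract p 1, 0) = int (ram b) * ord_pt b p"
  using above_poly[OF assms] above_\<pi>[OF v] by (simp add: ev_\<iota> val_\<iota>)

lemma rational_val:
  assumes v: "v \<in> above b" and q: "q \<noteq> 0"
  shows "v (q, 0) = fls_subdegree (\<phi> b q)"
  using above_rational[OF assms] above_\<pi>[OF v] ram_cases[of b] by auto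

lemma finite_supp_poly: "p \<noteq> 0 \<Longrightarrow> finite (supp (Fract p 1, 0))"
proof -
  assume p: "p \<noteq> 0"
  have "supp (Fract p 1, 0) \<subseteq> (\<Union>b\<in>insert None (Some ` {r. poly p r = 0}). above b)"
  proof
    fix v assume "v \<in> supp (Fract p 1, 0)"
    then have v: "v \<in> places F" "v (Fract p 1, 0) \<noteq> 0" by (auto simp: supp_def)
    obtain b where b: "v \<in> above b" using above_exists[OF v(1)] by blast
    then have "ord_pt b p \<noteq> 0" using rational_poly[OF b p] v by auto
    then have "b \<in> insert None (Some ` {r. poly p r = 0})"
      by (cases b) (auto simp: ord_pt_def order_root p)
    then show "v \<in> (\<Union>b\<in>insert None (Some ` {r. poly p r = 0}). above b)" using b by blast
  qed
  moreover have "finite (\<Union>b\<in>insert None (Some ` {r. poly p r = 0}). above b)"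
    using finite_above poly_roots_finite[OF p] by auto
  ultimately show ?thesis by (rule finite_subset)
qed

lemma mult_ff_rational: "mult_ff F (p, 0) (q, 0) = (p * q, 0)"
  by (simp add: mult_ff_def)

lemma mult_ff_conj: "mult_ff F p (conj_fract p) = (norm_fract F p, 0)"
  by (simp add: mult_ff_def conj_fract_def norm_fract_def power2_eq_square)

lemma supp_mult: "p \<noteq> 0 \<Longrightarrow> q \<noteq> 0 \<Longrightarrow> supp (mult_ff F p q) \<subseteq> supp p \<union> supp q"
  unfolding supp_def using placeD(2)[of _ p q] by fastforce

lemma pair_eq_0 [simp]: "(q, 0) = (0 :: 'a poly fract \<times> 'a poly fract) \<longleftrightarrow> q = 0"
  by (simp add: prod_eq_iff)

lemma Fract_1_eq_0 [simp]: "Fract p 1 = 0 \<longleftrightarrow> (p :: 'a poly) = 0"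
  by (simp add: Zero_fract_def eq_fract)

lemma fst_conj [simp]: "fst (conj_fract p) = fst p"
  by (simp add: conj_fract_def)

lemma Fract_eq_mult: "s \<noteq> 0 \<Longrightarrow> mult_ff F (Fract p s, 0) (Fract s 1, 0) = (Fract p 1, 0)"
  by (simp add: mult_ff_rational eq_fract)

lemma finite_supp_rational: "q \<noteq> 0 \<Longrightarrow> finite (supp (q, 0))"
proof -
  assume q0: "q \<noteq> 0"
  obtain p s where q: "q = Fract p s" "s \<noteq> 0" by (meson Fract_cases)
  then have p: "p \<noteq> 0" using q0 by (auto simp: fract_collapse)
  have "supp (q, 0) \<subseteq> supp (Fract p 1, 0) \<union> supp (Fract s 1, 0)"
  proof
    fix v assume v: "v \<in> supp (q, 0)"
    have eq: "mult_ff F (q, 0) (Fract s 1, 0) = (Fract p 1, 0)" unfolding q(1) by (rule Fract_eq_mult[OF q(2)])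
    have "v (mult_ff F (q, 0) (Fract s 1, 0)) = v (q, 0) + v (Fract s 1, 0)"
      using v q0 q(2) by (intro placeD(2)) (auto simp: supp_def)
    then have "v (Fract p 1, 0) = v (q, 0) + v (Fract s 1, 0)" by (simp only: eq)
    then show "v \<in> supp (Fract p 1, 0) \<union> supp (Fract s 1, 0)" using v by (auto simp: supp_def)
  qed
  then show ?thesis using finite_supp_poly p q(2) by (meson finite_UnI finite_subset)
qed

lemma conj_place_iff: "v \<circ> conj_fract \<in> places F \<longleftrightarrow> v \<in> places F"
proof -
  have "(v \<circ> conj_fract) \<circ> conj_fract = v" by (simp add: o_def)
  then show ?thesis using conj_place[of v] conj_place[of "v \<circ> conj_fract"] by metis
qed

text \<open>Away from the zeros and poles of its trace and norm, p and its conjugate are both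
  integral with a unit as product.\<close>

lemma finite_supp: "p \<noteq> 0 \<Longrightarrow> finite (supp p)"
proof -
  assume p: "p \<noteq> 0"
  have N0: "norm_fract F p \<noteq> 0" using norm_neq_0[OF p] .
  define B where "B = (if fst p = 0 then {} else supp (2 * fst p, 0))"
  have "supp p \<subseteq> supp (norm_fract F p, 0) \<union> B"
  proof
    fix v assume v: "v \<in> supp p"
    show "v \<in> supp (norm_fract F p, 0) \<union> B"
    proof (rule ccontr)
      assume not: "v \<notin> supp (norm_fract F p, 0) \<union> B"
      have vF: "v \<in> places F" using v by (simp add: supp_def)
      have N: "v (norm_fract F p, 0) = 0" using not vF by (simp add: supp_def)
      have T: "2 * fst p = 0 \<or> 0 \<le> v (2 * fst p, 0)" using not vF by (auto simp: supp_def B_def split: if_splits)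
      have "norm_fract F (conj_fract p) = norm_fract F p" by (simp add: norm_fract_def conj_fract_def)
      then have "0 \<le> v p" "0 \<le> v (conj_fract p)"
        using integral_imp_nonneg[OF vF, of p] integral_imp_nonneg[OF vF, of "conj_fract p"] T N p
        by auto
      moreover have "v p + v (conj_fract p) = 0"
        using placeD(2)[OF vF, of p "conj_fract p"] p N by (simp add: mult_ff_conj)
      ultimately show False using v by (simp add: supp_def)
    qed
  qed
  moreover have "finite B" unfolding B_def using finite_supp_rational two_fract by auto
  ultimately show ?thesis using finite_supp_rational[OF N0] by (meson finite_UnI finite_subset)
qed

definition deg :: "'a poly fract \<times> 'a poly fract \<Rightarrow> int" where
  "deg p = (\<Sum>v\<in>supp p. v p)"

lemma deg_superset:
  assumes "finite A" "supp p \<subseteq> A" "A \<subseteq> places F"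
  shows "deg p = (\<Sum>v\<in>A. v p)"
  unfolding deg_def using assms by (intro sum.mono_neutral_left) (auto simp: supp_def)

lemma deg_mult: "p \<noteq> 0 \<Longrightarrow> q \<noteq> 0 \<Longrightarrow> deg (mult_ff F p q) = deg p + deg q"
proof -
  assume pq: "p \<noteq> 0" "q \<noteq> 0"
  let ?A = "supp p \<union> supp q"
  have A: "finite ?A" "?A \<subseteq> places F" using finite_supp pq by (auto simp: supp_def)
  have "deg (mult_ff F p q) = (\<Sum>v\<in>?A. v (mult_ff F p q))"
    by (rule deg_superset[OF A(1) supp_mult[OF pq] A(2)])
  also have "\<dots> = (\<Sum>v\<in>?A. v p + v q)" using A pq by (intro sum.cong refl placeD(2)) auto
  also have "\<dots> = deg p + deg q"
    using deg_superset[OF A(1) _ A(2), of p] deg_superset[OF A(1) _ A(2), of q] by (simp add: sum.distrib)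
  finally show ?thesis .
qed

lemma deg_linear: "deg (Fract [:- r, 1:] 1, 0) = 0"
proof -
  let ?p = "[:- r, 1:]"
  let ?A = "above (Some r) \<union> above None"
  have val: "v (Fract ?p 1, 0) = (if b = Some r then v (\<pi> b, 0) else if b = None then - v (\<pi> b, 0) else 0)"
    if v: "v \<in> above b" for v b
  proof (cases b)
    case (Some s)
    show ?thesis
    proof (cases "s = r")
      case True
      then show ?thesis using Some by (simp add: \<pi>_def)
    next
      case False
      then have "Polynomial.order s ?p = 0" by (intro order_0I) simp
      then show ?thesis using rational_poly[OF v, of ?p] Some False by (simp add: ord_pt_def)
    qed
  next
    case None
    then show ?thesis using rational_poly[OF v, of ?p] above_\<pi>[OF v] by (simp add: ord_pt_def)
  qed
  have sub: "supp (Fract ?p 1, 0) \<subseteq> ?A"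
  proof
    fix v assume v: "v \<in> supp (Fract ?p 1, 0)"
    then obtain b where b: "v \<in> above b" using above_exists by (auto simp: supp_def)
    then show "v \<in> ?A" using val[OF b] v by (auto simp: supp_def split: if_splits)
  qed
  have "deg (Fract ?p 1, 0) = (\<Sum>v\<in>?A. v (Fract ?p 1, 0))"
    using sub above_place finite_above by (intro deg_superset) auto
  also have "\<dots> = (\<Sum>v\<in>above (Some r). v (Fract ?p 1, 0)) + (\<Sum>v\<in>above None. v (Fract ?p 1, 0))"
    using above_unique finite_above by (intro sum.union_disjoint) auto
  also have "(\<Sum>v\<in>above (Some r). v (Fract ?p 1, 0)) = (\<Sum>v\<in>above (Some r). v (\<pi> (Some r), 0))"
    by (simp add: val[of _ "Some r"])
  also have "(\<Sum>v\<in>above None. v (Fract ?p 1, 0)) = - (\<Sum>v\<in>above None. v (\<pi> None, 0))"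
    by (simp add: val[of _ None] sum_negf)
  finally show ?thesis by (simp add: sum_above)
qed

lemma deg_const: "c \<noteq> 0 \<Longrightarrow> deg (Fract [:c:] 1, 0) = 0"
  unfolding deg_def by (intro sum.neutral) (auto simp: supp_def placeD(4))

lemma deg_poly: "p \<noteq> 0 \<Longrightarrow> deg (Fract p 1, 0) = 0"
proof (induction "Polynomial.degree p" arbitrary: p)
  case 0
  then obtain c where "p = [:c:]" by (metis degree_eq_zeroE)
  then show ?case using 0 deg_const by auto
next
  case (Suc n)
  then obtain r where "poly p r = 0" using alg_closed_imp_poly_has_root[of p] by auto
  then obtain q where q: "p = [:- r, 1:] * q" by (metis dvdE poly_eq_0_iff_dvd)
  then have q0: "q \<noteq> 0" using Suc by auto
  then have "Polynomial.degree p = Suc (Polynomial.degree q)" unfolding q by (subst degree_mult_eq) auto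
  then have "deg (Fract q 1, 0) = 0" using Suc q0 by auto
  moreover have "(Fract p 1, 0) = mult_ff F (Fract [:- r, 1:] 1, 0) (Fract q 1, 0)"
    by (simp add: mult_ff_rational q)
  ultimately show ?case using q0 deg_linear[of r]
    by (simp only:) (subst deg_mult, auto)
qed

lemma deg_rational: "q \<noteq> 0 \<Longrightarrow> deg (q, 0) = 0"
proof -
  assume q0: "q \<noteq> 0"
  obtain p s where q: "q = Fract p s" "s \<noteq> 0" by (meson Fract_cases)
  then have p: "p \<noteq> 0" using q0 by (auto simp: fract_collapse)
  have "deg (mult_ff F (q, 0) (Fract s 1, 0)) = deg (q, 0) + deg (Fract s 1, 0)"
    using q0 q(2) by (intro deg_mult) auto
  then show ?thesis using q p deg_poly Fract_eq_mult[OF q(2), of p] by simp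
qed

text \<open>Conjugation permutes the places and so preserves the degree, while p times its conjugate
  is rational and has degree 0; hence twice the degree of p is 0.\<close>

theorem deg_principal: "p \<noteq> 0 \<Longrightarrow> deg p = 0"
proof -
  assume p: "p \<noteq> 0"
  have "deg (conj_fract p) = deg p"
    unfolding deg_def
    by (rule sum.reindex_bij_witness[of _ "\<lambda>v. v \<circ> conj_fract" "\<lambda>v. v \<circ> conj_fract"])
       (auto simp: supp_def conj_place_iff o_assoc[symmetric] o_def conj_place_iff[unfolded o_def])
  moreover have "deg p + deg (conj_fract p) = 0"
    using deg_mult[of p "conj_fract p"] p deg_rational[OF norm_neq_0[OF p]] by (simp add: mult_ff_conj)
  ultimately show ?thesis by simp
qed

text \<open>In a representation with denominator of least degree, a root of the denominator would be
  a root of the numerator as well and could be cancelled.\<close>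

lemma rational_poly_of_nonneg:
  assumes "\<And>r. q = 0 \<or> 0 \<le> fls_subdegree (\<phi> (Some r) q)"
  obtains u where "q = Fract u 1"
proof -
  have "\<exists>n s p. s \<noteq> 0 \<and> Polynomial.degree s = n \<and> q = Fract p s" by (meson Fract_cases)
  define n where "n = (LEAST n. \<exists>s p. s \<noteq> 0 \<and> Polynomial.degree s = n \<and> q = Fract p s)"
  have "\<exists>s p. s \<noteq> 0 \<and> Polynomial.degree s = n \<and> q = Fract p s"
    unfolding n_def by (rule LeastI_ex) fact
  then obtain s p where sp: "s \<noteq> 0" "Polynomial.degree s = n" "q = Fract p s" by blast
  have "n = 0"
  proof (rule ccontr)
    assume "n \<noteq> 0"
    then obtain r where r: "poly s r = 0" using alg_closed_imp_poly_has_root[of s] sp by auto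
    then obtain s' where s': "s = [:- r, 1:] * s'" by (metis dvdE poly_eq_0_iff_dvd)
    have s'0: "s' \<noteq> 0" using s' sp by auto
    have degs: "n = Suc (Polynomial.degree s')"
      using sp(2) s'0 unfolding s' by (subst (asm) degree_mult_eq) auto
    have "poly p r = 0"
    proof (cases "q = 0")
      case True
      then have "p = 0" using sp by (simp add: Zero_fract_def eq_fract)
      then show ?thesis by simp
    next
      case False
      then have p0: "p \<noteq> 0" using sp by (auto simp: fract_collapse)
      have "fls_subdegree (\<phi> (Some r) q) = int (ram (Some r)) * (ord_pt (Some r) p - ord_pt (Some r) s)"
        using ev_\<xi>[OF p0, of "Some r"] ev_\<xi>[OF sp(1), of "Some r"]
          fls_val.w_divide[of "ev (\<xi> (Some r)) p" "ev (\<xi> (Some r)) s"]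
        unfolding sp(3) \<phi>_Fract[OF sp(1)] by (simp add: algebra_simps)
      then have "ord_pt (Some r) s \<le> ord_pt (Some r) p"
        using assms[of r] False ram_cases[of "Some r"] by auto
      moreover have "Polynomial.order r s \<noteq> 0" using r sp(1) order_root by blast
      ultimately have "Polynomial.order r p \<noteq> 0" by (simp add: ord_pt_def)
      then show ?thesis using order_root by blast
    qed
    then obtain p' where p': "p = [:- r, 1:] * p'" by (metis dvdE poly_eq_0_iff_dvd)
    have "p * s' = p' * s" by (simp only: p' s' mult_ac)
    then have "q = Fract p' s'" using sp(1,3) s'0 by (simp add: eq_fract)
    then have "n \<le> Polynomial.degree s'" unfolding n_def using s'0 by (intro Least_le) blast
    then show False using degs by simp
  qed
  then obtain c where c: "s = [:c:]" using sp by (metis degree_eq_zeroE)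
  then have "q = Fract (Polynomial.smult (inverse c) p) 1" using sp by (simp add: eq_fract)
  then show ?thesis by (rule that)
qed

lemma subdegree_of_all_places_nonneg:
  assumes "\<And>v. v \<in> places F \<Longrightarrow> q = 0 \<or> 0 \<le> v (q, 0)"
  shows "q = 0 \<or> 0 \<le> fls_subdegree (\<phi> b q)"
proof -
  obtain v where v: "v \<in> above b" using above_nonempty by blast
  show ?thesis using assms[OF above_place[OF v]] rational_val[OF v] by (cases "q = 0") auto
qed

lemma rational_const_of_nonneg:
  assumes "\<forall>v\<in>places F. q = 0 \<or> 0 \<le> v (q, 0)"
  shows "\<exists>c. q = Fract [:c:] 1"
proof -
  have sd: "q = 0 \<or> 0 \<le> fls_subdegree (\<phi> b q)" for b
    using assms by (intro subdegree_of_all_places_nonneg) blast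
  obtain u where u: "q = Fract u 1" by (rule rational_poly_of_nonneg[of q, OF sd])
  show ?thesis
  proof (cases "u = 0")
    case True
    then show ?thesis using u by (intro exI[of _ 0]) simp
  next
    case False
    then have "q \<noteq> 0" using u by (simp add: Zero_fract_def eq_fract)
    then have "0 \<le> int (ram None) * ord_pt None u" using sd[of None] ev_\<xi>[OF False, of None] u by (simp add: \<phi>_poly)
    then have "Polynomial.degree u = 0" using ram_cases[of None] by (auto simp: ord_pt_def)
    then show ?thesis using u by (metis degree_eq_zeroE)
  qed
qed

text \<open>Trace and norm have no poles, so they are constants. Thus p satisfies a quadratic
  equation over an algebraically closed field and equals one of its roots.\<close>

theorem trivial_divisor_const:
  assumes p: "p \<noteq> 0" and v0: "\<And>v. v \<in> places F \<Longrightarrow> v p = 0"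
  obtains c where "c \<noteq> 0" "E p = fls_const c"
proof -
  interpret \<iota>: comm_ring_hom \<iota> by (rule \<phi>_hom)
  have v0': "v (conj_fract p) = 0" if "v \<in> places F" for v
    using v0[OF conj_place[OF that]] by simp
  have N: "v (norm_fract F p, 0) = 0" if "v \<in> places F" for v
    using placeD(2)[OF that, of p "conj_fract p"] p v0[OF that] v0'[OF that] by (simp add: mult_ff_conj)
  then obtain n where n: "norm_fract F p = Fract [:n:] 1"
    using rational_const_of_nonneg[of "norm_fract F p"] by (metis order_refl)
  have T: "2 * fst p = 0 \<or> 0 \<le> v (2 * fst p, 0)" if v: "v \<in> places F" for v
  proof (cases "2 * fst p = 0")
    case False
    interpret w: deriv3_valn D K fls_const "val v" by (rule val_deriv3_valn[OF v])
    have "w.ge (E p + E (conj_fract p)) 0"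
      using v0[OF v] v0'[OF v] by (intro w.ge_add) (auto simp: w.ge_def)
    then show ?thesis using False by (simp add: trace_E w.ge_def val_\<iota>)
  qed simp
  obtain t where t: "2 * fst p = Fract [:t:] 1" using rational_const_of_nonneg[of "2 * fst p"] T by blast
  obtain a where "poly [:n, - t, 1:] a = 0" using alg_closed_imp_poly_has_root[of "[:n, - t, 1:]"] by auto
  then have a: "n = a * (t - a)" by (simp add: algebra_simps add_eq_0_iff)
  have sum: "E p + E (conj_fract p) = fls_const t" by (simp add: trace_E t \<phi>_poly)
  have prod: "E p * E (conj_fract p) = fls_const n" by (simp add: E_norm n \<phi>_poly)
  have "(E p - fls_const a) * (E p - fls_const (t - a)) = E p ^ 2 - fls_const t * E p + fls_const n"
    unfolding a by (simp add: algebra_simps power2_eq_square fls_const_mult_const[symmetric] fls_minus_const[symmetric] del: fls_const_mult_const)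
  also have "\<dots> = 0" unfolding sum[symmetric] prod[symmetric] by (simp add: algebra_simps power2_eq_square)
  finally obtain c where c: "E p = fls_const c" by auto
  have "c \<noteq> 0"
  proof
    assume "c = 0"
    then have "E p = 0" using c by simp
    then show False using p by simp
  qed
  then show ?thesis using that c by blast
qed

end

context hyperelliptic
begin

subsection \<open>Regular differentials\<close>

text \<open>With e the ramification index, dx has order e - 1 over a finite point and -(e + 1) over
  infinity; this is the negative of that order.\<close>

definition different :: "'a option \<Rightarrow> int" where
  "different b = (case b of Some _ \<Rightarrow> 1 - int (ram b) | None \<Rightarrow> int (ram b) + 1)"

text \<open>\<open>\<omega> dx\<close> is regular at \<open>v\<close> iff \<open>v(\<omega>) \<ge> v(dt/dx)\<close> for a uniformizer \<open>t\<close>; by the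
  next lemma the right-hand side is \<^term>\<open>different b\<close>.\<close>

definition regular :: "'a fls set" where
  "regular = {\<omega> \<in> K. \<forall>b. \<forall>v\<in>above b. \<omega> = 0 \<or> different b \<le> val v \<omega>}"

lemma val_D_uniformizer:
  assumes v: "v \<in> above b" and t: "t \<in> K" "t \<noteq> 0" "val v t = 1"
  shows "val v (D t) = different b"
proof -
  interpret w: deriv3_valn D K fls_const "val v" by (rule val_deriv3_valn[OF above_place[OF v]])
  have e: "val v (\<iota> (\<pi> b)) = int (ram b)" using above_\<pi>[OF v] by (simp add: val_\<iota>)
  \<comment> \<open>Ramification is tame, the index being 1 or 2, so the explicit derivative of
    \<pi> determines that of any uniformizer.\<close>
  then have "\<not> 3 dvd val v (\<iota> (\<pi> b))" using ram_cases[of b] by auto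
  then have *: "val v (D (\<iota> (\<pi> b))) = int (ram b) - 1 + val v (D t)"
    using w.w_D_of_not_dvd[OF t, of "\<iota> (\<pi> b)"] e by simp
  show ?thesis
  proof (cases b)
    case (Some r)
    then have "D (\<iota> (\<pi> b)) = 1" by (simp add: \<iota>_\<pi> D_x)
    then show ?thesis using * Some by (simp add: different_def)
  next
    case None
    have x0: "x \<noteq> 0" using \<phi>_eq_0[of base "\<pi> b"] by (simp add: \<iota>_\<pi> None del: \<phi>_eq_0)
    then have "D (\<iota> (\<pi> b)) = - (inverse x ^ 2)"
      using D_inverse[OF x0] by (simp add: \<iota>_\<pi> None D_x field_simps)
    then have "val v (D (\<iota> (\<pi> b))) = val v (\<iota> (\<pi> b) ^ 2)"
      by (simp add: \<iota>_\<pi> None w.K_closed)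
    also have "\<dots> = 2 * int (ram b)" using e w.w_power[of "\<iota> (\<pi> b)" 2] by simp
    finally show ?thesis using * None by (simp add: different_def)
  qed
qed

text \<open>A logarithmic differential has at worst a simple pole, with residue v(f), which is 0 in
  characteristic 3 exactly when 3 divides v(f).\<close>

lemma dvd_3_iff_log_derivative_regular:
  assumes v: "v \<in> above b" and f: "f \<in> K" "f \<noteq> 0"
  shows "3 dvd val v f \<longleftrightarrow> D f / f = 0 \<or> different b \<le> val v (D f / f)"
proof -
  interpret w: deriv3_valn D K fls_const "val v" by (rule val_deriv3_valn[OF above_place[OF v]])
  obtain t where t: "t \<in> K" "t \<noteq> 0" "val v t = 1" using val_uniformizer[OF above_place[OF v]] by blast
  note Dt = val_D_uniformizer[OF v t]
  have quot: "val v (D f / f) = val v (D f) - val v f" if "D f \<noteq> 0"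
    using f that D_in_K by (intro w.w_divide) auto
  show ?thesis
  proof (cases "3 dvd val v f")
    case True
    have "D f = 0 \<or> different b \<le> val v (D f / f)"
      using w.ge_D_of_dvd[OF t f True] quot by (cases "D f = 0") (auto simp: w.ge_def Dt)
    then show ?thesis using True by auto
  next
    case False
    then show ?thesis using w.w_D_of_not_dvd[OF t f False] f quot by (auto simp: Dt)
  qed
qed

lemma val_y:
  assumes v: "v \<in> above b"
  shows "2 * val v y = int (ram b) * ord_pt b F"
proof -
  interpret w: deriv3_valn D K fls_const "val v" by (rule val_deriv3_valn[OF above_place[OF v]])
  have "val v (y ^ 2) = int (ram b) * ord_pt b F"
    unfolding y_square using above_poly[OF v F_neq_0] above_\<pi>[OF v] by simp
  then show ?thesis using w.w_power[of y 2] roots_F_neq_0[OF y_in] by simp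
qed

lemma val_y_cases:
  assumes v: "v \<in> above b"
  shows "b = Some r \<Longrightarrow> val v y = int (ram b) - 1"
    and "b = None \<Longrightarrow> val v y = - (int (ram b) + 2) \<and> ram b = 1 \<or> val v y = - (int (ram b) + 3) \<and> ram b = 2"
proof -
  show "val v y = int (ram b) - 1" if b: "b = Some r"
  proof (cases "poly F r = 0")
    case True
    then show ?thesis using val_y[OF v] order_F[OF True] by (simp add: b ram_def ord_pt_def)
  next
    case False
    then show ?thesis using val_y[OF v] order_0I[OF False] by (simp add: b ram_def ord_pt_def)
  qed
  show "val v y = - (int (ram b) + 2) \<and> ram b = 1 \<or> val v y = - (int (ram b) + 3) \<and> ram b = 2" if b: "b = None"
  proof (cases "Polynomial.degree F = 5")
    case True
    then show ?thesis using val_y[OF v] by (simp add: b ram_def ord_pt_def)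
  next
    case False
    then have "Polynomial.degree F = 6" using deg_F by auto
    then show ?thesis using val_y[OF v] by (simp add: b ram_def ord_pt_def)
  qed
qed

text \<open>At finite points y has the same order as dx. At infinity y has order -3 or -5 according
  to the ramification, which leaves room for exactly degree 1 in the numerator.\<close>

lemma differentials_regular:
  assumes "Polynomial.degree q \<le> 1"
  shows "ev x q / y \<in> regular"
proof (cases "q = 0")
  case True
  then show ?thesis by (simp add: regular_def subfield_0[OF K_subfield])
next
  case False
  have y0: "y \<noteq> 0" using roots_F_neq_0[OF y_in] .
  have q0: "ev x q \<noteq> 0" using ev_\<xi>[OF False] by blast
  have evK: "ev x q \<in> K" by (simp add: ev_\<iota>)
  have "different b \<le> val v (ev x q / y)" if v: "v \<in> above b" for b v
  proof -
    interpret w: deriv3_valn D K fls_const "val v" by (rule val_deriv3_valn[OF above_place[OF v]])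
    have "val v (ev x q / y) = int (ram b) * ord_pt b q - val v y"
      using evK q0 y0 above_poly[OF v False] above_\<pi>[OF v] by (subst w.w_divide) auto
    then show ?thesis
      using val_y_cases[OF v] assms ram_cases[of b] by (cases b) (auto simp: different_def ord_pt_def)
  qed
  then show ?thesis using subfield_divide[OF K_subfield evK y_in_K] by (auto simp: regular_def)
qed

lemma conj_above: "v \<in> above b \<Longrightarrow> v \<circ> conj_fract \<in> above b"
  using conj_place by (auto simp: above_def conj_fract_def)

text \<open>Over a finite point \<open>different\<close> would permit a pole of order up to the
  ramification index minus 1; the order of a rational function is a multiple of that index, so there
  is no pole.\<close>

lemma dvd_int_bound:
  assumes "m dvd (k :: int)" "1 - m \<le> k" "0 < m"
  shows "0 \<le> k"
proof (rule ccontr)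
  assume "\<not> 0 \<le> k"
  then show False using assms zdvd_imp_le[of m "- k"] by auto
qed

text \<open>The trace of a regular differential is regular on the projective line, hence 0. This
  leaves g / y with g rational; regularity at finite points makes g a polynomial, and at infinity it
  bounds the degree.\<close>

lemma regular_imp_differential:
  assumes "\<omega> \<in> regular"
  obtains q where "Polynomial.degree q \<le> 1" "\<omega> = ev x q / y"
proof -
  interpret \<iota>: comm_ring_hom \<iota> by (rule \<phi>_hom)
  have y0: "y \<noteq> 0" using roots_F_neq_0[OF y_in] .
  obtain p where p: "\<omega> = E p" using assms by (auto simp: regular_def K_def)
  have reg: "E p = 0 \<or> different b \<le> v p" if "v \<in> above b" for b v
    using assms that by (auto simp: regular_def p)
  have "2 * fst p = 0"
  proof (rule ccontr)
    assume T0: "2 * fst p \<noteq> 0"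
    have T: "different b \<le> fls_subdegree (\<phi> b (2 * fst p))" for b
    proof -
      obtain v where v: "v \<in> above b" using above_nonempty by blast
      interpret w: deriv3_valn D K fls_const "val v" by (rule val_deriv3_valn[OF above_place[OF v]])
      have "w.ge (E p + E (conj_fract p)) (different b)"
        using reg[OF v] reg[OF conj_above[OF v]] by (intro w.ge_add) (auto simp: w.ge_def)
      then show ?thesis using T0 rational_val[OF v T0] by (simp add: trace_E w.ge_def val_\<iota>)
    qed
    have "2 * fst p = 0 \<or> 0 \<le> fls_subdegree (\<phi> (Some r) (2 * fst p))" for r
      using dvd_int_bound[OF \<phi>_subdegree_dvd[of "Some r" "2 * fst p"]] T[of "Some r"] ram_cases[of "Some r"]
      by (auto simp: different_def)
    then obtain u where u: "2 * fst p = Fract u 1" by (rule rational_poly_of_nonneg)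
    then have u0: "u \<noteq> 0" using T0 by auto
    have "int (ram None) + 1 \<le> int (ram None) * ord_pt None u"
      using T[of None] ev_\<xi>[OF u0, of None] by (simp add: u \<phi>_poly different_def)
    moreover have "int (ram None) * ord_pt None u \<le> 0" by (simp add: ord_pt_def)
    ultimately show False by simp
  qed
  then have "fst p = 0" using two_fract by simp
  define g where "g = snd p * Fract F 1"
  have \<omega>y: "\<omega> * y = \<iota> g"
    using \<open>fst p = 0\<close> by (simp add: p E_def2 g_def \<iota>.hom_mult y_square[symmetric] ev_\<iota>[symmetric] power2_eq_square)
  have \<omega>: "\<omega> = \<iota> g / y" using \<omega>y y0 by (simp add: field_simps)
  show ?thesis
  proof (cases "g = 0")
    case True
    then show ?thesis using that[of 0] \<omega> by simp
  next
    case False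
    then have \<omega>0: "\<omega> \<noteq> 0" using \<omega>y by auto
    have val_g: "v (g, 0) = v p + val v y" if v: "v \<in> above b" for b v
    proof -
      interpret w: deriv3_valn D K fls_const "val v" by (rule val_deriv3_valn[OF above_place[OF v]])
      have "val v (\<omega> * y) = val v \<omega> + val v y" using \<omega>0 y0 p by (intro w.w_mult) auto
      then show ?thesis unfolding \<omega>y val_\<iota> by (simp add: p)
    qed
    have "g = 0 \<or> 0 \<le> fls_subdegree (\<phi> (Some r) g)" for r
    proof -
      obtain v where v: "v \<in> above (Some r)" using above_nonempty by blast
      show ?thesis
        using val_g[OF v] rational_val[OF v False] reg[OF v] \<omega>0 val_y_cases(1)[OF v refl]
        by (auto simp: p different_def)
    qed
    then obtain u where u: "g = Fract u 1" by (rule rational_poly_of_nonneg)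
    then have u0: "u \<noteq> 0" using False by auto
    obtain v where v: "v \<in> above None" using above_nonempty by blast
    have "int (ram None) * ord_pt None u = v p + val v y"
      using val_g[OF v] rational_poly[OF v u0] by (simp add: u)
    moreover have "int (ram None) + 1 \<le> v p" using reg[OF v] \<omega>0 by (auto simp: p different_def)
    ultimately have "Polynomial.degree u \<le> 1"
      using val_y_cases(2)[OF v refl] by (auto simp: ord_pt_def)
    then show ?thesis using that[of u] \<omega> u by (simp add: \<phi>_poly)
  qed
qed

subsection \<open>The Cartier--Manin equations\<close>

definition V :: "('a \<times> 'a) set" where
  "V = {(a, b). a ^ 3 = Polynomial.coeff F 2 * a + Polynomial.coeff F 1 * b \<and>
                b ^ 3 = Polynomial.coeff F 5 * a + Polynomial.coeff F 4 * b}"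

definition \<omega> :: "'a \<times> 'a \<Rightarrow> 'a fls" where
  "\<omega> ab = ev x [:fst ab, snd ab:] / y"

lemma degree_le_6_eq: "Polynomial.coeff F n = 0" if "n > 6"
  using that deg_F by (intro coeff_eq_0) auto

lemma of_nat_mod_3: "(of_nat n :: 'a) = of_nat (n mod 3)"
proof -
  have "(of_nat n :: 'a) = of_nat (3 * (n div 3) + n mod 3)" by simp
  also have "\<dots> = of_nat (n mod 3)" using three_eq_0 by (simp only: of_nat_add of_nat_mult) simp
  finally show ?thesis .
qed

lemma cube_add: "(a + b) ^ 3 = a ^ 3 + b ^ 3" for a b :: "'a poly"
proof -
  have "[:3 :: 'a:] = 0" using three_eq_0 by simp
  then have 3: "(3 :: 'a poly) = 0" by (simp add: numeral_poly)
  have "(a + b) ^ 3 = a ^ 3 + b ^ 3 + 3 * (a ^ 2 * b + a * b ^ 2)"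
    by (simp add: power3_eq_cube power2_eq_square algebra_simps)
  then show ?thesis using 3 by simp
qed

text \<open>The second derivative brings in (n + 1)(n + 2), which is -1 if 3 divides n and 0
  otherwise. As the product has degree at most 7, only n = 0 and n = 3 remain.\<close>

lemma pderiv2_linear_mult_F:
  "pderiv (pderiv ([:a, b:] * F)) =
     [: - (Polynomial.coeff F 2 * a + Polynomial.coeff F 1 * b) :] +
     Polynomial.monom (- (Polynomial.coeff F 5 * a + Polynomial.coeff F 4 * b)) 3" (is "?l = ?r")
proof (rule poly_eqI)
  fix n
  have co: "Polynomial.coeff ([:a, b:] * F) (Suc m) = a * Polynomial.coeff F (Suc m) + b * Polynomial.coeff F m" for m
    by simp
  have l: "Polynomial.coeff ?l n = of_nat (Suc n * Suc (Suc n)) * (a * Polynomial.coeff F (n + 2) + b * Polynomial.coeff F (n + 1))"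
    unfolding coeff_pderiv co by (simp only: of_nat_mult mult.assoc add_2_eq_Suc' Suc_eq_plus1[symmetric])
  consider "n = 0" | "n = 3" | "n \<noteq> 0" "n \<noteq> 3" "n mod 3 = 0" | "n mod 3 \<noteq> 0" by auto
  then show "Polynomial.coeff ?l n = Polynomial.coeff ?r n"
  proof cases
    case 1
    then show ?thesis unfolding l by (simp add: two_eq numeral_2_eq_2[symmetric] algebra_simps)
  next
    case 2
    have k: "of_nat (Suc 3 * Suc (Suc 3)) = (- 1 :: 'a)" using of_nat_mod_3[of 20] by (simp add: two_eq)
    have "Polynomial.coeff [:c:] 3 = 0" for c :: 'a by (simp add: numeral_3_eq_3)
    then show ?thesis unfolding l unfolding 2 k by (simp add: algebra_simps)
  next
    case 3
    then have "n \<ge> 6" by presburger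
    then show ?thesis unfolding l using 3 by (simp add: degree_le_6_eq coeff_pCons split: nat.splits)
  next
    case 4
    then have "Suc n * Suc (Suc n) mod 3 = 0"
    proof -
      have "3 dvd Suc n \<or> 3 dvd Suc (Suc n)" using 4 by presburger
      then have "3 dvd Suc n * Suc (Suc n)" by (elim disjE) (rule dvd_mult2, assumption, rule dvd_mult, assumption)
      then show ?thesis by presburger
    qed
    then have "(of_nat (Suc n * Suc (Suc n)) :: 'a) = 0" using of_nat_mod_3[of "Suc n * Suc (Suc n)"] by simp
    moreover have "n \<noteq> 0" "n \<noteq> 3" using 4 by auto
    ultimately show ?thesis unfolding l by (simp add: coeff_pCons split: nat.splits)
  qed
qed

lemma linear_cube: "[:a, b:] ^ 3 = [:a ^ 3:] + Polynomial.monom (b ^ 3) 3" for a b :: 'a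
proof -
  have "[:a, b:] = [:a:] + Polynomial.monom b 1" by (simp add: monom_altdef)
  then have "[:a, b:] ^ 3 = [:a:] ^ 3 + Polynomial.monom b 1 ^ 3" by (simp only: cube_add)
  then show ?thesis by (simp add: monom_power poly_const_pow)
qed

text \<open>Since y^2 = F, \<omega> is (a + b x) F / y^3 with y^3 a constant for \<open>D\<close>.
  Both \<omega>'' and \<omega>^3 are then polynomials over y^3, with only the coefficients of 1 and
  x^3, and these give the two equations.\<close>

lemma curvature_0_iff: "D (D (\<omega> ab)) + \<omega> ab ^ 3 = 0 \<longleftrightarrow> ab \<in> V"
proof -
  obtain a b where ab: "ab = (a, b)" by (cases ab)
  interpret evx: comm_ring_hom "ev x" by (rule ev_comm_ring_hom)
  have y0: "y \<noteq> 0" using roots_F_neq_0[OF y_in] .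
  have "ev x ([:a, b:] * F) = ev x [:a, b:] * y ^ 2" by (simp only: evx.hom_mult y_square)
  then have "\<omega> ab = ev x ([:a, b:] * F) * inverse y ^ 3"
    using y0 unfolding \<omega>_def ab fst_conv snd_conv
    by (simp only:) (simp add: power3_eq_cube power2_eq_square field_simps del: fls_val.eval_pCons)
  then have "D (D (\<omega> ab)) = ev x (pderiv (pderiv ([:a, b:] * F))) * inverse y ^ 3"
    by (simp only: D_mult D_cube D_ev mult_zero_right add_0_right)
  moreover have "\<omega> ab ^ 3 = ev x ([:a, b:] ^ 3) * inverse y ^ 3"
    by (simp add: \<omega>_def ab evx.hom_power power_mult_distrib divide_inverse del: fls_val.eval_pCons)
  ultimately have "D (D (\<omega> ab)) + \<omega> ab ^ 3 = ev x (pderiv (pderiv ([:a, b:] * F)) + [:a, b:] ^ 3) * inverse y ^ 3"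
    by (simp only: evx.hom_add distrib_right)
  then have "D (D (\<omega> ab)) + \<omega> ab ^ 3 = 0 \<longleftrightarrow> pderiv (pderiv ([:a, b:] * F)) + [:a, b:] ^ 3 = 0"
    using y0 ev_\<xi>[of "pderiv (pderiv ([:a, b:] * F)) + [:a, b:] ^ 3" base] by auto
  also have "\<dots> \<longleftrightarrow> [: a ^ 3 - (Polynomial.coeff F 2 * a + Polynomial.coeff F 1 * b) :] +
     Polynomial.monom (b ^ 3 - (Polynomial.coeff F 5 * a + Polynomial.coeff F 4 * b)) 3 = 0"
    unfolding pderiv2_linear_mult_F linear_cube
    by (intro arg_cong[of _ _ "\<lambda>p. p = 0"] poly_eqI) (simp add: coeff_pCons split: nat.splits)
  also have "\<dots> \<longleftrightarrow> ab \<in> V"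
  proof -
    have "[:s:] + Polynomial.monom t 3 = 0 \<longleftrightarrow> s = 0 \<and> t = 0" for s t :: 'a
    proof
      assume "[:s:] + Polynomial.monom t 3 = 0"
      then have "Polynomial.coeff ([:s:] + Polynomial.monom t 3) 0 = 0" "Polynomial.coeff ([:s:] + Polynomial.monom t 3) 3 = 0"
        by simp_all
      then show "s = 0 \<and> t = 0" by (simp add: coeff_pCons numeral_3_eq_3)
    qed simp
    then show ?thesis by (simp add: V_def ab)
  qed
  finally show ?thesis .
qed

lemma \<omega>_inj: "\<omega> ab = \<omega> cd \<Longrightarrow> ab = cd"
proof -
  assume eq: "\<omega> ab = \<omega> cd"
  interpret evx: comm_ring_hom "ev x" by (rule ev_comm_ring_hom)
  have y0: "y \<noteq> 0" using roots_F_neq_0[OF y_in] .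
  have "ev x [:fst ab, snd ab:] = ev x [:fst cd, snd cd:]"
    using eq y0 by (simp add: \<omega>_def del: fls_val.eval_pCons)
  then have "ev x ([:fst ab, snd ab:] - [:fst cd, snd cd:]) = 0" by (simp only: evx.hom_minus) simp
  then have "[:fst ab, snd ab:] - [:fst cd, snd cd:] = 0" using ev_\<xi> by blast
  then show ?thesis by (simp add: prod_eq_iff)
qed

text \<open>Divisibility by 3 removes all poles of the logarithmic differential, so it is regular
  and has the shape \<open>\<omega> ab\<close>; being logarithmic, it has curvature 0.\<close>

theorem cubic_divisor_log_derivative:
  assumes f: "f \<in> K" "f \<noteq> 0" and div3: "\<And>v. v \<in> places F \<Longrightarrow> 3 dvd val v f"
  obtains ab where "ab \<in> V" "D f = \<omega> ab * f"
proof -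
  have "D f / f \<in> regular"
    using dvd_3_iff_log_derivative_regular[OF _ f] div3 above_place subfield_divide[OF K_subfield D_in_K f(1)] f
    by (auto simp: regular_def)
  then obtain q where q: "Polynomial.degree q \<le> 1" "D f / f = ev x q / y" using regular_imp_differential by blast
  have "q = [:Polynomial.coeff q 0, Polynomial.coeff q 1:]"
    using q(1) by (intro poly_eqI) (auto simp: coeff_pCons coeff_eq_0 split: nat.splits)
  then have \<omega>: "D f / f = \<omega> (Polynomial.coeff q 0, Polynomial.coeff q 1)"
    using q(2) by (simp add: \<omega>_def del: fls_val.eval_pCons)
  then have D: "D f = \<omega> (Polynomial.coeff q 0, Polynomial.coeff q 1) * f" using f(2) by (simp add: field_simps)
  then have "(Polynomial.coeff q 0, Polynomial.coeff q 1) \<in> V"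
    using log_derivative_imp_curvature_0[OF f(2)] curvature_0_iff by blast
  then show ?thesis using that D by blast
qed

text \<open>The solution given by Jacobson's criterion lies in \<open>K\<close> because it is built
  from \<omega>, \<open>D\<close> and a power of x; its divisor is divisible by 3 because \<omega>
  is regular.\<close>

theorem log_derivative_solution:
  assumes ab: "ab \<in> V"
  obtains f where "f \<in> K" "f \<noteq> 0" "D f = \<omega> ab * f" "\<And>v. v \<in> places F \<Longrightarrow> 3 dvd val v f"
proof -
  have reg: "\<omega> ab \<in> regular" unfolding \<omega>_def by (intro differentials_regular) auto
  then have \<omega>K: "\<omega> ab \<in> K" by (simp add: regular_def)
  obtain g where g: "g \<in> {1, x, x ^ 2}"
    "D (D g) - D (\<omega> ab) * g - 2 * \<omega> ab * D g + \<omega> ab ^ 2 * g \<noteq> 0"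
    "D (D (D g) - D (\<omega> ab) * g - 2 * \<omega> ab * D g + \<omega> ab ^ 2 * g) =
       \<omega> ab * (D (D g) - D (\<omega> ab) * g - 2 * \<omega> ab * D g + \<omega> ab ^ 2 * g)"
    using curvature_0_imp_log_derivative[OF _ D_x, of "\<omega> ab"] curvature_0_iff ab by blast
  define f where "f = D (D g) - D (\<omega> ab) * g - 2 * \<omega> ab * D g + \<omega> ab ^ 2 * g"
  note g = g[folded f_def]
  have gK: "g \<in> K" using g(1) subfield_1[OF K_subfield] subfield_power[OF K_subfield x_in_K] by auto
  have twoK: "2 \<in> K" using fls_const_in_K[of 2] by (metis fls_const_numeral)
  have fK: "f \<in> K"
    unfolding f_def using gK \<omega>K twoK D_in_K
    by (intro subfield_add[OF K_subfield] subfield_diff[OF K_subfield] subfield_mult[OF K_subfield] subfield_power[OF K_subfield]) auto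
  have "3 dvd val v f" if v: "v \<in> places F" for v
  proof -
    obtain b where b: "v \<in> above b" using above_exists[OF v] by blast
    have "D f / f = \<omega> ab" using g(2,3) by simp
    then show ?thesis using dvd_3_iff_log_derivative_regular[OF b fK g(2)] reg b by (auto simp: regular_def)
  qed
  then show ?thesis using that[OF fK g(2,3)] by blast
qed

end

subsection \<open>Divisor classes of order 3\<close>

lemma divisor_degree_superset:
  assumes "finite A" "Poly_Mapping.keys D \<subseteq> A"
  shows "divisor_degree D = (\<Sum>v\<in>A. Poly_Mapping.lookup D v)"
  unfolding divisor_degree_def using assms
  by (intro sum.mono_neutral_left) (auto simp: in_keys_iff)

lemma divisor_degree_add: "divisor_degree (D + D') = divisor_degree D + divisor_degree D'"
proof -
  let ?A = "Poly_Mapping.keys D \<union> Poly_Mapping.keys D'"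
  have "finite ?A" "Poly_Mapping.keys (D + D') \<subseteq> ?A" by (simp_all add: Poly_Mapping.keys_add)
  then show ?thesis by (simp add: divisor_degree_superset[of ?A] lookup_add sum.distrib)
qed

lemma divisor_degree_zero [simp]: "divisor_degree 0 = 0"
  by (simp add: divisor_degree_def)

lemma divisor_degree_uminus: "divisor_degree (- D) = - divisor_degree D"
  using divisor_degree_add[of D "- D"] by simp

context
  fixes F :: "'a::alg_closed_field poly"
begin

lemma carrier_degree_zero_divisors [simp]:
  "D \<in> carrier (degree_zero_divisors F) \<longleftrightarrow> Poly_Mapping.keys D \<subseteq> places F \<and> divisor_degree D = 0"
  by (simp add: degree_zero_divisors_def divisor_group_def)

lemma mult_degree_zero_divisors [simp]: "D \<otimes>\<^bsub>degree_zero_divisors F\<^esub> D' = D + D'"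
  by (simp add: degree_zero_divisors_def divisor_group_def)

lemma one_degree_zero_divisors [simp]: "\<one>\<^bsub>degree_zero_divisors F\<^esub> = 0"
  by (simp add: degree_zero_divisors_def divisor_group_def)

lemma comm_group_degree_zero_divisors: "comm_group (degree_zero_divisors F)"
proof (rule comm_groupI)
  fix D D' assume "D \<in> carrier (degree_zero_divisors F)" "D' \<in> carrier (degree_zero_divisors F)"
  then show "D \<otimes>\<^bsub>degree_zero_divisors F\<^esub> D' \<in> carrier (degree_zero_divisors F)"
    using Poly_Mapping.keys_add[of D D'] by (auto simp: divisor_degree_add)
next
  fix D assume "D \<in> carrier (degree_zero_divisors F)"
  then have "- D \<in> carrier (degree_zero_divisors F)" by (simp add: divisor_degree_uminus)
  then show "\<exists>D'\<in>carrier (degree_zero_divisors F). D' \<otimes>\<^bsub>degree_zero_divisors F\<^esub> D = \<one>\<^bsub>degree_zero_divisors F\<^esub>"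
    by (intro bexI[of _ "- D"]) auto
qed (auto simp: add_ac)

lemma cube_degree_zero_divisors: "D [^]\<^bsub>degree_zero_divisors F\<^esub> (3 :: nat) = D + D + D"
  by (simp add: nat_pow_def numeral_3_eq_3)

end

context hyperelliptic
begin

lemma sum_val: "f \<in> K \<Longrightarrow> f \<noteq> 0 \<Longrightarrow> finite {v \<in> places F. val v f \<noteq> 0}"
  and deg_val: "f \<in> K \<Longrightarrow> f \<noteq> 0 \<Longrightarrow> (\<Sum>v\<in>{v \<in> places F. val v f \<noteq> 0}. val v f) = 0"
  using finite_supp deg_principal unfolding K_def deg_def supp_def by auto

lemma val_mult: "v \<in> places F \<Longrightarrow> f \<in> K \<Longrightarrow> g \<in> K \<Longrightarrow> f \<noteq> 0 \<Longrightarrow> g \<noteq> 0 \<Longrightarrow> val v (f * g) = val v f + val v g"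
  by (intro valn.w_mult[OF deriv3_valn.axioms(2)[OF val_deriv3_valn]])

lemma val_1: "v \<in> places F \<Longrightarrow> val v 1 = 0"
  by (rule valn.w_1[OF deriv3_valn.axioms(2)[OF val_deriv3_valn]])

lemma val_inverse: "v \<in> places F \<Longrightarrow> f \<in> K \<Longrightarrow> f \<noteq> 0 \<Longrightarrow> val v (inverse f) = - val v f"
  by (rule valn.w_inverse[OF deriv3_valn.axioms(2)[OF val_deriv3_valn]])

lemma val_cube: "v \<in> places F \<Longrightarrow> h \<in> K \<Longrightarrow> h \<noteq> 0 \<Longrightarrow> val v (h ^ 3) = 3 * val v h"
  unfolding power3_eq_cube using subfield_mult[OF K_subfield] by (simp add: val_mult)

text \<open>One n-th of the divisor of f. The integer division is exact in its uses: n is 1, or n is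
  3 and all values are divisible by 3.\<close>

definition divisor_of :: "int \<Rightarrow> 'a fls \<Rightarrow> 'a divisor" where
  "divisor_of n f = Abs_poly_mapping (\<lambda>v. if v \<in> places F then val v f div n else 0)"

lemma lookup_divisor_of:
  assumes "f \<in> K" "f \<noteq> 0"
  shows "Poly_Mapping.lookup (divisor_of n f) v = (if v \<in> places F then val v f div n else 0)"
proof -
  have "finite {v. (if v \<in> places F then val v f div n else 0) \<noteq> 0}"
    by (rule finite_subset[OF _ sum_val[OF assms]]) auto
  then show ?thesis unfolding divisor_of_def by (subst lookup_Abs_poly_mapping) auto
qed

lemma keys_divisor_of: "f \<in> K \<Longrightarrow> f \<noteq> 0 \<Longrightarrow> Poly_Mapping.keys (divisor_of n f) \<subseteq> {v \<in> places F. val v f \<noteq> 0}"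
  by (auto simp: in_keys_iff lookup_divisor_of split: if_splits)

lemma divisor_of_in_carrier:
  assumes f: "f \<in> K" "f \<noteq> 0" and n: "n \<noteq> 0" "\<And>v. v \<in> places F \<Longrightarrow> n dvd val v f"
  shows "divisor_of n f \<in> carrier (degree_zero_divisors F)"
proof -
  have "n * divisor_degree (divisor_of n f) = (\<Sum>v\<in>{v \<in> places F. val v f \<noteq> 0}. n * (val v f div n))"
    unfolding divisor_degree_superset[OF sum_val[OF f] keys_divisor_of[OF f]]
    by (simp add: lookup_divisor_of[OF f] sum_distrib_left)
  also have "\<dots> = (\<Sum>v\<in>{v \<in> places F. val v f \<noteq> 0}. val v f)" using n by (intro sum.cong) auto
  also have "\<dots> = 0" by (rule deg_val[OF f])
  finally show ?thesis using n(1) keys_divisor_of[OF f] by auto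
qed

lemma principal_divisors_eq: "principal_divisors F = divisor_of 1 ` (K - {0})"
proof -
  have "d \<in> principal_divisors F \<longleftrightarrow>
      Poly_Mapping.keys d \<subseteq> places F \<and> (\<exists>f\<in>K - {0}. \<forall>v\<in>places F. Poly_Mapping.lookup d v = val v f)" for d
  proof -
    have "(\<exists>f\<in>range E - {0}. P f) \<longleftrightarrow> (\<exists>p. p \<noteq> 0 \<and> P (E p))" for P
    proof
      assume "\<exists>f\<in>range E - {0}. P f"
      then obtain p where "E p \<noteq> 0" "P (E p)" by blast
      then show "\<exists>p. p \<noteq> 0 \<and> P (E p)" by (intro exI[of _ p]) simp
    next
      assume "\<exists>p. p \<noteq> 0 \<and> P (E p)"
      then obtain p where "p \<noteq> 0" "P (E p)" by blast
      then show "\<exists>f\<in>range E - {0}. P f" by (intro bexI[of _ "E p"]) simp_all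
    qed
    then show ?thesis
      unfolding principal_divisors_def divisor_group_def K_def
      by (simp add: function_field_def zero_prod_def[symmetric] Bex_def)
  qed
  moreover have "d = divisor_of 1 f \<longleftrightarrow> Poly_Mapping.keys d \<subseteq> places F \<and> (\<forall>v\<in>places F. Poly_Mapping.lookup d v = val v f)"
    if "f \<in> K - {0}" for d f
    using that by (auto simp: poly_mapping_eq_iff fun_eq_iff lookup_divisor_of in_keys_iff)
  ultimately show ?thesis by blast
qed

lemma divisor_of_mult:
  assumes "f \<in> K" "f \<noteq> 0" "g \<in> K" "g \<noteq> 0"
  shows "divisor_of 1 (f * g) = divisor_of 1 f + divisor_of 1 g"
  by (rule poly_mapping_eqI)
    (use assms subfield_mult[OF K_subfield] in \<open>simp add: lookup_divisor_of lookup_add val_mult\<close>)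

lemma divisor_of_inverse:
  assumes "f \<in> K" "f \<noteq> 0"
  shows "divisor_of 1 (inverse f) = - divisor_of 1 f"
  by (rule poly_mapping_eqI)
    (use assms subfield_inverse[OF K_subfield] in \<open>simp add: lookup_divisor_of val_inverse\<close>)

lemma divisor_of_3:
  assumes "f \<in> K" "f \<noteq> 0" "\<And>v. v \<in> places F \<Longrightarrow> 3 dvd val v f"
  shows "divisor_of 3 f + divisor_of 3 f + divisor_of 3 f = divisor_of 1 f"
proof (rule poly_mapping_eqI)
  fix v
  have "v \<in> places F \<Longrightarrow> val v f = 3 * (val v f div 3)" using assms(3) by simp
  then show "Poly_Mapping.lookup (divisor_of 3 f + divisor_of 3 f + divisor_of 3 f) v = Poly_Mapping.lookup (divisor_of 1 f) v"
    using assms by (auto simp: lookup_divisor_of lookup_add)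
qed

lemma subgroup_principal_divisors: "subgroup (principal_divisors F) (degree_zero_divisors F)"
proof -
  interpret M: comm_group "degree_zero_divisors F" by (rule comm_group_degree_zero_divisors)
  have in_carrier: "divisor_of 1 f \<in> carrier (degree_zero_divisors F)" if "f \<in> K - {0}" for f
    using that by (intro divisor_of_in_carrier) auto
  show ?thesis
  proof (rule M.subgroupI)
    show "principal_divisors F \<subseteq> carrier (degree_zero_divisors F)"
      unfolding principal_divisors_eq using in_carrier by blast
    show "principal_divisors F \<noteq> {}"
      unfolding principal_divisors_eq using subfield_1[OF K_subfield] by auto
  next
    fix d assume "d \<in> principal_divisors F"
    then obtain f where f: "f \<in> K - {0}" "d = divisor_of 1 f" by (auto simp: principal_divisors_eq)
    have inv: "inverse f \<in> K - {0}" using f subfield_inverse[OF K_subfield] by auto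
    have "divisor_of 1 (inverse f) \<otimes>\<^bsub>degree_zero_divisors F\<^esub> d = \<one>\<^bsub>degree_zero_divisors F\<^esub>"
      using f by (simp add: divisor_of_inverse)
    then have "inv\<^bsub>degree_zero_divisors F\<^esub> d = divisor_of 1 (inverse f)"
      using M.inv_equality in_carrier f inv by metis
    then show "inv\<^bsub>degree_zero_divisors F\<^esub> d \<in> principal_divisors F" using inv by (simp add: principal_divisors_eq)
  next
    fix d d' assume "d \<in> principal_divisors F" "d' \<in> principal_divisors F"
    then obtain f g where fg: "f \<in> K - {0}" "d = divisor_of 1 f" "g \<in> K - {0}" "d' = divisor_of 1 g"
      by (auto simp: principal_divisors_eq)
    then have "d + d' = divisor_of 1 (f * g)" by (simp add: divisor_of_mult)
    moreover have "f * g \<in> K - {0}" using fg subfield_mult[OF K_subfield] by auto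
    ultimately show "d \<otimes>\<^bsub>degree_zero_divisors F\<^esub> d' \<in> principal_divisors F" by (simp add: principal_divisors_eq)
  qed
qed

lemma normal_principal_divisors: "principal_divisors F \<lhd> degree_zero_divisors F"
  by (rule comm_group.subgroup_imp_normal[OF comm_group_degree_zero_divisors subgroup_principal_divisors])

definition div_class :: "'a divisor \<Rightarrow> 'a divisor set" where
  "div_class d = r_coset (degree_zero_divisors F) (principal_divisors F) d"

lemma div_class_eq: "div_class d = (\<lambda>f. divisor_of 1 f + d) ` (K - {0})"
  by (auto simp: div_class_def r_coset_def principal_divisors_eq)

lemma divisor_of_1 [simp]: "divisor_of n 1 = 0"
  by (rule poly_mapping_eqI) (simp add: lookup_divisor_of subfield_1[OF K_subfield] val_1)

lemma div_class_eqD: "div_class d = div_class d' \<Longrightarrow> \<exists>h\<in>K - {0}. d = divisor_of 1 h + d'"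
proof -
  assume eq: "div_class d = div_class d'"
  have "divisor_of 1 1 + d \<in> div_class d" unfolding div_class_eq
    by (rule image_eqI[where x = 1]) (use subfield_1[OF K_subfield] in simp_all)
  then show ?thesis using eq by (auto simp: div_class_eq)
qed

lemma div_class_eqI: 
  assumes h: "h \<in> K - {0}" and d: "d = divisor_of 1 h + d'"
  shows "div_class d = div_class d'"
proof (intro equalityI subsetI)
  fix P assume "P \<in> div_class d"
  then obtain f where f: "f \<in> K - {0}" "P = divisor_of 1 f + d" by (auto simp: div_class_eq)
  then have "P = divisor_of 1 (f * h) + d'" using h d by (simp add: divisor_of_mult add.assoc)
  moreover have "f * h \<in> K - {0}" using f h subfield_mult[OF K_subfield] by auto
  ultimately show "P \<in> div_class d'" by (auto simp: div_class_eq)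
next
  fix P assume "P \<in> div_class d'"
  then obtain f where f: "f \<in> K - {0}" "P = divisor_of 1 f + d'" by (auto simp: div_class_eq)
  have h': "inverse h \<in> K - {0}" using h subfield_inverse[OF K_subfield] by auto
  have "P = divisor_of 1 (f * inverse h) + d" using f h h' d by (simp add: divisor_of_mult divisor_of_inverse)
  moreover have "f * inverse h \<in> K - {0}" using f h' subfield_mult[OF K_subfield] by auto
  ultimately show "P \<in> div_class d" by (auto simp: div_class_eq)
qed

lemma torsion_Pic0_3_eq:
  "carrier (torsion (Pic0 F) 3) =
     div_class ` {d \<in> carrier (degree_zero_divisors F). d + d + d \<in> principal_divisors F}"
proof -
  interpret N: normal "principal_divisors F" "degree_zero_divisors F" by (rule normal_principal_divisors)
  have pow: "div_class d [^]\<^bsub>Pic0 F\<^esub> (3 :: nat) = \<one>\<^bsub>Pic0 F\<^esub> \<longleftrightarrow> d + d + d \<in> principal_divisors F"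
    if d: "d \<in> carrier (degree_zero_divisors F)" for d
  proof -
    have D3: "d + d + d \<in> carrier (degree_zero_divisors F)"
      using N.m_closed[OF N.m_closed[OF d d] d] by simp
    have "div_class d [^]\<^bsub>Pic0 F\<^esub> (3 :: nat) = r_coset (degree_zero_divisors F) (principal_divisors F) (d + d + d)"
      unfolding div_class_def Pic0_def N.FactGroup_pow[OF d] cube_degree_zero_divisors ..
    then show ?thesis
      using N.coset_join1[OF _ D3] N.coset_join2[OF D3 N.subgroup_axioms] N.subset N.subgroup_axioms
      by (auto simp: Pic0_def)
  qed
  have "carrier (torsion (Pic0 F) 3) = {P \<in> carrier (Pic0 F). P [^]\<^bsub>Pic0 F\<^esub> (3 :: nat) = \<one>\<^bsub>Pic0 F\<^esub>}"
    by (simp add: torsion_def)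
  also have "carrier (Pic0 F) = div_class ` carrier (degree_zero_divisors F)"
    by (simp add: Pic0_def carrier_FactGroup div_class_def)
  also have "{P \<in> \<dots>. P [^]\<^bsub>Pic0 F\<^esub> (3 :: nat) = \<one>\<^bsub>Pic0 F\<^esub>} =
      div_class ` {d \<in> carrier (degree_zero_divisors F). div_class d [^]\<^bsub>Pic0 F\<^esub> (3 :: nat) = \<one>\<^bsub>Pic0 F\<^esub>}" by auto
  also have "{d \<in> carrier (degree_zero_divisors F). div_class d [^]\<^bsub>Pic0 F\<^esub> (3 :: nat) = \<one>\<^bsub>Pic0 F\<^esub>} =
      {d \<in> carrier (degree_zero_divisors F). d + d + d \<in> principal_divisors F}" by (rule Collect_cong) (use pow in metis)
  finally show ?thesis .
qed

definition log_solution :: "'a \<times> 'a \<Rightarrow> 'a fls" where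
  "log_solution ab = (SOME f. f \<in> K \<and> f \<noteq> 0 \<and> D f = \<omega> ab * f \<and> (\<forall>v\<in>places F. 3 dvd val v f))"

lemma log_solution:
  assumes "ab \<in> V"
  shows "log_solution ab \<in> K" "log_solution ab \<noteq> 0" "D (log_solution ab) = \<omega> ab * log_solution ab"
    "\<And>v. v \<in> places F \<Longrightarrow> 3 dvd val v (log_solution ab)"
proof -
  have "\<exists>f. f \<in> K \<and> f \<noteq> 0 \<and> D f = \<omega> ab * f \<and> (\<forall>v\<in>places F. 3 dvd val v f)"
    using log_derivative_solution[OF assms] by metis
  from someI_ex[OF this]
  have "log_solution ab \<in> K \<and> log_solution ab \<noteq> 0 \<and> D (log_solution ab) = \<omega> ab * log_solution ab \<and>
    (\<forall>v\<in>places F. 3 dvd val v (log_solution ab))" unfolding log_solution_def .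
  then show "log_solution ab \<in> K" "log_solution ab \<noteq> 0" "D (log_solution ab) = \<omega> ab * log_solution ab"
    "\<And>v. v \<in> places F \<Longrightarrow> 3 dvd val v (log_solution ab)" by blast+
qed

text \<open>A class of order dividing 3 corresponds to the logarithmic derivative of a generator of
  \<open>3 d\<close>; this is well defined because cubes and constants have derivative zero.\<close>

lemma bij_betw_torsion: "bij_betw (\<lambda>ab. div_class (divisor_of 3 (log_solution ab))) V (carrier (torsion (Pic0 F) 3))"
  unfolding bij_betw_def
proof
  show "inj_on (\<lambda>ab. div_class (divisor_of 3 (log_solution ab))) V"
  proof (rule inj_onI)
    fix ab cd assume V: "ab \<in> V" "cd \<in> V"
      and eq: "div_class (divisor_of 3 (log_solution ab)) = div_class (divisor_of 3 (log_solution cd))"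
    define f where "f = log_solution ab"
    define g where "g = log_solution cd"
    note f = log_solution[OF V(1), folded f_def] and g = log_solution[OF V(2), folded g_def]
    obtain h where h: "h \<in> K" "h \<noteq> 0" "divisor_of 3 f = divisor_of 1 h + divisor_of 3 g"
      using div_class_eqD[OF eq[folded f_def g_def]] by auto
    \<comment> \<open>Equal classes mean that f and g h^3 have the same divisor. Their quotient is
      then a constant, so f and g have the same logarithmic derivative.\<close>
    define z where "z = f * inverse (g * h ^ 3)"
    have gh: "g * h ^ 3 \<in> K" "g * h ^ 3 \<noteq> 0" "h ^ 3 \<in> K"
      using g h subfield_mult[OF K_subfield] subfield_power[OF K_subfield] by auto
    have z: "z \<in> K" unfolding z_def by (rule subfield_mult[OF K_subfield f(1) subfield_inverse[OF K_subfield gh(1)]])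
    have z0: "z \<noteq> 0" using f(2) gh(2) by (simp add: z_def)
    have valz: "val v z = 0" if v: "v \<in> places F" for v
    proof -
      have "val v f div 3 = val v h + val v g div 3"
        using arg_cong[OF h(3), of "\<lambda>d. Poly_Mapping.lookup d v"] f(1,2) g(1,2) h(1,2) v
        by (simp add: lookup_divisor_of lookup_add)
      then have "val v f = 3 * val v h + val v g" using f(4)[OF v] g(4)[OF v] by presburger
      moreover have "val v z = val v f - (val v g + 3 * val v h)"
      proof -
        have "val v z = val v f + val v (inverse (g * h ^ 3))"
          unfolding z_def using gh(2) by (intro val_mult[OF v f(1) subfield_inverse[OF K_subfield gh(1)] f(2)]) simp
        also have "\<dots> = val v f - val v (g * h ^ 3)" by (simp only: val_inverse[OF v gh(1,2)] diff_conv_add_uminus)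
        also have "val v (g * h ^ 3) = val v g + 3 * val v h" using v g(1,2) h(1,2) gh(3) by (simp add: val_mult val_cube)
        finally show ?thesis .
      qed
      ultimately show ?thesis by simp
    qed
    obtain p where p: "z = E p" using z by (auto simp: K_def)
    then obtain c where c: "z = fls_const c"
      using trivial_divisor_const[of p] valz z0 by (metis E_eq_0 val_E)
    have "f = z * (g * h ^ 3)" unfolding z_def using gh(2) by (simp only: mult.assoc field_class.field_inverse[OF gh(2)] mult_1_right)
    then have f_eq: "f = fls_const c * (g * h ^ 3)" by (simp only: c)
    have Df: "D f = fls_const c * (D g * h ^ 3)"
      unfolding f_eq D_mult D_cube by (simp only: fls_deriv_const mult_zero_left mult_zero_right add_0_right add_0_left mult_1_left)
    have "\<omega> ab * f = fls_const c * (D g * h ^ 3)" using Df unfolding f(3) .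
    also have "\<dots> = \<omega> cd * f" unfolding g(3) f_eq by (simp only: mult_ac)
    finally show "ab = cd" using f(2) \<omega>_inj by simp
  qed
next
  show "(\<lambda>ab. div_class (divisor_of 3 (log_solution ab))) ` V = carrier (torsion (Pic0 F) 3)"
  proof (intro equalityI subsetI)
    fix P assume "P \<in> (\<lambda>ab. div_class (divisor_of 3 (log_solution ab))) ` V"
    then obtain ab where ab: "ab \<in> V" "P = div_class (divisor_of 3 (log_solution ab))" by blast
    note f = log_solution[OF ab(1)]
    have "divisor_of 3 (log_solution ab) \<in> carrier (degree_zero_divisors F)"
      using f by (intro divisor_of_in_carrier) auto
    moreover have "divisor_of 1 (log_solution ab) \<in> principal_divisors F"
      using f by (auto simp: principal_divisors_eq)
    ultimately show "P \<in> carrier (torsion (Pic0 F) 3)"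
      unfolding torsion_Pic0_3_eq ab(2) using divisor_of_3[OF f(1,2,4)] by auto
  next
    fix P assume "P \<in> carrier (torsion (Pic0 F) 3)"
    then obtain d0 where d0: "d0 \<in> carrier (degree_zero_divisors F)" "d0 + d0 + d0 \<in> principal_divisors F" "P = div_class d0"
      by (auto simp: torsion_Pic0_3_eq)
    then obtain f where f: "f \<in> K" "f \<noteq> 0" "d0 + d0 + d0 = divisor_of 1 f" by (auto simp: principal_divisors_eq)
    have val_f: "val v f = 3 * Poly_Mapping.lookup d0 v" if "v \<in> places F" for v
      using arg_cong[OF f(3), of "\<lambda>d. Poly_Mapping.lookup d v"] f(1,2) that by (simp add: lookup_divisor_of lookup_add)
    then obtain ab where ab: "ab \<in> V" "D f = \<omega> ab * f"
      using cubic_divisor_log_derivative[OF f(1,2)] by (metis dvd_triv_left)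
    define g where "g = log_solution ab"
    note g = log_solution[OF ab(1), folded g_def]
    \<comment> \<open>Both functions solve the equation with the same \<omega>, so the quotient has
      derivative 0 and is a cube h^3; a third of the divisors shows that \<open>d0\<close> differs
      from that of \<open>g\<close> by div h.\<close>
    define q where "q = f * inverse g"
    have fq: "f = q * g" using g by (simp add: q_def)
    have q: "q \<in> K" "q \<noteq> 0"
      using f g subfield_mult[OF K_subfield] subfield_inverse[OF K_subfield] by (auto simp: q_def)
    have "D q * g + q * D g = \<omega> ab * (q * g)" using ab(2) unfolding fq D_mult by (simp add: add.commute mult.commute)
    then have "D q * g = 0" using g(3) by (simp add: mult_ac)
    then have "D q = 0" using g by simp
    then obtain h where h: "h \<in> K" "q = h ^ 3" using D_eq_0_cube q by blast
    then have h0: "h \<noteq> 0" using q by auto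
    have "d0 = divisor_of 1 h + divisor_of 3 g"
    proof (rule poly_mapping_eqI)
      fix v
      show "Poly_Mapping.lookup d0 v = Poly_Mapping.lookup (divisor_of 1 h + divisor_of 3 g) v"
      proof (cases "v \<in> places F")
        case True
        have "3 * Poly_Mapping.lookup d0 v = 3 * val v h + val v g"
          using val_f[OF True] q g h h0 True unfolding fq h(2) by (simp add: val_mult val_cube)
        then show ?thesis using True h h0 g by (simp add: lookup_divisor_of lookup_add)
      next
        case False
        then have "Poly_Mapping.lookup d0 v = 0" using d0(1) by (auto simp: in_keys_iff)
        then show ?thesis using False h h0 g by (simp add: lookup_divisor_of lookup_add)
      qed
    qed
    then have "P = div_class (divisor_of 3 g)" using div_class_eqI[of h] h h0 d0(3) by simp
    then show "P \<in> (\<lambda>ab. div_class (divisor_of 3 (log_solution ab))) ` V" using ab g_def by blast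
  qed
qed

lemma card_torsion: "card (carrier (torsion (Pic0 F) 3)) = card V"
  using bij_betw_same_card[OF bij_betw_torsion] by simp

lemma group_torsion: "group (torsion (Pic0 F) 3)"
proof -
  interpret N: normal "principal_divisors F" "degree_zero_divisors F" by (rule normal_principal_divisors)
  interpret Q: comm_group "Pic0 F"
    unfolding Pic0_def by (rule comm_group.abelian_FactGroup[OF comm_group_degree_zero_divisors subgroup_principal_divisors])
  have "subgroup {P \<in> carrier (Pic0 F). P [^]\<^bsub>Pic0 F\<^esub> (3 :: nat) = \<one>\<^bsub>Pic0 F\<^esub>} (Pic0 F)"
  proof (rule Q.subgroupI, goal_cases)
    case 2
    have "\<one>\<^bsub>Pic0 F\<^esub> \<in> {P \<in> carrier (Pic0 F). P [^]\<^bsub>Pic0 F\<^esub> (3 :: nat) = \<one>\<^bsub>Pic0 F\<^esub>}"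
      by (intro CollectI conjI Q.one_closed Q.nat_pow_one)
    then show ?case by blast
  next
    case (3 P)
    then have "P \<in> carrier (Pic0 F)" "P [^]\<^bsub>Pic0 F\<^esub> (3 :: nat) = \<one>\<^bsub>Pic0 F\<^esub>" by blast+
    then show ?case by (intro CollectI conjI Q.inv_closed) (simp_all only: Q.nat_pow_inv Q.inv_one)
  next
    case (4 P Q)
    then have P: "P \<in> carrier (Pic0 F)" "P [^]\<^bsub>Pic0 F\<^esub> (3 :: nat) = \<one>\<^bsub>Pic0 F\<^esub>"
      and Q: "Q \<in> carrier (Pic0 F)" "Q [^]\<^bsub>Pic0 F\<^esub> (3 :: nat) = \<one>\<^bsub>Pic0 F\<^esub>" by blast+
    then show ?case
      using Q.pow_mult_distrib[OF Q.m_comm[OF P(1) Q(1)] P(1) Q(1), of 3]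
      by (intro CollectI conjI Q.m_closed) (simp_all only: Q.r_one Q.one_closed)
  qed blast
  then show ?thesis unfolding torsion_def by (rule Q.subgroup_imp_group)
qed

lemma torsion_exponent:
  assumes "P \<in> carrier (torsion (Pic0 F) 3)"
  shows "P [^]\<^bsub>torsion (Pic0 F) 3\<^esub> (3 :: nat) = \<one>\<^bsub>torsion (Pic0 F) 3\<^esub>"
  using assms by (auto simp: torsion_def nat_pow_def)

end

subsection \<open>Solutions of the Cartier--Manin equations\<close>

text \<open>Counting decides the isomorphism type: exponent 3 makes powers of a nontrivial g depend
  only on the exponent modulo 3, and its three powers are distinct.\<close>

lemma (in group) iso_cyclic_3_iff:
  assumes exponent: "\<And>g. g \<in> carrier G \<Longrightarrow> g [^] (3 :: nat) = \<one>"
  shows "G \<cong> product_group {..<1 :: nat} (\<lambda>_. integer_mod_group 3) \<longleftrightarrow> card (carrier G) = 3"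
proof -
  define C where "C = product_group {..<1 :: nat} (\<lambda>_. integer_mod_group 3)"
  have carr: "carrier C = ({0 :: nat} \<rightarrow>\<^sub>E {0 :: int..<3})"
    by (simp add: C_def carrier_integer_mod_group lessThan_Suc)
  have cardC: "card (carrier C) = 3" by (simp add: carr card_PiE)
  have groupC: "group C" by (simp add: C_def)
  have "G \<cong> C" if card3: "card (carrier G) = 3"
  proof -
    have "\<exists>g\<in>carrier G. g \<noteq> \<one>"
    proof (rule ccontr)
      assume "\<not> ?thesis"
      then have "carrier G = {\<one>}" by auto
      then show False using card3 by simp
    qed
    then obtain g where g: "g \<in> carrier G" "g \<noteq> \<one>" by blast
    have g3: "g [^] (3 :: int) = \<one>" using exponent[OF g(1)] int_pow_int[of G g 3] by simp
    have mod: "g [^] (n mod 3 :: int) = g [^] n" for n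
    proof -
      have "g [^] n = g [^] (3 * (n div 3) + n mod 3)" by simp
      also have "\<dots> = (g [^] (3 :: int)) [^] (n div 3) \<otimes> g [^] (n mod 3)"
        using g(1) by (simp only: int_pow_mult int_pow_pow)
      finally show ?thesis using g g3 by simp
    qed
    have g2: "g [^] (2 :: int) \<noteq> \<one>"
    proof
      assume "g [^] (2 :: int) = \<one>"
      then have "g [^] (3 :: int) = g" using g(1) int_pow_mult[of g 2 1] by simp
      then show False using g g3 by simp
    qed
    define h where "h = (\<lambda>f :: nat \<Rightarrow> int. g [^] f 0)"
    have "h \<in> hom C G"
    proof (rule homI)
      show "h f \<in> carrier G" for f using g by (simp add: h_def)
      show "h (f \<otimes>\<^bsub>C\<^esub> f') = h f \<otimes> h f'" for f f'
        using g by (simp add: h_def C_def mod int_pow_mult)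
    qed
    moreover have "inj_on h (carrier C)"
    proof (rule inj_onI)
      fix f f' assume ff: "f \<in> carrier C" "f' \<in> carrier C" and eq: "h f = h f'"
      have r: "f 0 \<in> {0, 1, 2}" "f' 0 \<in> {0, 1, 2}" using ff by (fastforce simp: carr PiE_iff)+
      have "g [^] (f 0 - f' 0) = \<one>" using eq g by (simp add: h_def int_pow_diff)
      then have "g [^] ((f 0 - f' 0) mod 3) = \<one>" using mod by simp
      then have "f 0 = f' 0" using r g g2 by auto
      then show "f = f'" using ff by (intro PiE_ext[of f "{0}" "\<lambda>_. {0..<3}" f']) (auto simp: carr)
    qed
    moreover have "h ` carrier C = carrier G"
    proof (rule card_subset_eq)
      show "finite (carrier G)" using card3 by (metis card.infinite zero_neq_numeral)
      show "h ` carrier C \<subseteq> carrier G" using g by (auto simp: h_def)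
      show "card (h ` carrier C) = card (carrier G)"
        using \<open>inj_on h (carrier C)\<close> cardC card3 by (simp add: card_image)
    qed
    ultimately have "h \<in> iso C G" by (simp add: iso_def bij_betw_def)
    then show ?thesis using group.iso_sym[OF groupC] by (auto simp: is_iso_def)
  qed
  moreover have "card (carrier G) = 3" if "G \<cong> C"
    using that cardC by (auto simp: is_iso_def iso_def dest: bij_betw_same_card)
  ultimately show ?thesis unfolding C_def by blast
qed

definition frobenius_fixed :: "'a::comm_ring_1 \<Rightarrow> 'a \<Rightarrow> 'a \<Rightarrow> 'a \<Rightarrow> ('a \<times> 'a) set" where
  "frobenius_fixed \<alpha> \<beta> \<gamma> \<delta> = {(a, b). a ^ 3 = \<alpha> * a + \<beta> * b \<and> b ^ 3 = \<gamma> * a + \<delta> * b}"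

context
  assumes char3: "CHAR('a::alg_closed_field) = 3"
begin

lemma three_0: "(3 :: 'a) = 0"
  using char3 of_nat_CHAR[where 'a = 'a] by simp

lemma cube_sum: "(a + b) ^ 3 = a ^ 3 + b ^ 3" for a b :: 'a
proof -
  have "(a + b) ^ 3 = a ^ 3 + b ^ 3 + 3 * (a ^ 2 * b + a * b ^ 2)"
    by (simp add: power3_eq_cube power2_eq_square algebra_simps)
  then show ?thesis using three_0 by simp
qed

lemma cube_inj: "a ^ 3 = b ^ 3 \<longleftrightarrow> a = b" for a b :: 'a
proof
  assume "a ^ 3 = b ^ 3"
  then have "(a - b) ^ 3 = 0" using cube_sum[of "a - b" b] by simp
  then show "a = b" by simp
qed simp

lemma two_not_0: "(2 :: 'a) \<noteq> 0"
proof
  assume two: "(2 :: 'a) = 0"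
  have "(1 :: 'a) = 3 - 2" by simp
  also have "\<dots> = 0 - 0" by (simp only: three_0 two)
  finally show False by simp
qed

lemma neq_uminus: "s \<noteq> 0 \<Longrightarrow> s \<noteq> - s" for s :: 'a
proof
  assume s: "s \<noteq> 0" "s = - s"
  then have "2 * s = 0" by (metis add.right_inverse mult_2)
  then show False using s two_not_0 by simp
qed

lemma sqrt_exists: "\<exists>s. s ^ 2 = (d :: 'a)"
  using nth_root_exists[of 2 d] by auto

lemma cbrt_exists: "\<exists>s. s ^ 3 = (d :: 'a)"
  using nth_root_exists[of 3 d] by auto

lemma card_cubic: "card {\<mu> :: 'a. \<mu> ^ 3 = d * \<mu>} = 3 \<longleftrightarrow> d \<noteq> 0"
proof (cases "d = 0")
  case True
  then have "{\<mu> :: 'a. \<mu> ^ 3 = d * \<mu>} = {0}" by auto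
  then show ?thesis using True by simp
next
  case False
  obtain s where s: "s ^ 2 = d" using sqrt_exists by blast
  then have s0: "s \<noteq> 0" using False by auto
  have "\<mu> ^ 3 = d * \<mu> \<longleftrightarrow> \<mu> = 0 \<or> \<mu> = s \<or> \<mu> = - s" for \<mu>
  proof -
    have "\<mu> ^ 3 - d * \<mu> = \<mu> * (\<mu> - s) * (\<mu> + s)"
      unfolding s[symmetric] by (simp add: power3_eq_cube power2_eq_square algebra_simps)
    then have "\<mu> ^ 3 = d * \<mu> \<longleftrightarrow> \<mu> * (\<mu> - s) * (\<mu> + s) = 0" by (metis eq_iff_diff_eq_0)
    then show ?thesis by (simp add: eq_neg_iff_add_eq_0)
  qed
  then have "{\<mu> :: 'a. \<mu> ^ 3 = d * \<mu>} = {0, s, - s}" by auto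
  then show ?thesis using False s0 neq_uminus[OF s0] by simp
qed

text \<open>In rank one, \<open>A = u v\<^sup>T\<close>, the solutions of \<open>w\<^sup>(\<^sup>3\<^sup>) = A w\<close> are \<open>w = \<mu> (p, q)\<close> with \<open>p\<^sup>3 = u\<^sub>1\<close>,
  \<open>q\<^sup>3 = u\<^sub>2\<close> and \<open>\<mu>\<^sup>3 = (v\<^sub>1 p + v\<^sub>2 q) \<mu>\<close>.\<close>

lemma card_frobenius_fixed_rank_1:
  assumes u: "p ^ 3 = (u1 :: 'a)" "q ^ 3 = u2" "(u1, u2) \<noteq> (0, 0)"
  shows "card (frobenius_fixed (u1 * v1) (u1 * v2) (u2 * v1) (u2 * v2)) = 3 \<longleftrightarrow> v1 ^ 3 * u1 + v2 ^ 3 * u2 \<noteq> 0"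
proof -
  define d where "d = v1 * p + v2 * q"
  have pq: "(p, q) \<noteq> (0, 0)" using u by auto
  have "frobenius_fixed (u1 * v1) (u1 * v2) (u2 * v1) (u2 * v2) = (\<lambda>\<mu>. (p * \<mu>, q * \<mu>)) ` {\<mu>. \<mu> ^ 3 = d * \<mu>}"
  proof (intro equalityI subsetI)
    fix ab assume "ab \<in> frobenius_fixed (u1 * v1) (u1 * v2) (u2 * v1) (u2 * v2)"
    then obtain a b where ab: "ab = (a, b)" "a ^ 3 = u1 * (v1 * a + v2 * b)" "b ^ 3 = u2 * (v1 * a + v2 * b)"
      by (auto simp: frobenius_fixed_def algebra_simps)
    obtain \<mu> where \<mu>: "\<mu> ^ 3 = v1 * a + v2 * b" using cbrt_exists by blast
    have "a ^ 3 = (p * \<mu>) ^ 3" "b ^ 3 = (q * \<mu>) ^ 3" using ab \<mu> u by (simp_all add: power_mult_distrib)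
    then have "a = p * \<mu>" "b = q * \<mu>" by (simp_all only: cube_inj)
    moreover from this have "\<mu> ^ 3 = d * \<mu>" using \<mu> by (simp add: d_def algebra_simps)
    ultimately show "ab \<in> (\<lambda>\<mu>. (p * \<mu>, q * \<mu>)) ` {\<mu>. \<mu> ^ 3 = d * \<mu>}" using ab by auto
  next
    fix ab assume "ab \<in> (\<lambda>\<mu>. (p * \<mu>, q * \<mu>)) ` {\<mu>. \<mu> ^ 3 = d * \<mu>}"
    then show "ab \<in> frobenius_fixed (u1 * v1) (u1 * v2) (u2 * v1) (u2 * v2)"
      by (auto simp: frobenius_fixed_def d_def power_mult_distrib u algebra_simps)
  qed
  moreover have "inj_on (\<lambda>\<mu>. (p * \<mu>, q * \<mu>)) {\<mu>. \<mu> ^ 3 = d * \<mu>}" using pq by (intro inj_onI) auto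
  ultimately have "card (frobenius_fixed (u1 * v1) (u1 * v2) (u2 * v1) (u2 * v2)) = 3 \<longleftrightarrow> d \<noteq> 0"
    using card_cubic[of d] by (simp add: card_image)
  moreover have d3: "d ^ 3 = v1 ^ 3 * u1 + v2 ^ 3 * u2" by (simp add: d_def cube_sum power_mult_distrib u)
  have "v1 ^ 3 * u1 + v2 ^ 3 * u2 = 0 \<longleftrightarrow> d = 0" unfolding d3[symmetric] by simp
  ultimately show ?thesis by blast
qed

lemma card_neq_3:
  assumes "{x1, x2, x3, x4} \<subseteq> A" "distinct [x1, x2, x3, x4]"
  shows "card A \<noteq> 3"
proof
  assume A: "card A = 3"
  then have "finite A" by (metis card.infinite zero_neq_numeral)
  then have "card {x1, x2, x3, x4} \<le> card A" using assms(1) by (intro card_mono) auto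
  then show False using assms(2) A by simp
qed

text \<open>In characteristic 3 the derivative is X^3 + e, and the quartic minus X times its
  derivative is the nonzero constant \<open>f\<close>, so no root is repeated.\<close>

lemma two_quartic_roots:
  assumes f: "f \<noteq> (0 :: 'a)"
  obtains s t where "s ^ 4 + e * s + f = 0" "t ^ 4 + e * t + f = 0" "s \<noteq> t"
proof -
  have "Polynomial.degree [:f, e, 0, 0, 1:] > 0" by simp
  then obtain s where "poly [:f, e, 0, 0, 1:] s = 0" using alg_closed_imp_poly_has_root by blast
  then have s: "s ^ 4 + e * s + f = 0" by (simp add: algebra_simps power4_eq_xxxx)
  have "Polynomial.degree [:s ^ 3 + e, s ^ 2, s, 1:] > 0" by simp
  then obtain t where "poly [:s ^ 3 + e, s ^ 2, s, 1:] t = 0" using alg_closed_imp_poly_has_root by blast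
  then have t: "s ^ 3 + e + s ^ 2 * t + s * t ^ 2 + t ^ 3 = 0"
    by (simp add: algebra_simps power2_eq_square power3_eq_cube)
  have "t ^ 4 + e * t + f = (s ^ 4 + e * s + f) + (t - s) * (s ^ 3 + e + s ^ 2 * t + s * t ^ 2 + t ^ 3)"
    by (simp add: algebra_simps power2_eq_square power3_eq_cube power4_eq_xxxx)
  then have t4: "t ^ 4 + e * t + f = 0" using s t by simp
  have "s \<noteq> t"
  proof
    assume "s = t"
    then have "f = (s ^ 4 + e * s + f) - s * (s ^ 3 + e + s ^ 2 * t + s * t ^ 2 + t ^ 3) + 3 * s ^ 4"
      by (simp add: algebra_simps power2_eq_square power3_eq_cube power4_eq_xxxx)
    then show False using f s t three_0 by simp
  qed
  then show ?thesis using that s t4 by blast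
qed

text \<open>Eliminating the second unknown as (z^3 - \<alpha> z) / \<beta> leaves z (z^8 + e z^2 +
  f) = 0, a quartic in z^2 whose constant term is \<beta>^2 times the determinant. Four solutions
  are enough to exclude the count 3.\<close>

lemma card_frobenius_fixed_neq_3_aux:
  assumes det: "\<alpha> * \<delta> - \<beta> * \<gamma> \<noteq> (0 :: 'a)" and \<beta>: "\<beta> \<noteq> 0"
  shows "card (frobenius_fixed \<alpha> \<beta> \<gamma> \<delta>) \<noteq> 3"
proof -
  define e where "e = - (\<alpha> ^ 3 + \<delta> * \<beta> ^ 2)"
  define f where "f = \<beta> ^ 2 * (\<alpha> * \<delta> - \<beta> * \<gamma>)"
  have "f \<noteq> 0" using det \<beta> by (simp add: f_def)
  then obtain s t where st: "s ^ 4 + e * s + f = 0" "t ^ 4 + e * t + f = 0" "s \<noteq> t"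
    by (rule two_quartic_roots)
  obtain a c where ac: "a ^ 2 = s" "c ^ 2 = t" using sqrt_exists by metis
  have nz: "a \<noteq> 0" "c \<noteq> 0" using st ac \<open>f \<noteq> 0\<close> by auto
  have sol: "(z, (z ^ 3 - \<alpha> * z) / \<beta>) \<in> frobenius_fixed \<alpha> \<beta> \<gamma> \<delta>" if "z * ((z ^ 2) ^ 4 + e * z ^ 2 + f) = 0" for z
  proof -
    have "(z ^ 3 - \<alpha> * z) ^ 3 = (z ^ 3) ^ 3 + (- \<alpha> * z) ^ 3" using cube_sum[of "z ^ 3" "- \<alpha> * z"] by simp
    also have "\<dots> = z * ((z ^ 2) ^ 4 + e * z ^ 2 + f) + \<beta> ^ 3 * \<gamma> * z + \<delta> * \<beta> ^ 2 * (z ^ 3 - \<alpha> * z)"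
      unfolding e_def f_def by Groebner_Basis.algebra
    finally have w: "(z ^ 3 - \<alpha> * z) ^ 3 = \<beta> ^ 3 * \<gamma> * z + \<delta> * \<beta> ^ 2 * (z ^ 3 - \<alpha> * z)" using that by simp
    have "w ^ 3 = \<beta> ^ 3 * \<gamma> * z + \<delta> * \<beta> ^ 2 * w \<Longrightarrow> (w / \<beta>) ^ 3 = \<gamma> * z + \<delta> * (w / \<beta>)" for w
      using \<beta> by (simp add: power_divide field_simps) (simp add: power2_eq_square power3_eq_cube algebra_simps)
    from this[OF w] have "((z ^ 3 - \<alpha> * z) / \<beta>) ^ 3 = \<gamma> * z + \<delta> * ((z ^ 3 - \<alpha> * z) / \<beta>)" .
    then show ?thesis using \<beta> by (simp add: frobenius_fixed_def)
  qed
  let ?P = "\<lambda>z. (z, (z ^ 3 - \<alpha> * z) / \<beta>)"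
  have "{?P 0, ?P a, ?P (- a), ?P c} \<subseteq> frobenius_fixed \<alpha> \<beta> \<gamma> \<delta>"
    using sol[of 0] sol[of a] sol[of "- a"] sol[of c] st ac by simp
  moreover have "distinct [?P 0, ?P a, ?P (- a), ?P c]"
    using nz st(3) ac neq_uminus[OF nz(1)] by auto
  ultimately show ?thesis by (rule card_neq_3)
qed

lemma frobenius_fixed_swap: "card (frobenius_fixed (\<delta> :: 'a) \<gamma> \<beta> \<alpha>) = card (frobenius_fixed \<alpha> \<beta> \<gamma> \<delta>)"
proof -
  have "frobenius_fixed \<delta> \<gamma> \<beta> \<alpha> = prod.swap ` frobenius_fixed \<alpha> \<beta> \<gamma> \<delta>"
    by (auto simp: frobenius_fixed_def image_iff add.commute)
  then show ?thesis by (simp add: card_image)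
qed

lemma card_frobenius_fixed_neq_3:
  assumes det: "\<alpha> * \<delta> - \<beta> * \<gamma> \<noteq> (0 :: 'a)"
  shows "card (frobenius_fixed \<alpha> \<beta> \<gamma> \<delta>) \<noteq> 3"
proof -
  consider "\<beta> \<noteq> 0" | "\<gamma> \<noteq> 0" | "\<beta> = 0" "\<gamma> = 0" by blast
  then show ?thesis
  proof cases
    case 1
    then show ?thesis using card_frobenius_fixed_neq_3_aux det by blast
  next
    case 2
    have "\<delta> * \<alpha> - \<gamma> * \<beta> \<noteq> 0" using det by (simp add: mult.commute)
    then show ?thesis using card_frobenius_fixed_neq_3_aux 2 frobenius_fixed_swap by metis
  next
    case 3
    then have nz: "\<alpha> \<noteq> 0" "\<delta> \<noteq> 0" using det by auto
    obtain s t where st: "s ^ 2 = \<alpha>" "t ^ 2 = \<delta>" using sqrt_exists by metis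
    then have "s \<noteq> 0" "t \<noteq> 0" using nz by auto
    moreover have "{(0, 0), (s, 0), (- s, 0), (0, t)} \<subseteq> frobenius_fixed \<alpha> \<beta> \<gamma> \<delta>"
      using 3 st by (simp add: frobenius_fixed_def power3_eq_cube power2_eq_square)
    ultimately show ?thesis using neq_uminus[of s] by (intro card_neq_3) auto
  qed
qed

end

section \<open>Rank one and the invariant J4\<close>

lemma rank_1_factorisation:
  fixes \<alpha> :: "'a::field"
  assumes "\<alpha> * \<delta> - \<beta> * \<gamma> = 0"
  obtains u1 u2 v1 v2 where "(u1, u2) \<noteq> (0, 0)" "\<alpha> = u1 * v1" "\<beta> = u1 * v2" "\<gamma> = u2 * v1" "\<delta> = u2 * v2"
proof -
  consider "\<alpha> \<noteq> 0" | "\<alpha> = 0" "\<gamma> \<noteq> 0" | "\<alpha> = 0" "\<gamma> = 0" "(\<beta>, \<delta>) \<noteq> (0, 0)" | "\<alpha> = 0" "\<beta> = 0" "\<gamma> = 0" "\<delta> = 0"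
    by auto
  then show ?thesis
  proof cases
    case 1
    then show ?thesis using that[of \<alpha> \<gamma> 1 "\<beta> / \<alpha>"] assms by (simp add: field_simps)
  next
    case 2
    then show ?thesis using that[of \<alpha> \<gamma> 1 "\<delta> / \<gamma>"] assms by (simp add: field_simps)
  next
    case 3
    then show ?thesis using that[of \<beta> \<delta> 0 1] by auto
  next
    case 4
    \<comment> \<open>The zero matrix is covered by v = 0, so that u is nonzero in every case, as
      \<open>cofactor_neq_0\<close> demands.\<close>
    then show ?thesis using that[of 1 0 0 0] by auto
  qed
qed

lemma order_ge_2_of_double_root:
  fixes p :: "'a::field poly"
  assumes "p \<noteq> 0" "poly p a = 0" "poly (pderiv p) a = 0"
  shows "Polynomial.order a p \<ge> 2"
proof -
  obtain q where q: "p = [:- a, 1:] * q" using assms(2) by (auto simp: poly_eq_0_iff_dvd)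
  then have "poly (pderiv p) a = poly q a" unfolding q pderiv_mult by (simp add: pderiv_pCons)
  then obtain r where "q = [:- a, 1:] * r" using assms(3) by (auto simp: poly_eq_0_iff_dvd)
  then have "p = [:- a, 1:] ^ 2 * r" using q by (simp only: power2_eq_square mult.assoc)
  then have "[:- a, 1:] ^ 2 dvd p" by (rule dvdI)
  then show ?thesis using assms(1) order_divides by blast
qed

text \<open>With \<open>A = u v\<^sup>T\<close> and \<open>p\<^sup>3 = u\<^sub>1\<close>, \<open>q\<^sup>3 = u\<^sub>2\<close>, the quantity below is the value at \<open>(-p : q)\<close> of the
  binary sextic, which has a vanishing derivative there.\<close>

lemma cofactor_neq_0:
  fixes F :: "'a::alg_closed_field poly"
  assumes char3: "CHAR('a) = 3" and deg: "Polynomial.degree F \<in> {5, 6}" and sf: "rsquarefree F"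
    and u: "(u1, u2) \<noteq> (0, 0)"
    and c: "Polynomial.coeff F 2 = u1 * v1" "Polynomial.coeff F 1 = u1 * v2"
      "Polynomial.coeff F 5 = u2 * v1" "Polynomial.coeff F 4 = u2 * v2"
  shows "Polynomial.coeff F 6 * u1 ^ 2 - Polynomial.coeff F 3 * u1 * u2 + Polynomial.coeff F 0 * u2 ^ 2 \<noteq> 0"
proof
  assume G: "Polynomial.coeff F 6 * u1 ^ 2 - Polynomial.coeff F 3 * u1 * u2 + Polynomial.coeff F 0 * u2 ^ 2 = 0"
  note three = three_0[OF char3]
  obtain p q where pq: "p ^ 3 = u1" "q ^ 3 = u2" using cbrt_exists[OF char3] by metis
  have F0: "F \<noteq> 0" using deg by auto
  have F_eq: "F = [:Polynomial.coeff F 0, u1 * v2, u1 * v1, Polynomial.coeff F 3, u2 * v2, u2 * v1, Polynomial.coeff F 6:]"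
    (is "_ = ?F")
  proof (rule poly_eqI)
    fix n
    show "Polynomial.coeff F n = Polynomial.coeff ?F n"
    proof (cases "n \<le> 6")
      case True
      then have "n \<in> {0, 1, 2, 3, 4, 5, 6}" by auto
      then show ?thesis using c by (auto simp: numeral_eq_Suc)
    next
      case False
      then obtain m where "n = Suc (Suc (Suc (Suc (Suc (Suc (Suc m))))))" by (auto simp: not_le less_eq_Suc_le dest!: le_Suc_ex)
      moreover have "Polynomial.coeff F n = 0" using False deg by (intro coeff_eq_0) auto
      ultimately show ?thesis by simp
    qed
  qed
  show False
  proof (cases "q = 0")
    case True
    \<comment> \<open>Here the point (-p : q) is infinity, and a double root there lowers the degree
      below 5.\<close>
    then have "u2 = 0" "u1 \<noteq> 0" using pq u by auto
    then have "Polynomial.coeff F 5 = 0" "Polynomial.coeff F 6 = 0" using G c by auto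
    then have "Polynomial.coeff F (Polynomial.degree F) = 0" using deg by (metis insertE singletonD)
    then show False using F0 by simp
  next
    case False
    define t where "t = - (p / q)"
    have p: "p = - (t * q)" using False by (simp add: t_def)
    have u: "u1 = - (t ^ 3 * q ^ 3)" "u2 = q ^ 3" using pq by (simp_all add: p power_mult_distrib)
    have "q ^ 6 * poly F t = Polynomial.coeff F 6 * u1 ^ 2 - Polynomial.coeff F 3 * u1 * u2 + Polynomial.coeff F 0 * u2 ^ 2"
      by (subst F_eq) (simp add: u algebra_simps power2_eq_square power_add[symmetric] eval_nat_numeral)
    then have "poly F t = 0" using G False by simp
    \<comment> \<open>Modulo 3 the derivative is (u1 + u2 t^3)(v2 - v1 t), and u1 + u2 t^3 = 0 by
      the choice of t.\<close>
    moreover have "poly (pderiv F) t = 3 * (2 * Polynomial.coeff F 6 * t ^ 5 + 2 * u2 * v1 * t ^ 4 + u2 * v2 * t ^ 3 + Polynomial.coeff F 3 * t ^ 2 + u1 * v1 * t)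
        - (t ^ 4 * u2 * v1 + t * u1 * v1) + (u2 * v2 * t ^ 3 + u1 * v2)"
      by (subst F_eq) (simp add: pderiv_pCons algebra_simps eval_nat_numeral)
    then have "poly (pderiv F) t = - (t ^ 4 * u2 * v1 + t * u1 * v1) + (u2 * v2 * t ^ 3 + u1 * v2)" by (simp only: three) simp
    then have "poly (pderiv F) t = 0" by (simp add: u algebra_simps eval_nat_numeral)
    ultimately have "Polynomial.order t F \<ge> 2" using order_ge_2_of_double_root[OF F0] by blast
    moreover have "Polynomial.order t F \<le> 1" using sf by (metis le_numeral_extra(4) One_nat_def rsquarefree_def zero_le_one)
    ultimately show False by simp
  qed
qed

text \<open>For A = u v^T, \<open>J4_char3\<close> factors as (v1^3 u1 + v2^3 u2) times the quantity
  of \<open>cofactor_neq_0\<close>. The latter is nonzero, and the former decides between three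
  solutions and the zero solution alone.\<close>

lemma card_frobenius_fixed_iff:
  fixes F :: "'a::alg_closed_field poly"
  assumes char3: "CHAR('a) = 3" and deg: "Polynomial.degree F \<in> {5, 6}" and sf: "rsquarefree F"
  defines "c \<equiv> Polynomial.coeff F"
  shows "card (frobenius_fixed (c 2) (c 1) (c 5) (c 4)) = 3 \<longleftrightarrow> J2_char3 c = 0 \<and> J4_char3 c \<noteq> 0"
proof (cases "J2_char3 c = 0")
  case False
  then show ?thesis using card_frobenius_fixed_neq_3[OF char3] by (simp add: J2_char3_def)
next
  case True
  then obtain u1 u2 v1 v2 where u: "(u1, u2) \<noteq> (0, 0)"
    and c: "c 2 = u1 * v1" "c 1 = u1 * v2" "c 5 = u2 * v1" "c 4 = u2 * v2"
    unfolding J2_char3_def by (rule rank_1_factorisation)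
  obtain p q where pq: "p ^ 3 = u1" "q ^ 3 = u2" using cbrt_exists[OF char3] by metis
  have "J4_char3 c = (v1 ^ 3 * u1 + v2 ^ 3 * u2) * (c 6 * u1 ^ 2 - c 3 * u1 * u2 + c 0 * u2 ^ 2)"
    unfolding J4_char3_def c by Groebner_Basis.algebra
  moreover have "c 6 * u1 ^ 2 - c 3 * u1 * u2 + c 0 * u2 ^ 2 \<noteq> 0"
    using cofactor_neq_0[OF char3 deg sf u] c unfolding c_def .
  ultimately have "J4_char3 c \<noteq> 0 \<longleftrightarrow> v1 ^ 3 * u1 + v2 ^ 3 * u2 \<noteq> 0" by simp
  then show ?thesis
    unfolding c using card_frobenius_fixed_rank_1[OF char3 pq u, of v1 v2] True by simp
qed

lemma (in hyperelliptic) torsion_Pic0_3_iso_iff: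
  "torsion (Pic0 F) 3 \<cong> product_group {..<1 :: nat} (\<lambda>_. integer_mod_group 3) \<longleftrightarrow>
     J2_char3 (Polynomial.coeff F) = 0 \<and> J4_char3 (Polynomial.coeff F) \<noteq> 0"
proof -
  have "V = frobenius_fixed (Polynomial.coeff F 2) (Polynomial.coeff F 1) (Polynomial.coeff F 5) (Polynomial.coeff F 4)"
    by (simp add: V_def frobenius_fixed_def)
  then show ?thesis
    using group.iso_cyclic_3_iff[OF group_torsion torsion_exponent] card_torsion
      card_frobenius_fixed_iff[OF char3 deg_F sf] by simp
qed

text \<open>In characteristic 3 both invariants have coefficients in the prime field, so they
  commute with passage to the algebraic closure, where the torsion is computed.\<close>

lemma non_ordinary_iff:
  fixes F :: "'k::field poly"
  assumes char3: "CHAR('k) = 3" and model: "genus2_model F"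
  shows "non_ordinary F \<longleftrightarrow> J2 F = 0 \<and> J4 F \<noteq> 0"
proof -
  interpret comm_ring_hom "to_ac :: 'k \<Rightarrow> _" by (rule to_ac_comm_ring_hom)
  interpret hyperelliptic "map_poly to_ac F"
    using model char3 by unfold_locales (simp_all add: genus2_model_def degree_map_poly)
  have coeff: "Polynomial.coeff (map_poly to_ac F) i = to_ac (Polynomial.coeff F i)" for i
    by (simp add: coeff_map_poly)
  have "J2_char3 (Polynomial.coeff (map_poly to_ac F)) = to_ac (J2 F)"
    "J4_char3 (Polynomial.coeff (map_poly to_ac F)) = to_ac (J4 F)"
    unfolding J2_char3[OF assms(1)] J4_char3[OF assms(1)] J2_char3_def J4_char3_def coeff by (simp_all add: hom_distribs)
  then show ?thesis
    unfolding non_ordinary_def has_p_rank_def Jac_def assms(1) using torsion_Pic0_3_iso_iff by simp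
qed

theorem theorem1:
  fixes F :: "'k::{field, finite} poly" and g1 g2 g3 :: 'k
  assumes "CHAR('k) = 3"
    and "genus2_model F"
    and "absolute_invariants F = (g1, g2, g3)"
  shows "non_ordinary F \<longleftrightarrow> g1 = 0 \<and> g2 \<in> (UNIV :: 'k set) - {0} \<and> g3 \<in> (UNIV :: 'k set)"
proof -
  have "(2 :: 'k) \<noteq> 0" unfolding char3_numeral(2)[OF assms(1)] neg_equal_0_iff_equal by (rule one_neq_zero)
  then have "J10 F \<noteq> 0" using J10_nonzero assms(2) by blast
  \<comment> \<open>With \<open>J10 F\<close> nonzero, g1 = 0 excludes the branch with
    \<open>J2 F\<close> nonzero, and of the other two branches g2 is nonzero exactly in the one with
    \<open>J4 F\<close> nonzero.\<close>
  then show ?thesis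
    using non_ordinary_iff[OF assms(1,2)] assms(3) by (auto simp: absolute_invariants_def split: if_splits)
qed

end
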